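(* For a prime $p$ let $V_p$ be the number of pairs $(x,y)\in\mathbb{F}_p^2$ satisfying both $x^4+6x^2-3=0$ and $y^2=x^3-x$. Then there are infinitely many primes $p\equiv 1\pmod{12}$ with $V_p>0$. However, there is no sub-congruence class of $p\equiv 1 \pmod{12}$ on which $V_p>0$ for all primes $p$ in it: for every positive integer $m$ divisible by $12$ and every integer $c$ with $c\equiv 1\pmod{12}$ and $\gcd(c,m)=1$, there exists a prime $p\equiv c\pmod m$ with $V_p=0$. *)

theory Defs
  imports "HOL-Number_Theory.Number_Theory"
begin

definition V :: "nat \<Rightarrow> nat" where
  "V p = card {(x::int, y::int). x \<in> {0..<int p} \<and> y \<in> {0..<int p} \<and>
      [x^4 + 6*x^2 - 3 = 0] (mod int p) \<and> [y^2 = x^3 - x] (mod int p)}"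

end

theory Submission
  imports "HOL-Complex_Analysis.Complex_Analysis" "HOL-Real_Asymp.Real_Asymp" Defs
begin

text \<open>
  Let \<open>p \<equiv> 1 (mod 12)\<close> and \<open>x\<^sup>4 + 6x\<^sup>2 - 3 = 0\<close> in \<open>F\<^sub>p\<close>. With \<open>r = (x\<^sup>2 + 3)/2\<close> we have \<open>r\<^sup>2 = 3\<close>,
  \<open>2x\<^sup>2 = r(r - 1)\<^sup>2\<close> and \<open>x\<^sup>3 - x = -x(r - 1)\<^sup>2\<close>. Hence \<open>V\<^sub>p > 0\<close> as soon as \<open>z\<^sup>8 + 6z\<^sup>4 - 3\<close> has a
  root \<open>z\<close> (take \<open>x = z\<^sup>2\<close>), and a Euclid-style argument applied to the values of this polynomial
  at Gaussian integers \<open>n + \<i>\<close> gives infinitely many such \<open>p\<close>.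

  Conversely, a solution \<open>x\<close> makes \<open>2r\<close> a square, and then \<open>\<surd>-3\<close> as well because \<open>2\<i> = (1 + \<i>)\<^sup>2\<close>.
  If \<open>p = c\<^sup>2 + 3d\<^sup>2\<close>, quadratic reciprocity expresses the quadratic character of \<open>\<surd>-3 = \<plusminus>c/d\<close> modulo \<open>p\<close>
  by the residues of \<open>c\<close> modulo 12 and of \<open>d\<close> modulo 4. So a prime with \<open>V\<^sub>p = 0\<close> in a given class is the norm of an
  Eisenstein prime in a suitable residue class, and such a prime exists by Dirichlet's theorem for the
  Eisenstein integers. That theorem is proved analytically: \<open>L\<close>-functions of nonprincipal ray class characters
  continue to \<open>Re s > 0\<close> by grouping the lattice into blocks and taking second differences, and if one of them
  vanished at 1, Landau's argument applied to the product of all of them would make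
  \<open>\<Sum> log N(\<pi>) / N(\<pi>)\<close> converge.
\<close>

section \<open>The Eisenstein integers\<close>

text \<open>The quadratic character of \<surd>-3 modulo p is not a function of p modulo any m: the
  field that governs it is not abelian over the rationals, so Dirichlet's theorem over the integers
  cannot reach it. The field becomes abelian over the cube roots of unity, which is why primes are
  sought among Eisenstein integers. In p = c^2 + 3 d^2 the classes c = 1 and c = 5 modulo 12 have
  the same square modulo 24, so p modulo 24 does not see the difference, but the quadratic character
  of c modulo p does; this freedom defeats every sub-class. The constructed primes admit no root x
  of the quartic at all. In the other direction p = 1 modulo 12 has to come out of the construction.
  A root of the octic makes 12 a square, which leaves p = 1 or 11 modulo 12; taking values at
  Gaussian integers also makes -1 a square and removes the second case. Real and complex characters
  need no separate treatment in the analytic part: the product over all characters has a simple pole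
  at most, and one zero already cancels it.\<close>

datatype eis = Eis (eis_re: int) (eis_om: int)

lemma eis_eq_iff: "x = y \<longleftrightarrow> eis_re x = eis_re y \<and> eis_om x = eis_om y"
  by (cases x; cases y) auto

instantiation eis :: comm_ring_1
begin
definition "0 = Eis 0 0"
definition "1 = Eis 1 0"
definition "x + y = Eis (eis_re x + eis_re y) (eis_om x + eis_om y)"
definition "x - y = Eis (eis_re x - eis_re y) (eis_om x - eis_om y)"
definition "- x = Eis (- eis_re x) (- eis_om x)"
text \<open>\<open>Eis a b\<close> stands for a + b \<omega> with \<omega> a primitive cube root of
  unity; the product uses \<omega>^2 = -1 - \<omega>.\<close>

definition "x * y = Eis (eis_re x * eis_re y - eis_om x * eis_om y)
   (eis_re x * eis_om y + eis_om x * eis_re y - eis_om x * eis_om y)"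
instance
  by standard (auto simp: zero_eis_def one_eis_def plus_eis_def minus_eis_def uminus_eis_def
     times_eis_def algebra_simps)
end

lemma eis_sel [simp]:
  "eis_re 0 = 0" "eis_om 0 = 0" "eis_re 1 = 1" "eis_om 1 = 0"
  "eis_re (x + y) = eis_re x + eis_re y" "eis_om (x + y) = eis_om x + eis_om y"
  "eis_re (x - y) = eis_re x - eis_re y" "eis_om (x - y) = eis_om x - eis_om y"
  "eis_re (- x) = - eis_re x" "eis_om (- x) = - eis_om x"
  "eis_re (x * y) = eis_re x * eis_re y - eis_om x * eis_om y"
  "eis_om (x * y) = eis_re x * eis_om y + eis_om x * eis_re y - eis_om x * eis_om y"
  by (auto simp: zero_eis_def one_eis_def plus_eis_def minus_eis_def uminus_eis_def times_eis_def)

lemma eis_of_nat_sel [simp]: "eis_re (of_nat n) = int n" "eis_om (of_nat n) = 0"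
  by (induction n) auto

lemma eis_of_int_sel [simp]: "eis_re (of_int n) = n" "eis_om (of_int n) = 0"
  by (cases n; simp)+

definition eis_cnj :: "eis \<Rightarrow> eis" where
  "eis_cnj x = Eis (eis_re x - eis_om x) (- eis_om x)"

lemma eis_cnj_sel [simp]: "eis_re (eis_cnj x) = eis_re x - eis_om x" "eis_om (eis_cnj x) = - eis_om x"
  by (auto simp: eis_cnj_def)

definition enorm :: "eis \<Rightarrow> int" where
  "enorm x = (eis_re x)\<^sup>2 - eis_re x * eis_om x + (eis_om x)\<^sup>2"

lemma enorm_mult: "enorm (x * y) = enorm x * enorm y"
  by (simp add: enorm_def power2_eq_square algebra_simps)

lemma mult_eis_cnj: "x * eis_cnj x = of_int (enorm x)"
  by (simp add: eis_eq_iff enorm_def power2_eq_square algebra_simps)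

lemma enorm_ge_sum_squares: "2 * enorm x \<ge> (eis_re x)\<^sup>2 + (eis_om x)\<^sup>2"
proof -
  have "2 * enorm x = (eis_re x)\<^sup>2 + (eis_om x)\<^sup>2 + (eis_re x - eis_om x)\<^sup>2"
    by (simp add: enorm_def power2_eq_square algebra_simps)
  then show ?thesis by simp
qed

lemma enorm_nonneg [simp]: "enorm x \<ge> 0"
  using enorm_ge_sum_squares[of x] by (smt (verit) zero_le_power2)

lemma enorm_eq_0_iff [simp]: "enorm x = 0 \<longleftrightarrow> x = 0"
proof
  assume "enorm x = 0"
  then have "(eis_re x)\<^sup>2 + (eis_om x)\<^sup>2 \<le> 0" using enorm_ge_sum_squares[of x] by simp
  then show "x = 0" by (simp add: eis_eq_iff sum_power2_le_zero_iff)
qed (simp add: enorm_def)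

lemma enorm_0 [simp]: "enorm 0 = 0" and enorm_1 [simp]: "enorm 1 = 1"
  and enorm_minus [simp]: "enorm (- x) = enorm x" and enorm_of_int [simp]: "enorm (of_int n) = n\<^sup>2"
  by (auto simp: enorm_def)

lemma enorm_pos_iff [simp]: "enorm x > 0 \<longleftrightarrow> x \<noteq> 0"
  using enorm_nonneg[of x] enorm_eq_0_iff[of x] by linarith

lemma enorm_power: "enorm (x ^ n) = enorm x ^ n"
  by (induction n) (auto simp: enorm_mult)

instance eis :: idom
proof
  fix x y :: eis
  assume "x \<noteq> 0" "y \<noteq> 0"
  then show "x * y \<noteq> 0"
    using enorm_mult[of x y] enorm_eq_0_iff by (metis mult_eq_0_iff)
qed

lemma enorm_eq_1_imp_unit: "enorm x = 1 \<Longrightarrow> x dvd 1"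
  using mult_eis_cnj[of x] by (metis dvdI of_int_1)

lemma eis_unit_imp_enorm: "x dvd 1 \<Longrightarrow> enorm x = 1"
proof -
  assume "x dvd (1::eis)"
  then obtain y where "1 = x * y" by (auto elim: dvdE)
  then have "enorm x * enorm y = 1" using enorm_mult by (metis enorm_1)
  then show ?thesis using enorm_nonneg[of x] by (metis zmult_eq_1_iff not_one_le_zero  neg_0_le_iff_le)
qed

text \<open>Normalization wants one chosen element in each class of associates. An arbitrary choice
  does, since it depends on the class only; units are sent to 1 so that a unit is its own unit
  factor.\<close>

definition eis_rep :: "eis \<Rightarrow> eis" where
  "eis_rep x = (if x dvd 1 then 1 else SOME y. x dvd y \<and> y dvd x)"

lemma eis_rep: "x dvd eis_rep x" "eis_rep x dvd x"
proof -
  have "\<exists>y. x dvd y \<and> y dvd x" by (intro exI[of _ x]) simp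
  from someI_ex[OF this] show "x dvd eis_rep x" "eis_rep x dvd x"
    by (auto simp: eis_rep_def)
qed

lemma eis_rep_cong:
  assumes "x dvd y" "y dvd x"
  shows "eis_rep x = eis_rep y"
proof -
  have "(\<lambda>z. x dvd z \<and> z dvd x) = (\<lambda>z. y dvd z \<and> z dvd y)"
    using assms by (auto intro: dvd_trans)
  moreover have "x dvd 1 \<longleftrightarrow> y dvd 1" using assms by (auto intro: dvd_trans)
  ultimately show ?thesis by (simp add: eis_rep_def)
qed

section \<open>Division with remainder by rounding\<close>

definition int_round_div :: "int \<Rightarrow> int \<Rightarrow> int" where
  "int_round_div u n = (2 * u + n) div (2 * n)"

lemma int_round_div_bound:
  assumes "n > 0" shows "\<bar>2 * (u - int_round_div u n * n)\<bar> \<le> n"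
proof -
  have "2 * u + n = 2 * n * int_round_div u n + (2 * u + n) mod (2 * n)"
    by (simp add: int_round_div_def)
  moreover have "(2 * u + n) mod (2 * n) < 2 * n" "(2 * u + n) mod (2 * n) \<ge> 0"
    using assms by auto
  ultimately show ?thesis by (simp add: algebra_simps)
qed

lemma int_round_div_mult [simp]:
  assumes "n > 0" shows "int_round_div (k * n) n = k"
proof -
  have "(n + k * (2 * n)) div (2 * n) = k + n div (2 * n)"
    using assms by (intro div_mult_self1) simp
  also have "n div (2 * n) = 0" using assms by simp
  finally show ?thesis by (simp add: int_round_div_def algebra_simps)
qed

instantiation eis :: idom_modulo
begin
definition divide_eis :: "eis \<Rightarrow> eis \<Rightarrow> eis" where
  "x div y = (if y = 0 then 0 else
     Eis (int_round_div (eis_re (x * eis_cnj y)) (enorm y))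
       (int_round_div (eis_om (x * eis_cnj y)) (enorm y)))"
definition modulo_eis :: "eis \<Rightarrow> eis \<Rightarrow> eis" where
  "x mod y = x - x div y * (y :: eis)"
instance
proof
  fix x y :: eis
  show "x * y div y = x" if "y \<noteq> 0"
  proof -
    have e: "x * y * eis_cnj y = x * of_int (enorm y)" by (simp add: mult.assoc mult_eis_cnj)
    have "x * y div y = Eis (int_round_div (eis_re (x * of_int (enorm y))) (enorm y))
        (int_round_div (eis_om (x * of_int (enorm y))) (enorm y))"
      using that by (simp only: divide_eis_def e if_False)
    then show ?thesis using that by simp
  qed
qed (auto simp: modulo_eis_def divide_eis_def)
end

text \<open>Each coordinate of x / y is rounded with an error of at most 1/2, so the remainder
  divided by y has norm at most 1/4 + 1/4 + 1/4 = 3/4. Working with \<open>x * eis_cnj y\<close>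
  over \<open>enorm y\<close> keeps everything in the integers.\<close>

lemma enorm_mod_less:
  fixes x y :: eis assumes "y \<noteq> 0" shows "enorm (x mod y) < enorm y"
proof -
  define z n where "z = x * eis_cnj y" and "n = enorm y"
  have n: "n > 0" using assms by (simp add: n_def)
  define r where "r = z - (x div y) * of_int n"
  have "(x mod y) * eis_cnj y = r"
    by (simp add: r_def z_def modulo_eis_def algebra_simps n_def flip: mult_eis_cnj)
  moreover have "enorm (eis_cnj y) = n" by (simp add: n_def enorm_def power2_eq_square algebra_simps)
  ultimately have 1: "enorm (x mod y) * n = enorm r" by (metis enorm_mult)
  define a b where "a = eis_re r" and "b = eis_om r"
  have ab: "\<bar>2 * a\<bar> \<le> n" "\<bar>2 * b\<bar> \<le> n"
    using int_round_div_bound[OF n] assms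
    by (auto simp: a_def b_def r_def divide_eis_def simp flip: z_def n_def)
  have "4 * enorm r = (2*a)\<^sup>2 - (2*a)*(2*b) + (2*b)\<^sup>2"
    by (simp add: enorm_def a_def b_def power2_eq_square)
  moreover have "(2*a)\<^sup>2 \<le> n\<^sup>2" "(2*b)\<^sup>2 \<le> n\<^sup>2"
    using ab n by (metis abs_le_square_iff abs_of_pos)+
  moreover have "- ((2*a)*(2*b)) \<le> n * n"
    using mult_mono[OF ab] n by (simp add: abs_mult flip: abs_mult)
  ultimately have "4 * (enorm (x mod y) * n) \<le> 3 * (n * n)" using 1 by (simp add: power2_eq_square)
  then have "4 * enorm (x mod y) \<le> 3 * n" using n by (simp add: mult.assoc[symmetric])
  then show ?thesis using n unfolding n_def by linarith
qed

lemma eis_rep_zero [simp]: "eis_rep 0 = 0" using eis_rep[of 0] by simp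

lemma eis_rep_eq_0_iff [simp]: "eis_rep x = 0 \<longleftrightarrow> x = 0" using eis_rep[of x] by auto

text \<open>This makes \<open>prime\<close>, \<open>multiplicity\<close> and
  \<open>prime_factorization\<close> available. The chosen associates need not be closed under
  multiplication, so factorizations are used up to a unit only.\<close>

instantiation eis :: normalization_euclidean_semiring
begin
definition euclidean_size_eis :: "eis \<Rightarrow> nat" where "euclidean_size_eis x = nat (enorm x)"
definition normalize_eis :: "eis \<Rightarrow> eis" where "normalize_eis = eis_rep"
definition unit_factor_eis :: "eis \<Rightarrow> eis" where "unit_factor_eis x = x div eis_rep x"
instance
proof
  fix a b :: eis
  show "b \<noteq> 0 \<Longrightarrow> euclidean_size (a mod b) < euclidean_size b"
    using enorm_mod_less[of b a] by (simp add: euclidean_size_eis_def)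
  show "b \<noteq> 0 \<Longrightarrow> euclidean_size a \<le> euclidean_size (a * b)"
  proof -
    assume "b \<noteq> 0"
    then have "enorm b \<ge> 1" using enorm_pos_iff[of b] by linarith
    then have "enorm a * 1 \<le> enorm a * enorm b" by (intro mult_left_mono) auto
    then show "euclidean_size a \<le> euclidean_size (a * b)"
      by (simp add: euclidean_size_eis_def enorm_mult)
  qed
  show "unit_factor a * normalize a = a"
    using eis_rep(2)[of a] by (simp add: unit_factor_eis_def normalize_eis_def)
  show "normalize (0::eis) = 0" by (simp add: normalize_eis_def)
  show "unit_factor a = a" if "a dvd 1" using that
    using nonzero_mult_div_cancel_right[of 1 a] by (simp add: unit_factor_eis_def eis_rep_def)
  show "unit_factor a dvd 1" if "a \<noteq> 0"
  proof -
    obtain k where k: "a = k * eis_rep a" using eis_rep(2)[of a] by (metis dvdE mult.commute)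
    obtain l where l: "eis_rep a = l * a" using eis_rep(1)[of a] by (metis dvdE mult.commute)
    have "a * 1 = a * (k * l)" using k l by (metis mult.commute mult.left_commute mult.right_neutral)
    then have "k * l = 1" using that by (metis mult_cancel_left)
    moreover have "unit_factor a = k" using that k nonzero_mult_div_cancel_right[of "eis_rep a" k]
      by (simp add: unit_factor_eis_def)
    ultimately show ?thesis by (metis dvdI)
  qed
  show "unit_factor (a * b) = a * unit_factor b" if "a dvd 1"
  proof -
    from that obtain a' where a': "1 = a * a'" by (auto elim: dvdE)
    have "b = a * b * a'" using a' by (metis mult.assoc mult.commute mult_1)
    then have rep: "eis_rep (a * b) = eis_rep b"
      by (intro eis_rep_cong) (metis dvd_triv_left, simp)
    show ?thesis
    proof (cases "b = 0")
      case False
      obtain k where k: "b = k * eis_rep b" using eis_rep(2)[of b] by (metis dvdE mult.commute)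
      have "a * b = (a * k) * eis_rep b" using k by (metis mult.assoc)
      then show ?thesis using rep False k
        by (metis nonzero_mult_div_cancel_right eis_rep_eq_0_iff unit_factor_eis_def)
    qed (simp add: unit_factor_eis_def)
  qed
qed (simp_all add: euclidean_size_eis_def unit_factor_eis_def divide_eis_def)
end

instance eis :: factorial_semiring ..

section \<open>Ray class characters\<close>

text \<open>A substitute for subgroups inside a monoid without inverses: closure under those
  quotients that exist in \<open>P\<close>. It lets characters be extended directly on the elements
  coprime to the modulus, with no quotient group to build.\<close>

definition saturated_in :: "'a::comm_monoid_mult set \<Rightarrow> 'a set \<Rightarrow> bool" where
  "saturated_in P S \<longleftrightarrow> S \<subseteq> P \<and> 1 \<in> S \<and> (\<forall>x\<in>S. \<forall>y\<in>S. x * y \<in> S) \<and>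
     (\<forall>x\<in>P. \<forall>y\<in>S. x * y \<in> S \<longrightarrow> x \<in> S)"

definition char_on :: "'a::comm_monoid_mult set \<Rightarrow> ('a \<Rightarrow> complex) \<Rightarrow> bool" where
  "char_on S \<phi> \<longleftrightarrow> (\<forall>x\<in>S. \<forall>y\<in>S. \<phi> (x * y) = \<phi> x * \<phi> y) \<and> (\<forall>x\<in>S. \<phi> x \<noteq> 0)"

lemma saturated_in_power: "saturated_in P S \<Longrightarrow> x \<in> S \<Longrightarrow> x ^ n \<in> S"
  by (induction n) (auto simp: saturated_in_def)

lemma char_on_one: assumes "saturated_in P S" "char_on S \<phi>" shows "\<phi> 1 = 1"
proof -
  have "1 \<in> S" using assms by (auto simp: saturated_in_def)
  then have "\<phi> (1 * 1) = \<phi> 1 * \<phi> 1" "\<phi> 1 \<noteq> 0" using assms unfolding char_on_def by blast+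
  then show ?thesis by simp
qed

lemma char_on_power:
  assumes "saturated_in P S" "char_on S \<phi>" "x \<in> S" shows "\<phi> (x ^ n) = \<phi> x ^ n"
proof (induction n)
  case (Suc n)
  then show ?case using assms saturated_in_power[OF assms(1,3), of n] by (simp add: char_on_def)
qed (use char_on_one[OF assms(1,2)] in simp)

text \<open>The classical extension of a character from a group H to the group generated by H and a:
  with n the order of a modulo H, the value at a may be any n-th root of the value at a^n. As
  inverses are missing, the larger set consists of those x that some power of \<open>a\<close>
  carries into \<open>S\<close>.\<close>

lemma char_extend_step:
  fixes P S :: "'a::comm_monoid_mult set"
  assumes P: "\<And>x y. x \<in> P \<Longrightarrow> y \<in> P \<Longrightarrow> x * y \<in> P" "1 \<in> P"
    and S: "saturated_in P S" and \<phi>: "char_on S \<phi>" and a: "a \<in> P"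
    and n: "n > 0" "a ^ n \<in> S" "\<And>k. 0 < k \<Longrightarrow> k < n \<Longrightarrow> a ^ k \<notin> S"
    and \<zeta>: "\<zeta> ^ n = \<phi> (a ^ n)"
  shows "\<exists>S' \<phi>'. saturated_in P S' \<and> char_on S' \<phi>' \<and> S \<subseteq> S' \<and> a \<in> S' \<and>
           (\<forall>x\<in>S. \<phi>' x = \<phi> x) \<and> \<phi>' a = \<zeta>"
proof -
  have Pp: "a ^ k \<in> P" for k using P a by (induction k) auto
  have Sm: "x * y \<in> S" if "x \<in> S" "y \<in> S" for x y using S that by (auto simp: saturated_in_def)
  have Ss: "x \<in> S" if "x \<in> P" "y \<in> S" "x * y \<in> S" for x y
    using S that unfolding saturated_in_def by blast
  have SP: "x \<in> P" if "x \<in> S" for x using S that by (auto simp: saturated_in_def)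
  have \<phi>m: "\<phi> (x * y) = \<phi> x * \<phi> y" if "x \<in> S" "y \<in> S" for x y using \<phi> that by (auto simp: char_on_def)
  have \<phi>0: "\<phi> x \<noteq> 0" if "x \<in> S" for x using \<phi> that by (auto simp: char_on_def)
  have \<zeta>0: "\<zeta> \<noteq> 0" using \<zeta> \<phi>0[OF n(2)] n(1) by (metis power_0_left less_irrefl)
  have pow: "\<phi> (a ^ d) = \<zeta> ^ d" if "a ^ d \<in> S" for d
  proof -
    have "a ^ d = a ^ (d mod n) * (a ^ n) ^ (d div n)"
      by (metis mod_mult_div_eq power_add power_mult)
    then have "a ^ (d mod n) \<in> S" using Ss[OF Pp saturated_in_power[OF S n(2)]] that by metis
    then have "d mod n = 0" using n(1,3) by (metis mod_less_divisor neq0_conv)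
    then obtain q where "d = n * q" by auto
    then show ?thesis using char_on_power[OF S \<phi> n(2), of q] \<zeta> by (simp add: power_mult)
  qed
  define S' where "S' = {x\<in>P. \<exists>j. x * a ^ j \<in> S}"
  \<comment> \<open>Every admissible exponent j gives the same value, by \<open>wd\<close> below;
    \<open>SOME\<close> merely picks one.\<close>
  define \<phi>' where "\<phi>' x = (let j = (SOME j. x * a ^ j \<in> S) in \<phi> (x * a ^ j) / \<zeta> ^ j)" for x
  have wd: "\<phi> (x * a ^ j) / \<zeta> ^ j = \<phi> (x * a ^ k) / \<zeta> ^ k"
    if "x \<in> P" "x * a ^ j \<in> S" "x * a ^ k \<in> S" "j \<le> k" for x j k
  proof -
    have e: "x * a ^ k = a ^ (k - j) * (x * a ^ j)"
      using that(4) by (metis le_add_diff_inverse2 mult.assoc mult.commute power_add)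
    then have "a ^ (k - j) \<in> S" using Ss[OF Pp that(2)] that(3) by metis
    then have "\<phi> (x * a ^ k) = \<zeta> ^ (k - j) * \<phi> (x * a ^ j)"
      using \<phi>m[OF _ that(2)] pow e by metis
    moreover have "\<zeta> ^ k = \<zeta> ^ (k - j) * \<zeta> ^ j" using that(4) by (metis le_add_diff_inverse2 power_add)
    ultimately show ?thesis using \<zeta>0 by (simp add: field_simps)
  qed
  have \<phi>': "\<phi>' x = \<phi> (x * a ^ j) / \<zeta> ^ j" if "x \<in> P" "x * a ^ j \<in> S" for x j
  proof -
    define k where "k = (SOME j. x * a ^ j \<in> S)"
    have "x * a ^ k \<in> S" unfolding k_def using that(2) by (rule someI)
    then show ?thesis using wd[of x j k] wd[of x k j] that
      by (metis \<phi>'_def k_def nle_le)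
  qed
  have "saturated_in P S'"
    unfolding saturated_in_def
  proof (intro conjI ballI impI)
    show "S' \<subseteq> P" by (auto simp: S'_def)
    show "1 \<in> S'" using P S unfolding S'_def saturated_in_def by (auto intro: exI[of _ 0])
  next
    fix x y assume xy: "x \<in> S'" "y \<in> S'"
    then obtain j k where "x * a ^ j \<in> S" "y * a ^ k \<in> S" "x \<in> P" "y \<in> P" by (auto simp: S'_def)
    moreover have "(x * y) * a ^ (j + k) = (x * a ^ j) * (y * a ^ k)" by (simp add: power_add ac_simps)
    ultimately show "x * y \<in> S'" unfolding S'_def using Sm P by (metis (mono_tags, lifting) mem_Collect_eq)
  next
    fix x y assume xy: "x \<in> P" "y \<in> S'" "x * y \<in> S'"
    then obtain j k where jk: "y * a ^ j \<in> S" "x * y * a ^ k \<in> S" "y \<in> P" by (auto simp: S'_def)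
    \<comment> \<open>Chosen so that i + j = k + n j: then \<open>a ^ j\<close> can be moved onto
      \<open>y\<close>, and the surplus is a power of \<open>a ^ n\<close>, which lies in
      \<open>S\<close>. Since n > 0 the subtraction does not truncate.\<close>
    define i where "i = k + n * j - j"
    have ij: "i + j = k + n * j" using n(1) unfolding i_def by (cases n) auto
    have "x * a ^ i * (y * a ^ j) = x * y * a ^ (i + j)"
      by (simp add: power_add ac_simps)
    also have "\<dots> = (x * y * a ^ k) * (a ^ n) ^ j"
      unfolding ij by (simp add: power_add power_mult mult.assoc)
    also have "\<dots> \<in> S" by (intro Sm jk saturated_in_power[OF S n(2)])
    finally have "x * a ^ i \<in> S" using Ss[OF _ jk(1)] P(1)[OF xy(1) Pp] by blast
    then show "x \<in> S'" using xy by (auto simp: S'_def)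
  qed
  moreover have "char_on S' \<phi>'"
    unfolding char_on_def
  proof (intro conjI ballI)
    fix x y assume xy: "x \<in> S'" "y \<in> S'"
    then obtain j k where jk: "x * a ^ j \<in> S" "y * a ^ k \<in> S" "x \<in> P" "y \<in> P" by (auto simp: S'_def)
    have e: "(x * y) * a ^ (j + k) = (x * a ^ j) * (y * a ^ k)" by (simp add: power_add ac_simps)
    have "\<phi>' (x * y) = \<phi> ((x * y) * a ^ (j + k)) / \<zeta> ^ (j + k)"
      by (rule \<phi>') (use jk P e Sm in auto)
    then show "\<phi>' (x * y) = \<phi>' x * \<phi>' y"
      unfolding e using \<phi>'[OF jk(3,1)] \<phi>'[OF jk(4,2)] \<phi>m jk by (simp add: power_add)
  next
    fix x assume x: "x \<in> S'"
    then obtain j where j: "x * a ^ j \<in> S" "x \<in> P" by (auto simp: S'_def)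
    then show "\<phi>' x \<noteq> 0" using \<phi>'[OF j(2,1)] \<phi>0 \<zeta>0 by simp
  qed
  moreover have "S \<subseteq> S'" using SP by (auto simp: S'_def intro: exI[of _ 0])
  moreover have "\<phi>' x = \<phi> x" if "x \<in> S" for x using \<phi>'[of x 0] that SP by simp
  moreover have an: "a * a ^ (n - 1) = a ^ n" using n(1) by (metis power_eq_if neq0_conv)
  then have "a \<in> S'" using a n(2) unfolding S'_def by (metis (mono_tags, lifting) mem_Collect_eq)
  moreover have "\<phi>' a = \<zeta>"
  proof -
    have "\<phi>' a = \<zeta> ^ n / \<zeta> ^ (n - 1)" using \<phi>'[OF a, of "n - 1"] an n(2) \<zeta> by simp
    also have "\<zeta> ^ n = \<zeta> * \<zeta> ^ (n - 1)" using n(1) by (metis power_eq_if neq0_conv)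
    finally show ?thesis using \<zeta>0 by simp
  qed
  ultimately show ?thesis by blast
qed

text \<open>Finitely many new elements are enough for the application: a full set of residues modulo
  \<open>M\<close> stands for the whole monoid.\<close>

lemma char_extend_finite:
  fixes P S :: "'a::comm_monoid_mult set"
  assumes P: "\<And>x y. x \<in> P \<Longrightarrow> y \<in> P \<Longrightarrow> x * y \<in> P" "1 \<in> P"
    and S: "saturated_in P S" and \<phi>: "char_on S \<phi>"
    and tors: "\<And>a. a \<in> P \<Longrightarrow> \<exists>n>0. a ^ n \<in> S"
    and A: "finite A" "A \<subseteq> P"
  shows "\<exists>S' \<phi>'. saturated_in P S' \<and> char_on S' \<phi>' \<and> S \<subseteq> S' \<and> A \<subseteq> S' \<and> (\<forall>x\<in>S. \<phi>' x = \<phi> x)"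
  using A
proof (induction A rule: finite_induct)
  case empty
  then show ?case using S \<phi> by auto
next
  case (insert a A)
  then obtain S1 \<phi>1 where 1: "saturated_in P S1" "char_on S1 \<phi>1" "S \<subseteq> S1" "A \<subseteq> S1"
    "\<forall>x\<in>S. \<phi>1 x = \<phi> x" by auto
  have a: "a \<in> P" using insert by auto
  define n where "n = (LEAST n. n > 0 \<and> a ^ n \<in> S1)"
  have ex: "\<exists>n. n > 0 \<and> a ^ n \<in> S1" using tors[OF a] 1(3) by blast
  have n: "n > 0" "a ^ n \<in> S1" using LeastI_ex[OF ex] by (auto simp: n_def)
  have n': "a ^ k \<notin> S1" if "0 < k" "k < n" for k using not_less_Least[of k] that by (auto simp: n_def)
  obtain \<zeta> where \<zeta>: "\<zeta> ^ n = \<phi>1 (a ^ n)"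
    using n(1) by (metis exp_Ln exp_of_nat_mult nonzero_mult_div_cancel_left of_nat_eq_0_iff
        power_0_left neq0_conv times_divide_eq_right)
  obtain S' \<phi>' where "saturated_in P S' \<and> char_on S' \<phi>' \<and> S1 \<subseteq> S' \<and> a \<in> S' \<and>
           (\<forall>x\<in>S1. \<phi>' x = \<phi>1 x) \<and> \<phi>' a = \<zeta>"
    using char_extend_step[OF P 1(1,2) a n n' \<zeta>] by blast
  then show ?case using 1 by (intro exI[of _ S'] exI[of _ \<phi>']) (auto simp: subset_iff)
qed

section \<open>Congruences and units modulo a rational integer\<close>

definition econg :: "int \<Rightarrow> eis \<Rightarrow> eis \<Rightarrow> bool" where
  "econg M x y \<longleftrightarrow> of_int M dvd x - y"

lemma of_int_dvd_eis_iff: "of_int M dvd (x::eis) \<longleftrightarrow> M dvd eis_re x \<and> M dvd eis_om x"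
proof
  assume "M dvd eis_re x \<and> M dvd eis_om x"
  then obtain a b where "eis_re x = M * a" "eis_om x = M * b" by (auto elim!: dvdE)
  then have "x = of_int M * Eis a b" by (simp add: eis_eq_iff)
  then show "of_int M dvd x" by simp
qed (auto elim!: dvdE)

text \<open>Because the modulus is a rational integer, congruence is read off coordinate by
  coordinate and the residues form a square box.\<close>

lemma econg_iff: "econg M x y \<longleftrightarrow> [eis_re x = eis_re y] (mod M) \<and> [eis_om x = eis_om y] (mod M)"
  by (simp add: econg_def of_int_dvd_eis_iff cong_iff_dvd_diff)

lemma econg_refl [simp]: "econg M x x"
  and econg_sym: "econg M x y \<Longrightarrow> econg M y x"
  and econg_trans: "econg M x y \<Longrightarrow> econg M y z \<Longrightarrow> econg M x z"
  by (auto simp: econg_iff intro: cong_sym cong_trans)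

lemma econg_mult: "econg M x y \<Longrightarrow> econg M x' y' \<Longrightarrow> econg M (x * x') (y * y')"
  by (auto simp: econg_iff intro!: cong_mult cong_diff cong_add)

lemma econg_power: "econg M x y \<Longrightarrow> econg M (x ^ n) (y ^ n)"
  by (induction n) (auto intro: econg_mult)

definition ecoprime :: "int \<Rightarrow> eis \<Rightarrow> bool" where
  "ecoprime M x \<longleftrightarrow> (\<exists>y. econg M (x * y) 1)"

lemma ecoprime_1 [simp]: "ecoprime M 1" by (auto simp: ecoprime_def intro: exI[of _ 1])

lemma ecoprime_mult: "ecoprime M x \<Longrightarrow> ecoprime M y \<Longrightarrow> ecoprime M (x * y)"
proof -
  assume "ecoprime M x" "ecoprime M y"
  then obtain a b where "econg M (x * a) 1" "econg M (y * b) 1" by (auto simp: ecoprime_def)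
  then have "econg M ((x * y) * (a * b)) 1" using econg_mult[of M "x * a" 1 "y * b" 1]
    by (simp add: ac_simps)
  then show ?thesis by (auto simp: ecoprime_def)
qed

lemma ecoprime_multD: "ecoprime M (x * y) \<Longrightarrow> ecoprime M x"
  unfolding ecoprime_def by (metis mult.assoc)

lemma ecoprime_mult_iff: "ecoprime M (x * y) \<longleftrightarrow> ecoprime M x \<and> ecoprime M y"
  using ecoprime_mult ecoprime_multD by (metis mult.commute)

lemma ecoprime_power: "ecoprime M x \<Longrightarrow> ecoprime M (x ^ n)"
  by (induction n) (auto simp: ecoprime_mult)

lemma ecoprime_cong: "econg M x y \<Longrightarrow> ecoprime M x \<longleftrightarrow> ecoprime M y"
  unfolding ecoprime_def by (meson econg_mult econg_refl econg_sym econg_trans)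

lemma ecoprime_unit: "u dvd 1 \<Longrightarrow> ecoprime M u"
  by (metis dvdE ecoprime_1 ecoprime_multD)

lemma econg_cancel:
  assumes "ecoprime M z" "econg M (x * z) (y * z)" shows "econg M x y"
proof -
  obtain w where w: "econg M (z * w) 1" using assms by (auto simp: ecoprime_def)
  have "econg M (x * (z * w)) (y * (z * w))"
    using econg_mult[OF assms(2) econg_refl[of M w]] by (simp add: mult.assoc)
  moreover have "econg M (x * (z * w)) x" "econg M (y * (z * w)) y"
    using econg_mult[OF econg_refl w] by (metis mult_1_right)+
  ultimately show ?thesis by (meson econg_sym econg_trans)
qed

definition ebox :: "int \<Rightarrow> eis set" where
  "ebox M = (\<lambda>(a, b). Eis a b) ` ({0..<M} \<times> {0..<M})"

definition ered :: "int \<Rightarrow> eis \<Rightarrow> eis" where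
  "ered M x = Eis (eis_re x mod M) (eis_om x mod M)"

lemma finite_ebox [simp]: "finite (ebox M)" by (simp add: ebox_def)

lemma ered_in_ebox: "M > 0 \<Longrightarrow> ered M x \<in> ebox M" by (auto simp: ebox_def ered_def)

lemma econg_ered: "econg M (ered M x) x" by (simp add: econg_iff ered_def cong_def)

lemma ered_eq_iff: "ered M x = ered M y \<longleftrightarrow> econg M x y"
  by (auto simp: ered_def econg_iff cong_def)

text \<open>By pigeonhole two powers of \<open>x\<close> with exponents up to the number of residues
  agree, so some period divides the factorial of that number. A common exponent shows that character
  values are roots of unity, and it later fixes the point at which Landau's argument is
  evaluated.\<close>

lemma ecoprime_exponent:
  assumes "M > 0" shows "\<exists>h>0. \<forall>x. ecoprime M x \<longrightarrow> econg M (x ^ h) 1"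
proof (intro exI[of _ "fact (card (ebox M))"] conjI allI impI)
  fix x assume x: "ecoprime M x"
  define N where "N = card (ebox M)"
  have "\<not> inj_on (\<lambda>i. ered M (x ^ i)) {0..N}"
  proof
    assume "inj_on (\<lambda>i. ered M (x ^ i)) {0..N}"
    then have "card {0..N} \<le> card (ebox M)"
      by (rule card_inj_on_le) (use ered_in_ebox[OF assms] in auto)
    then show False by (simp add: N_def)
  qed
  then obtain i j where ij: "i < j" "j \<le> N" "econg M (x ^ i) (x ^ j)"
    by (auto simp: inj_on_def ered_eq_iff) (metis econg_sym linorder_neqE_nat)
  have "econg M (1 * x ^ i) (x ^ (j - i) * x ^ i)" using ij by (simp flip: power_add)
  then have 1: "econg M (x ^ (j - i)) 1"
    using econg_cancel[OF ecoprime_power[OF x]] econg_sym by blast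
  have "j - i dvd fact N" using ij by (intro dvd_fact) auto
  then obtain q where q: "fact N = (j - i) * q" by auto
  show "econg M (x ^ fact (card (ebox M))) 1"
    using econg_power[OF 1, of q] q by (simp add: N_def power_mult)
qed simp

text \<open>Ray class characters, encoded as functions on elements that are trivial on units and
  vanish exactly off the elements coprime to \<open>M\<close>.\<close>

definition echars :: "int \<Rightarrow> (eis \<Rightarrow> complex) set" where
  "echars M = {\<eta>. (\<forall>x y. \<eta> (x * y) = \<eta> x * \<eta> y) \<and> (\<forall>x y. econg M x y \<longrightarrow> \<eta> x = \<eta> y) \<and>
     (\<forall>u. u dvd 1 \<longrightarrow> \<eta> u = 1) \<and> (\<forall>x. \<eta> x = 0 \<longleftrightarrow> \<not> ecoprime M x)}"

definition echar0 :: "int \<Rightarrow> eis \<Rightarrow> complex" where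
  "echar0 M x = (if ecoprime M x then 1 else 0)"

lemma echarsD:
  assumes "\<eta> \<in> echars M"
  shows "\<eta> (x * y) = \<eta> x * \<eta> y" "econg M x y \<Longrightarrow> \<eta> x = \<eta> y" "u dvd 1 \<Longrightarrow> \<eta> u = 1"
    "\<eta> x = 0 \<longleftrightarrow> \<not> ecoprime M x" "\<eta> 1 = 1"
  using assms by (auto simp: echars_def)

lemma echar_power: "\<eta> \<in> echars M \<Longrightarrow> \<eta> (x ^ n) = \<eta> x ^ n"
  by (induction n) (auto simp: echarsD)

lemma echar0_in [simp]: "echar0 M \<in> echars M"
  by (auto simp: echars_def echar0_def ecoprime_mult_iff ecoprime_cong ecoprime_unit)

lemma echars_mult: "\<eta> \<in> echars M \<Longrightarrow> \<psi> \<in> echars M \<Longrightarrow> (\<lambda>x. \<eta> x * \<psi> x) \<in> echars M"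
  unfolding echars_def by (auto simp: ac_simps)

lemma echars_cnj: "\<eta> \<in> echars M \<Longrightarrow> (\<lambda>x. cnj (\<eta> x)) \<in> echars M"
  unfolding echars_def by auto

lemma echar_root_of_unity:
  assumes "M > 0" shows "\<exists>h>0. \<forall>\<eta>\<in>echars M. \<forall>x. ecoprime M x \<longrightarrow> \<eta> x ^ h = 1"
proof -
  obtain h where "h > 0" "\<forall>x. ecoprime M x \<longrightarrow> econg M (x ^ h) 1" using ecoprime_exponent[OF assms] by auto
  then show ?thesis by (metis echar_power echarsD(2,5))
qed

lemma norm_echar:
  assumes "M > 0" "\<eta> \<in> echars M" shows "norm (\<eta> x) = (if ecoprime M x then 1 else 0)"
proof (cases "ecoprime M x")
  case True
  then obtain h where h: "h > 0" "\<eta> x ^ h = 1" using echar_root_of_unity[OF assms(1)] assms(2) by blast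
  then have "norm (\<eta> x) ^ h = 1" by (metis norm_one norm_power)
  then have "norm (\<eta> x) = 1" using h(1) by (metis norm_ge_zero power_eq_1_iff real_norm_def abs_of_nonneg norm_power
    power_eq_imp_eq_base power_one zero_le_one)
  then show ?thesis using True by simp
qed (use echarsD(4)[OF assms(2)] in simp)

lemma norm_echar_le: "M > 0 \<Longrightarrow> \<eta> \<in> echars M \<Longrightarrow> norm (\<eta> x) \<le> 1"
  by (simp add: norm_echar)

text \<open>The values on the box determine a character, and they lie among 0 and the h-th roots of
  unity.\<close>

lemma finite_echars: assumes "M > 0" shows "finite (echars M)"
proof -
  obtain h where h: "h > 0" "\<forall>\<eta>\<in>echars M. \<forall>x. ecoprime M x \<longrightarrow> \<eta> x ^ h = 1"
    using echar_root_of_unity[OF assms] by auto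
  define R where "R = insert 0 {z::complex. z ^ h = 1}"
  have "finite R" using h(1) by (simp add: R_def finite_roots_unity)
  moreover have "(\<lambda>\<eta>. restrict \<eta> (ebox M)) ` echars M \<subseteq> (\<Pi>\<^sub>E x\<in>ebox M. R)"
    using h(2) echarsD(4) by (fastforce simp: R_def)
  ultimately have "finite ((\<lambda>\<eta>. restrict \<eta> (ebox M)) ` echars M)"
    by (meson finite_PiE finite_ebox finite_subset)
  moreover have "inj_on (\<lambda>\<eta>. restrict \<eta> (ebox M)) (echars M)"
  proof (rule inj_onI, rule ext)
    fix \<eta> \<psi> x assume *: "\<eta> \<in> echars M" "\<psi> \<in> echars M" "restrict \<eta> (ebox M) = restrict \<psi> (ebox M)"
    have "\<eta> (ered M x) = \<psi> (ered M x)" using *(3) ered_in_ebox[OF assms, of x] by (metis restrict_apply')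
    then show "\<eta> x = \<psi> x" using * econg_ered[of M x] echarsD(2) by metis
  qed
  ultimately show ?thesis by (rule finite_imageD)
qed

text \<open>Begin with the trivial character on the elements congruent to a unit, send
  \<open>g\<close> to a primitive root of unity of its order modulo that set, and extend to all
  residues. Starting from that set makes the result trivial on units and constant on residue
  classes.\<close>

lemma echar_separates:
  assumes M: "M > 0" and g: "ecoprime M g" "\<And>u. u dvd 1 \<Longrightarrow> \<not> econg M g u"
  shows "\<exists>\<eta>\<in>echars M. \<eta> g \<noteq> 1"
proof -
  define P where "P = {x. ecoprime M x}"
  define T where "T = {x. \<exists>u. u dvd 1 \<and> econg M x u}"
  obtain h where h: "h > 0" "\<And>x. ecoprime M x \<Longrightarrow> econg M (x ^ h) 1" using ecoprime_exponent[OF M] by auto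
  have P: "x * y \<in> P" "1 \<in> P" if "x \<in> P" "y \<in> P" for x y using that by (auto simp: P_def ecoprime_mult)
  have P1: "1 \<in> P" by (simp add: P_def)
  have T: "saturated_in P T"
    unfolding saturated_in_def
  proof (intro conjI ballI impI)
    show "T \<subseteq> P" using ecoprime_cong ecoprime_unit by (auto simp: T_def P_def)
    show "1 \<in> T" by (auto simp: T_def intro: exI[of _ 1])
  next
    fix x y assume "x \<in> T" "y \<in> T"
    then obtain u v where "u dvd 1" "v dvd 1" "econg M x u" "econg M y v" by (auto simp: T_def)
    then show "x * y \<in> T" unfolding T_def using econg_mult by (auto intro!: exI[of _ "u * v"])
  next
    fix x y assume "x \<in> P" "y \<in> T" "x * y \<in> T"
    then obtain u v where uv: "u dvd 1" "v dvd 1" "econg M (x * y) u" "econg M y v" by (auto simp: T_def)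
    obtain v' where v': "1 = v * v'" using uv(2) by (auto elim: dvdE)
    have "econg M (x * v) u" by (meson econg_mult econg_refl econg_sym econg_trans uv(3,4))
    then have "econg M (x * v * v') (u * v')" using econg_mult econg_refl by blast
    then have "econg M x (u * v')" using v' by (simp add: mult.assoc flip: v')
    moreover have "u * v' dvd 1" using uv(1) v' by (metis dvd_triv_right is_unit_mult_iff)
    ultimately show "x \<in> T" by (auto simp: T_def)
  qed
  have c1: "char_on T (\<lambda>_. 1)" by (simp add: char_on_def)
  have tors: "\<exists>n>0. a ^ n \<in> T" if "a \<in> P" for a
    using h(2)[of a] h(1) that unfolding P_def T_def by (metis (mono_tags) dvd_refl mem_Collect_eq)
  have gP: "g \<in> P" and gT: "g \<notin> T" using g by (auto simp: P_def T_def)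
  define n where "n = (LEAST n. n > 0 \<and> g ^ n \<in> T)"
  have ex: "\<exists>n. n > 0 \<and> g ^ n \<in> T" using tors[OF gP] by blast
  have n: "n > 0" "g ^ n \<in> T" using LeastI_ex[OF ex] by (auto simp: n_def)
  have n': "g ^ k \<notin> T" if "0 < k" "k < n" for k using not_less_Least[of k] that by (auto simp: n_def)
  \<comment> \<open>Since \<open>g\<close> is not congruent to a unit, its order is at least 2, so a
    primitive n-th root of unity differs from 1.\<close>
  have "n \<noteq> 1" using n gT by auto
  then have n2: "n \<ge> 2" using n by simp
  define \<zeta> where "\<zeta> = exp (2 * of_real pi * \<i> * of_nat 1 / of_nat n)"
  have z1: "\<zeta> ^ n = 1" unfolding \<zeta>_def by (rule complex_root_unity) (use n in simp)
  have z2: "\<zeta> \<noteq> 1"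
  proof
    assume "\<zeta> = 1"
    then show False using complex_root_unity_eq_1[of n 1] n2 by (simp add: \<zeta>_def)
  qed
  obtain S1 \<phi>1 where S1: "saturated_in P S1" "char_on S1 \<phi>1" "T \<subseteq> S1" "g \<in> S1" "\<forall>x\<in>T. \<phi>1 x = 1" "\<phi>1 g = \<zeta>"
    using char_extend_step[OF P(1) P1 T c1 gP n n', of \<zeta>] z1 by auto
  have fin: "finite (ebox M \<inter> P)" by simp
  have tors1: "\<exists>n>0. a ^ n \<in> S1" if "a \<in> P" for a using tors[OF that] S1(3) by blast
  obtain S \<phi> where S: "saturated_in P S" "char_on S \<phi>" "S1 \<subseteq> S" "ebox M \<inter> P \<subseteq> S" "\<forall>x\<in>S1. \<phi> x = \<phi>1 x"
    using char_extend_finite[OF P(1) P1 S1(1,2) tors1 fin] by auto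
  have TS: "T \<subseteq> S" using S S1 by auto
  have \<phi>T: "\<phi> x = 1" if "x \<in> T" for x using S S1 that by auto
  have oneT: "x \<in> T" if "econg M x 1" for x using that unfolding T_def by (intro CollectI exI[of _ 1]) simp
  \<comment> \<open>\<open>S\<close> holds a representative of every coprime class and everything
    congruent to 1. If s inverts x modulo \<open>M\<close>, then s and x s lie in \<open>S\<close>,
    and saturation gives x.\<close>
  have inS: "x \<in> S" if "x \<in> P" for x
  proof -
    define r where "r = ered M x"
    have r2: "econg M x r" using econg_ered econg_sym by (simp add: r_def)
    have r3: "r \<in> P" using that ecoprime_cong[OF r2] by (simp add: P_def)
    have r: "r \<in> S" "econg M x r" "r \<in> P"
      using S(4) ered_in_ebox[OF M, of x] r2 r3 by (auto simp: r_def)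
    obtain s where s: "econg M (r * s) 1" using r(3) by (auto simp: P_def ecoprime_def)
    have sP: "s \<in> P" using s by (auto simp: P_def ecoprime_def mult.commute)
    have "s * r \<in> S" using oneT[OF s] TS by (auto simp: mult.commute)
    then have sS: "s \<in> S" using S(1) sP r(1) by (auto simp: saturated_in_def)
    have "econg M (x * s) 1" by (meson econg_mult econg_refl econg_trans r(2) s)
    then have "x * s \<in> S" using TS oneT by auto
    then show ?thesis using S(1) sS that by (auto simp: saturated_in_def)
  qed
  then have PS: "S = P" using S(1) by (auto simp: saturated_in_def)
  have \<phi>c: "\<phi> x = \<phi> y" if xy: "x \<in> P" "econg M x y" for x y
  proof -
    obtain s where s: "econg M (x * s) 1" using xy by (auto simp: P_def ecoprime_def)
    have sP: "s \<in> P" using s by (auto simp: P_def ecoprime_def mult.commute)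
    have s': "econg M (y * s) 1" by (meson econg_mult econg_refl econg_trans econg_sym xy(2) s)
    have "x * s \<in> T" "y * s \<in> T" using s s' oneT by auto
    then have "\<phi> (x * s) = 1" "\<phi> (y * s) = 1" using \<phi>T by auto
    moreover have yP: "y \<in> P" using xy ecoprime_cong by (auto simp: P_def)
    ultimately have "\<phi> x * \<phi> s = \<phi> y * \<phi> s" using S(2) xy(1) sP unfolding PS char_on_def by simp
    moreover have "\<phi> s \<noteq> 0" using S(2) sP unfolding PS char_on_def by blast
    ultimately show ?thesis by simp
  qed
  define \<eta> where "\<eta> x = (if x \<in> P then \<phi> x else 0)" for x
  have "\<eta> \<in> echars M"
    unfolding echars_def mem_Collect_eq
  proof (intro conjI allI impI)
    fix x y show "\<eta> (x * y) = \<eta> x * \<eta> y"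
      using S(2) by (auto simp: \<eta>_def P_def ecoprime_mult_iff char_on_def PS)
  next
    fix x y assume "econg M x y" then show "\<eta> x = \<eta> y"
      using \<phi>c[of x y] ecoprime_cong[of M x y] by (auto simp: \<eta>_def P_def)
  next
    fix u :: eis assume "u dvd 1"
    then have "u \<in> T" by (auto simp: T_def)
    then show "\<eta> u = 1" using \<phi>T TS PS by (auto simp: \<eta>_def)
  next
    fix x show "\<eta> x = 0 \<longleftrightarrow> \<not> ecoprime M x" using S(2) by (auto simp: \<eta>_def PS char_on_def P_def)
  qed
  moreover have "\<eta> g = \<zeta>" using gP S1(4,6) S(5) by (simp add: \<eta>_def)
  ultimately show ?thesis using z2 by auto
qed

text \<open>Multiplying all characters by some \<psi> with \<open>\<psi> g \<noteq> 1\<close>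
  permutes them and scales the sum. The inverse permutation is multiplication by the complex
  conjugate, as values have modulus 1 on coprime elements and every character vanishes off
  them.\<close>

lemma echar_orthogonality:
  assumes M: "M > 0" and g: "ecoprime M g"
  shows "(\<Sum>\<eta>\<in>echars M. \<eta> g) = (if \<exists>u. u dvd 1 \<and> econg M g u then of_nat (card (echars M)) else 0)"
proof (cases "\<exists>u. u dvd 1 \<and> econg M g u")
  case True
  then have "\<eta> g = 1" if "\<eta> \<in> echars M" for \<eta> using echarsD(2,3)[OF that] by metis
  then have "(\<Sum>\<eta>\<in>echars M. \<eta> g) = (\<Sum>\<eta>\<in>echars M. 1)" by (intro sum.cong) auto
  then show ?thesis using True by simp
next
  case False
  then obtain \<psi> where \<psi>: "\<psi> \<in> echars M" "\<psi> g \<noteq> 1" using echar_separates[OF M g] by blast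
  have "(\<Sum>\<eta>\<in>echars M. \<eta> g) = (\<Sum>\<eta>\<in>echars M. \<psi> g * \<eta> g)"
  proof (rule sum.reindex_bij_witness[where i = "\<lambda>\<eta> x. \<psi> x * \<eta> x" and j = "\<lambda>\<eta> x. cnj (\<psi> x) * \<eta> x"])
    have n1: "\<psi> x * cnj (\<psi> x) = (if ecoprime M x then 1 else 0)" for x
      using norm_echar[OF M \<psi>(1), of x] by (auto simp: complex_norm_square[symmetric])
    fix \<eta> assume \<eta>: "\<eta> \<in> echars M"
    show "(\<lambda>x. \<psi> x * \<eta> x) \<in> echars M" "(\<lambda>x. cnj (\<psi> x) * \<eta> x) \<in> echars M"
      using \<eta> \<psi>(1) by (auto intro!: echars_mult echars_cnj)
    have *: "(\<psi> x * cnj (\<psi> x)) * \<eta> x = \<eta> x" for x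
      unfolding n1 using echarsD(4)[OF \<eta>, of x] by simp
    show "(\<lambda>x. cnj (\<psi> x) * (\<psi> x * \<eta> x)) = \<eta>" "(\<lambda>x. \<psi> x * (cnj (\<psi> x) * \<eta> x)) = \<eta>"
      using * by (auto simp: ac_simps)
    then show "\<psi> g * (cnj (\<psi> g) * \<eta> g) = \<eta> g" by metis
  qed
  also have "\<dots> = \<psi> g * (\<Sum>\<eta>\<in>echars M. \<eta> g)" by (simp add: sum_distrib_left)
  finally have "(\<Sum>\<eta>\<in>echars M. \<eta> g) * (1 - \<psi> g) = 0" by (simp add: algebra_simps)
  then show ?thesis using \<psi>(2) False by auto
qed

section \<open>Dirichlet series over the Eisenstein integers\<close>

lemma summable_on_prod_nonneg:
  fixes f :: "'a \<Rightarrow> real" and g :: "'b \<Rightarrow> real"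
  assumes "f summable_on A" "g summable_on B" "\<And>x. x \<in> A \<Longrightarrow> f x \<ge> 0" "\<And>x. x \<in> B \<Longrightarrow> g x \<ge> 0"
  shows "(\<lambda>(x, y). f x * g y) summable_on A \<times> B"
proof (rule summable_on_SigmaI)
  show "((\<lambda>y. case (x, y) of (x, y) \<Rightarrow> f x * g y) has_sum f x * infsum g B) B" if "x \<in> A" for x
    using assms(2) by (auto intro: has_sum_cmult_right)
  show "(\<lambda>x. f x * infsum g B) summable_on A" using assms(1) by (rule summable_on_cmult_left)
qed (use assms in auto)

lemma summable_on_int_powr:
  fixes \<sigma> :: real assumes "\<sigma> > 1"
  shows "(\<lambda>n::int. (1 + (real_of_int n)\<^sup>2) powr (-(\<sigma>/2))) summable_on UNIV"
proof -
  define f where "f = (\<lambda>n::int. (1 + (real_of_int n)\<^sup>2) powr (-(\<sigma>/2)))"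
  have "summable (\<lambda>n::nat. real n powr (-\<sigma>))" using assms by (subst summable_real_powr_iff) auto
  then have "summable (\<lambda>n::nat. f (int n))"
  proof (rule summable_comparison_test_ev[rotated])
    have "norm (f (int n)) \<le> real n powr (-\<sigma>)" if "n > 0" for n
    proof -
      have "f (int n) \<le> ((real n)\<^sup>2) powr (-(\<sigma>/2))"
        unfolding f_def using assms that by (intro powr_mono2') auto
      also have "\<dots> = real n powr (-\<sigma>)" using that by (simp add: powr_powr flip: powr_numeral)
      finally show ?thesis by (simp add: f_def)
    qed
    then show "\<forall>\<^sub>F n in sequentially. norm (f (int n)) \<le> real n powr (-\<sigma>)"
      by (intro eventually_mono[OF eventually_gt_at_top[of 0]]) auto
  qed
  then have 1: "(\<lambda>n. f (int n)) summable_on UNIV"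
    by (intro summable_nonneg_imp_summable_on) (auto simp: f_def)
  have 2: "f summable_on range int" using 1 by (subst summable_on_reindex) (auto simp: o_def)
  have "(\<lambda>n. f (- int n)) summable_on UNIV" using 1 by (simp add: f_def)
  then have 3: "f summable_on range (\<lambda>n. - int n)"
    by (subst summable_on_reindex) (auto simp: o_def inj_on_def)
  have "(UNIV :: int set) = range int \<union> range (\<lambda>n. - int n)"
    by (auto simp: image_iff) (metis int_cases2)
  then show ?thesis using summable_on_union[OF 2 3] by (simp add: f_def)
qed

definition eN :: "eis \<Rightarrow> real" where "eN x = real_of_int (enorm x)"

lemma eN_mult: "eN (x * y) = eN x * eN y" and eN_power: "eN (x ^ n) = eN x ^ n"
  and eN_0 [simp]: "eN 0 = 0" and eN_1 [simp]: "eN 1 = 1" and eN_minus [simp]: "eN (- x) = eN x"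
  and eN_nonneg [simp]: "eN x \<ge> 0" and eN_eq_0_iff [simp]: "eN x = 0 \<longleftrightarrow> x = 0"
  and eN_pos_iff [simp]: "eN x > 0 \<longleftrightarrow> x \<noteq> 0"
  by (auto simp: eN_def enorm_mult enorm_power)

lemma eN_ge_1: "x \<noteq> 0 \<Longrightarrow> eN x \<ge> 1"
  using enorm_pos_iff[of x] unfolding eN_def by linarith

lemma bij_betw_Eis: "bij_betw (\<lambda>(a, b). Eis a b) UNIV UNIV"
  by (rule bij_betwI[where g = "\<lambda>x. (eis_re x, eis_om x)"]) auto

text \<open>For N the norm of a nonzero a + b \<omega>, the bound (1 + a^2)(1 + b^2) \<le> 16 N^2
  majorizes the double sum by a product of two one-dimensional sums.\<close>

lemma summable_on_eN_powr:
  assumes "\<sigma> > 1" shows "(\<lambda>x. eN x powr (-\<sigma>)) summable_on A"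
proof -
  define f where "f = (\<lambda>n::int. (1 + (real_of_int n)\<^sup>2) powr (-(\<sigma>/2)))"
  have "(\<lambda>(x, y). f x * f y) summable_on UNIV \<times> UNIV"
    by (intro summable_on_prod_nonneg) (use summable_on_int_powr[OF assms] in \<open>auto simp: f_def\<close>)
  then have "(\<lambda>z. 16 powr (\<sigma>/2) * (case z of (x, y) \<Rightarrow> f x * f y)) summable_on UNIV"
    by (intro summable_on_cmult_right) simp
  then have "(\<lambda>z. eN (case z of (a, b) \<Rightarrow> Eis a b) powr (-\<sigma>)) summable_on UNIV"
  proof (rule summable_on_comparison_test)
    fix z :: "int \<times> int"
    obtain a b where z: "z = (a, b)" by (cases z)
    define x where "x = Eis a b"
    show "eN (case z of (a, b) \<Rightarrow> Eis a b) powr (-\<sigma>) \<le> 16 powr (\<sigma>/2) * (case z of (x, y) \<Rightarrow> f x * f y)"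
    proof (cases "x = 0")
      case False
      define p q where "p = 1 + (real_of_int a)\<^sup>2" and "q = 1 + (real_of_int b)\<^sup>2"
      have "2 * eN x \<ge> (real_of_int a)\<^sup>2 + (real_of_int b)\<^sup>2"
        using enorm_ge_sum_squares[of x] unfolding eN_def x_def
        by (simp flip: of_int_power of_int_add)
      then have 1: "4 * eN x \<ge> p + q - 1" using eN_ge_1[OF False] by (simp add: p_def q_def)
      have pq: "p \<ge> 1" "q \<ge> 1" by (auto simp: p_def q_def)
      have "p * q \<le> (p + q - 1)\<^sup>2"
      proof -
        have "(p + q - 1)\<^sup>2 - p * q = (p-1)\<^sup>2 + (q-1)\<^sup>2 + (p-1)*(q-1) + (p - 1) + (q - 1)"
          by (simp add: power2_eq_square algebra_simps)
        also have "\<dots> \<ge> 0" using pq by (intro add_nonneg_nonneg) auto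
        finally show ?thesis by simp
      qed
      also have "\<dots> \<le> (4 * eN x)\<^sup>2" using 1 pq by (intro power_mono) auto
      finally have 2: "p * q / 16 \<le> (eN x)\<^sup>2" by (simp add: power2_eq_square)
      have "eN x powr (-\<sigma>) = ((eN x)\<^sup>2) powr (-(\<sigma>/2))"
        using False by (simp add: powr_powr flip: powr_numeral)
      also have "\<dots> \<le> (p * q / 16) powr (-(\<sigma>/2))"
        using 2 pq assms by (intro powr_mono2') auto
      also have "\<dots> = 16 powr (\<sigma>/2) * (f a * f b)"
        using pq by (simp add: powr_divide powr_mult powr_minus f_def p_def q_def divide_simps)
      finally show ?thesis by (simp add: z x_def)
    qed (auto simp: z x_def f_def)
  qed auto
  then have "(\<lambda>x. eN x powr (-\<sigma>)) summable_on UNIV"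
    by (subst (asm) summable_on_reindex_bij_betw[OF bij_betw_Eis])
  then show ?thesis using summable_on_subset_banach by blast
qed

text \<open>In the cone 1 \<le> b \<le> a the norm of 1 + M (a + b \<omega>) is at most 5 M^2 a^2,
  and each a occurs with a values of b, so the sum dominates a multiple of the harmonic
  series.\<close>

lemma not_summable_on_inverse_eN:
  assumes M: "M > 0" shows "\<not> (\<lambda>x. 1 / eN x) summable_on {x. econg M x 1}"
proof
  assume "(\<lambda>x. 1 / eN x) summable_on {x. econg M x 1}"
  define S where "S = (SIGMA a:{1::nat..}. {1..a})"
  define h where "h = (\<lambda>(a, b). Eis (1 + M * int a) (M * int b))"
  have "h ` S \<subseteq> {x. econg M x 1}" by (auto simp: h_def econg_iff cong_iff_dvd_diff)
  with \<open>_ summable_on _\<close> have "(\<lambda>x. 1 / eN x) summable_on h ` S" using summable_on_subset_banach by blast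
  moreover have "inj_on h S" using M by (auto simp: inj_on_def h_def)
  ultimately have "(\<lambda>z. 1 / eN (h z)) summable_on S" by (simp add: summable_on_reindex o_def)
  then have "(\<lambda>(a, b). 1 / (5 * (real_of_int M)\<^sup>2 * (real a)\<^sup>2)) summable_on S"
  proof (rule summable_on_comparison_test)
    fix z assume z: "z \<in> S"
    then obtain a b where ab: "z = (a, b)" "1 \<le> a" "1 \<le> b" "b \<le> a" by (auto simp: S_def)
    define u v where "u = real_of_int M * real a" and "v = real_of_int M * real b"
    have u: "u \<ge> 1" "v \<ge> 0" "v \<le> u"
      using M ab mult_mono[of 1 "real_of_int M" 1 "real a"] by (auto simp: u_def v_def)
    have "eN (h z) = (1 + u)\<^sup>2 - (1 + u) * v + v\<^sup>2"
      by (simp add: eN_def h_def ab enorm_def u_def v_def)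
    also have "\<dots> \<le> (u + u)\<^sup>2 - 0 + u\<^sup>2" using u by (intro add_mono diff_mono power_mono) auto
    also have "\<dots> = 5 * (real_of_int M)\<^sup>2 * (real a)\<^sup>2" by (simp add: u_def power2_eq_square)
    finally have *: "eN (h z) \<le> 5 * (real_of_int M)\<^sup>2 * (real a)\<^sup>2" .
    have "h z \<noteq> 0" using ab M by (auto simp: h_def eis_eq_iff)
    then show "(case z of (a, b) \<Rightarrow> 1 / (5 * (real_of_int M)\<^sup>2 * (real a)\<^sup>2)) \<le> 1 / eN (h z)"
      using * by (auto simp: ab intro!: divide_left_mono mult_pos_pos)
         (use M ab in auto)
  qed auto
  then have "(\<lambda>a. \<Sum>\<^sub>\<infinity>b\<in>{1..a}. 1 / (5 * (real_of_int M)\<^sup>2 * (real a)\<^sup>2)) summable_on {1..}"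
    unfolding S_def by (intro summable_on_Sigma_banach[where f = "\<lambda>a b. 1 / (5 * (real_of_int M)\<^sup>2 * (real a)\<^sup>2)"])
  then have "(\<lambda>a. (5 * (real_of_int M)\<^sup>2) * (\<Sum>\<^sub>\<infinity>b\<in>{1..a}. 1 / (5 * (real_of_int M)\<^sup>2 * (real a)\<^sup>2))) summable_on {1..}"
    by (rule summable_on_cmult_right)
  then have "(\<lambda>a. 1 / real a) summable_on {1..}"
    by (rule summable_on_cong[THEN iffD1, rotated]) (use M in \<open>auto simp: power2_eq_square\<close>)
  then have "(\<lambda>a. 1 / real a) summable_on insert 0 {1..}" by (subst summable_on_insert_iff)
  also have "insert 0 {1::nat..} = UNIV" by auto
  finally have "summable (\<lambda>a. 1 / real a)" by (rule summable_on_imp_summable)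
  then show False using not_summable_harmonic[where 'a = real] by (simp add: inverse_eq_divide)
qed

section \<open>Analytic continuation of lattice sums\<close>

lemma has_field_derivative_infsum:
  fixes f f' :: "'i \<Rightarrow> complex \<Rightarrow> complex"
  assumes r: "r > 0" and d: "\<And>i w. i \<in> A \<Longrightarrow> w \<in> cball z r \<Longrightarrow> (f i has_field_derivative f' i w) (at w)"
    and b: "\<And>i w. i \<in> A \<Longrightarrow> w \<in> cball z r \<Longrightarrow> norm (f i w) \<le> B i" and B: "B summable_on A"
    and w: "w \<in> ball z r"
  shows "((\<lambda>i. f' i w) has_sum (\<Sum>\<^sub>\<infinity>i\<in>A. f' i w)) A"
    "((\<lambda>w. \<Sum>\<^sub>\<infinity>i\<in>A. f i w) has_field_derivative (\<Sum>\<^sub>\<infinity>i\<in>A. f' i w)) (at w)"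
proof -
  have ul: "uniform_limit (cball z r) (\<lambda>X y. \<Sum>x\<in>X. f x y) (\<lambda>y. \<Sum>\<^sub>\<infinity>x\<in>A. f x y) (finite_subsets_at_top A)"
    by (rule Weierstrass_m_test_general[OF b B])
  have ev: "\<forall>\<^sub>F X in finite_subsets_at_top A. continuous_on (cball z r) (\<lambda>y. \<Sum>x\<in>X. f x y) \<and>
        (\<forall>w\<in>ball z r. ((\<lambda>y. \<Sum>x\<in>X. f x y) has_field_derivative (\<Sum>x\<in>X. f' x w)) (at w))"
  proof (rule eventually_finite_subsets_at_top_weakI, intro conjI ballI)
    fix X assume X: "finite X" "X \<subseteq> A"
    have "continuous_on (cball z r) (f x)" if "x \<in> X" for x
      using d X that by (intro DERIV_continuous_on) (blast intro: DERIV_subset)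
    then show "continuous_on (cball z r) (\<lambda>y. \<Sum>x\<in>X. f x y)" by (intro continuous_on_sum) auto
    show "((\<lambda>y. \<Sum>x\<in>X. f x y) has_field_derivative (\<Sum>x\<in>X. f' x w)) (at w)" if "w \<in> ball z r" for w
      using d X that by (intro DERIV_sum) auto
  qed
  \<comment> \<open>Only the terms are majorized; that the series of derivatives converges too is
    part of Weierstrass's theorem on uniform limits of holomorphic functions.\<close>
  obtain g' where "\<And>w. w \<in> ball z r \<Longrightarrow> ((\<lambda>y. \<Sum>\<^sub>\<infinity>x\<in>A. f x y) has_field_derivative g' w) (at w) \<and>
       ((\<lambda>X. \<Sum>x\<in>X. f' x w) \<longlongrightarrow> g' w) (finite_subsets_at_top A)"
    using has_complex_derivative_uniform_limit[OF ev ul] r by (auto simp: finite_subsets_at_top_neq_bot)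
  then have "((\<lambda>y. \<Sum>\<^sub>\<infinity>x\<in>A. f x y) has_field_derivative g' w) (at w)" "((\<lambda>i. f' i w) has_sum g' w) A"
    using w by (auto simp: has_sum_def)
  then show "((\<lambda>i. f' i w) has_sum (\<Sum>\<^sub>\<infinity>i\<in>A. f' i w)) A"
    "((\<lambda>w. \<Sum>\<^sub>\<infinity>i\<in>A. f i w) has_field_derivative (\<Sum>\<^sub>\<infinity>i\<in>A. f' i w)) (at w)"
    by (auto simp: infsumI)
qed

text \<open>The value at 0 is 0, so sums may run over all elements without excluding 0.\<close>

definition epow :: "complex \<Rightarrow> eis \<Rightarrow> complex" where
  "epow s x = complex_of_real (eN x) powr (- s)"

lemma norm_epow: "norm (epow s x) = eN x powr (- Re s)"
  by (simp add: epow_def norm_powr_real_powr)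

lemma epow_0 [simp]: "epow s 0 = 0" and epow_minus [simp]: "epow s (- x) = epow s x"
  and epow_1 [simp]: "epow s 1 = 1"
  by (simp_all add: epow_def)

lemma epow_mult: "epow s (x * y) = epow s x * epow s y"
  unfolding epow_def eN_mult of_real_mult by (rule powr_times_real) auto

lemma norm_epow_le_1: "Re s \<ge> 0 \<Longrightarrow> norm (epow s x) \<le> 1"
proof (cases "x = 0")
  case False
  assume "Re s \<ge> 0"
  then have "eN x powr (- Re s) \<le> eN x powr 0" using eN_ge_1[OF False] by (intro powr_mono) auto
  then show ?thesis using False by (simp add: norm_epow)
qed simp

lemma epow_has_field_derivative:
  "((\<lambda>s. epow s x) has_field_derivative (- of_real (ln (eN x)) * epow s x)) (at s within A)"
proof (cases "x = 0")
  case False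
  then have *: "epow t x = exp (- t * of_real (ln (eN x)))" for t
    by (simp add: epow_def powr_def Ln_of_real)
  show ?thesis unfolding * by (auto intro!: derivative_eq_intros)
qed simp

lemma epow_summable:
  assumes "Re s > 1" shows "(\<lambda>x. norm (epow s x)) summable_on A"
  unfolding norm_epow by (rule summable_on_eN_powr) (use assms in simp)

lemma abs_summable_mult_epow:
  assumes "Re s > 1" "\<And>x. norm (f x) \<le> B"
  shows "(\<lambda>x. norm (f x * epow s x)) summable_on A"
proof (rule summable_on_comparison_test)
  show "(\<lambda>x. B * norm (epow s x)) summable_on A" using epow_summable[OF assms(1)] by (rule summable_on_cmult_right)
qed (auto simp: norm_mult intro!: mult_right_mono assms)

text \<open>Write the power as exp(- s ln(1 + u)). The remainder of exp after two terms gives 4 R^2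
  exp R, from |s ln(1 + u)| \<le> 2 R |u| \<le> R; the error |ln(1 + u) - u| \<le> 2 u^2 gives 2 R.
  What matters is uniformity in s.\<close>

lemma powr_one_plus_approx:
  fixes u :: real assumes u: "\<bar>u\<bar> \<le> 1/2" and s: "norm s \<le> R"
  shows "norm (complex_of_real (1 + u) powr (- s) - 1 + s * of_real u) \<le> (4 * R\<^sup>2 * exp R + 2 * R) * u\<^sup>2"
proof -
  define w where "w = ln (1 + u)"
  have R: "R \<ge> 0" using s norm_ge_zero order_trans by blast
  have w1: "\<bar>w - u\<bar> \<le> 2 * u\<^sup>2" using abs_ln_one_plus_x_minus_x_bound[OF u] by (simp add: w_def)
  have "2 * u\<^sup>2 \<le> \<bar>u\<bar>" using mult_right_mono[OF u, of "2 * \<bar>u\<bar>"] by (simp add: power2_eq_square)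
  then have w2: "\<bar>w\<bar> \<le> 2 * \<bar>u\<bar>" using w1 by linarith
  have e: "complex_of_real (1 + u) powr (- s) = exp (- s * of_real w)"
    using u by (simp add: powr_def w_def Ln_of_real del: of_real_add)
  define z where "z = - s * complex_of_real w"
  have nz: "norm z \<le> R * (2 * \<bar>u\<bar>)" unfolding z_def norm_mult using s w2 R
    by (intro mult_mono) auto
  also have "\<dots> \<le> R * 1" using u R by (intro mult_left_mono) auto
  finally have nz1: "norm z \<le> R" by simp
  have "norm (exp z - (\<Sum>k\<le>1. z ^ k / fact k)) \<le> exp \<bar>Re z\<bar> * norm z ^ Suc 1 / fact 1"
    by (rule Taylor_exp)
  then have "norm (exp z - 1 - z) \<le> exp \<bar>Re z\<bar> * (norm z)\<^sup>2" by (simp add: power2_eq_square algebra_simps)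
  also have "\<dots> \<le> exp R * (R * (2 * \<bar>u\<bar>))\<^sup>2"
    using nz nz1 abs_Re_le_cmod[of z] by (intro mult_mono power_mono) auto
  finally have 1: "norm (exp z - 1 - z) \<le> 4 * R\<^sup>2 * exp R * u\<^sup>2" by (simp add: power_mult_distrib mult_ac)
  have "norm (s * of_real (u - w)) \<le> R * (2 * u\<^sup>2)"
    unfolding norm_mult using s R w1 by (intro mult_mono) (auto simp: abs_minus_commute simp del: of_real_diff)
  moreover have "exp z - 1 + s * of_real u = (exp z - 1 - z) + s * of_real (u - w)"
    by (simp add: z_def algebra_simps)
  ultimately show ?thesis unfolding e z_def[symmetric]
    using 1 norm_triangle_ineq[of "exp z - 1 - z" "s * of_real (u - w)"] by (simp add: algebra_simps)
qed

text \<open>The norm of z \<plusminus> b is N(z) \<plusminus> t + N(b) with t of size sqrt(N(z)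
  N(b)). The term linear in t cancels in the symmetric difference, which gains a full factor 1/N(z).
  A first difference would gain only the square root of that and stop the continuation at real part
  1/2.\<close>

lemma epow_second_difference:
  assumes s: "norm s \<le> R" and z: "z \<noteq> 0" and N: "eN z \<ge> 36 * eN b"
  shows "norm (epow s (z + b) + epow s (z - b) - 2 * epow s z) \<le>
     (18 * (4 * R\<^sup>2 * exp R + 2 * R) + 2 * R) * eN b * eN z powr (- Re s - 1)"
proof -
  define n m where "n = eN b" and "m = eN z"
  define t where "t = real_of_int (2 * eis_re z * eis_re b - eis_re z * eis_om b - eis_om z * eis_re b + 2 * eis_om z * eis_om b)"
  have R: "R \<ge> 0" using s norm_ge_zero order_trans by blast
  have m: "m > 0" "n \<ge> 0" using z by (auto simp: m_def n_def)
  have Np: "eN (z + b) = m + t + n" "eN (z - b) = m - t + n"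
    by (simp_all add: m_def n_def t_def eN_def enorm_def power2_eq_square algebra_simps)
  \<comment> \<open>Cauchy-Schwarz for the norm form, with the defect displayed as a square.\<close>
  have "4 * m * n - t\<^sup>2 = 3 * (real_of_int (eis_re z * eis_om b - eis_om z * eis_re b))\<^sup>2"
    by (simp add: m_def n_def t_def eN_def enorm_def power2_eq_square algebra_simps)
  then have t2: "t\<^sup>2 \<le> 4 * m * n" by (smt (verit) zero_le_power2)
  define up um where "up = (t + n) / m" and "um = (- t + n) / m"
  have sq: "v\<^sup>2 \<le> 9 * n / m" if v: "v = (t' + n) / m" "t'\<^sup>2 = t\<^sup>2" for v t'
  proof -
    have nm: "n \<le> m" using N m unfolding n_def m_def by linarith
    have "(t' + n)\<^sup>2 \<le> 9 * n * m"
    proof -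
      \<comment> \<open>The added square turns the right-hand side into 3/2 t'^2 + 3 n^2; then t'^2
        \<le> 4 m n and n \<le> m give 9 n m.\<close>
      have "(t' + n)\<^sup>2 \<le> (t' + n)\<^sup>2 + (t' - 2 * n)\<^sup>2 / 2" by simp
      also have "\<dots> = 3 / 2 * t'\<^sup>2 + 3 * n\<^sup>2" by (simp add: power2_eq_square field_simps)
      also have "\<dots> \<le> 3 / 2 * (4 * m * n) + 3 * (n * m)"
        using t2 that(2) nm m by (intro add_mono) (auto simp: power2_eq_square mult_left_mono)
      finally show ?thesis by (simp add: algebra_simps)
    qed
    then show ?thesis using m by (simp add: v power_divide divide_simps) (simp add: power2_eq_square mult_ac)
  qed
  have sp: "up\<^sup>2 \<le> 9 * n / m" and sm: "um\<^sup>2 \<le> 9 * n / m"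
    using sq[OF up_def] sq[OF um_def] by auto
  \<comment> \<open>This is where 36 comes from: 9 n / m \<le> 1/4 keeps both relative changes
    within the range of the expansion.\<close>
  have "9 * n / m \<le> (1/2)\<^sup>2" using N m by (simp add: n_def m_def power2_eq_square divide_simps)
  then have hp: "\<bar>up\<bar> \<le> 1/2" "\<bar>um\<bar> \<le> 1/2"
    using sp sm abs_le_square_iff[of up "1/2"] abs_le_square_iff[of um "1/2"] by auto
  define C where "C = 4 * R\<^sup>2 * exp R + 2 * R"
  have C: "C \<ge> 0" using R by (simp add: C_def)
  define A where "A u = complex_of_real (1 + u) powr (- s) - 1 + s * of_real u" for u
  have Ab: "norm (A up) \<le> C * (9 * n / m)" "norm (A um) \<le> C * (9 * n / m)"
    using powr_one_plus_approx[OF hp(1) s] powr_one_plus_approx[OF hp(2) s]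
      mult_left_mono[OF sp C] mult_left_mono[OF sm C] by (auto simp: A_def C_def)
  have ez: "epow s (z + b) = epow s z * complex_of_real (1 + up) powr (- s)"
    "epow s (z - b) = epow s z * complex_of_real (1 + um) powr (- s)"
  proof -
    have *: "eN (z + b) = m * (1 + up)" "eN (z - b) = m * (1 + um)" unfolding Np up_def um_def using m by (simp_all add: field_simps)
    show "epow s (z + b) = epow s z * complex_of_real (1 + up) powr (- s)"
      "epow s (z - b) = epow s z * complex_of_real (1 + um) powr (- s)"
      unfolding epow_def * of_real_mult using hp m
      by (subst powr_times_real; auto simp: m_def simp del: of_real_add)+
  qed
  have upm: "up + um = 2 * n / m" by (simp add: up_def um_def add_divide_distrib[symmetric])
  have "epow s (z + b) + epow s (z - b) - 2 * epow s z = epow s z * (A up + A um - s * of_real (up + um))"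
    unfolding ez A_def by (simp add: algebra_simps)
  also have "norm \<dots> \<le> m powr (- Re s) * (C * (9 * n / m) + C * (9 * n / m) + R * (2 * n / m))"
    unfolding norm_mult norm_epow m_def[symmetric]
  proof (rule mult_left_mono)
    have "norm (s * of_real (up + um)) \<le> R * (2 * n / m)"
      unfolding norm_mult upm norm_of_real using s R m by (intro mult_mono) auto
    then show "norm (A up + A um - s * of_real (up + um)) \<le> C * (9 * n / m) + C * (9 * n / m) + R * (2 * n / m)"
      using Ab norm_triangle_ineq4[of "A up + A um" "s * of_real (up + um)"] norm_triangle_ineq[of "A up" "A um"] by linarith
  qed simp
  also have "\<dots> = (18 * C + 2 * R) * n * (m powr (- Re s) / m)" using m by (simp add: field_simps)
  also have "m powr (- Re s) / m = m powr (- Re s - 1)" using m by (simp add: powr_diff)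
  finally show ?thesis by (simp add: C_def n_def m_def)
qed

lemma bij_betw_ebox_decomp:
  assumes M: "M > 0"
  shows "bij_betw (\<lambda>(g, b). of_int M * g + b) (UNIV \<times> ebox M) UNIV"
    and "bij_betw (\<lambda>(g, b). of_int M * g - b) (UNIV \<times> ebox M) UNIV"
proof -
  define q where "q x = Eis (eis_re x div M) (eis_om x div M)" for x
  have q: "of_int M * q x + ered M x = x" for x by (simp add: q_def ered_def eis_eq_iff)
  have q': "q (of_int M * g + b) = g" "ered M (of_int M * g + b) = b" if "b \<in> ebox M" for g b
    using that M by (auto simp: q_def ered_def eis_eq_iff ebox_def)
  show "bij_betw (\<lambda>(g, b). of_int M * g + b) (UNIV \<times> ebox M) UNIV"
    by (rule bij_betwI[where g = "\<lambda>x. (q x, ered M x)"]) (auto simp: q q' ered_in_ebox M)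
  have q2: "- (of_int M * q (- x)) - ered M (- x) = x" for x using q[of "- x"]
    by (metis add.inverse_inverse minus_add_distrib uminus_add_conv_diff add_uminus_conv_diff)
  have q3: "q (b - of_int M * g) = - g" "ered M (b - of_int M * g) = b" if "b \<in> ebox M" for g b
    using q'[OF that, of "- g"] by (simp_all add: algebra_simps)
  show "bij_betw (\<lambda>(g, b). of_int M * g - b) (UNIV \<times> ebox M) UNIV"
    by (rule bij_betwI[where g = "\<lambda>x. (- q (- x), ered M (- x))"]) (auto simp: q2 q3 ered_in_ebox M)
qed

lemma infsum_by_ebox:
  fixes h :: "eis \<Rightarrow> complex"
  assumes M: "M > 0" and h: "(\<lambda>x. norm (h x)) summable_on UNIV"
  shows "((\<lambda>g. \<Sum>b\<in>ebox M. h (of_int M * g + b)) has_sum (\<Sum>\<^sub>\<infinity>x. h x)) UNIV"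
    "((\<lambda>g. \<Sum>b\<in>ebox M. h (of_int M * g - b)) has_sum (\<Sum>\<^sub>\<infinity>x. h x)) UNIV"
proof -
  have hs: "(h has_sum (\<Sum>\<^sub>\<infinity>x. h x)) UNIV" using abs_summable_summable[OF h] by (rule has_sum_infsum)
  have "((\<lambda>z. h (case z of (g, b) \<Rightarrow> of_int M * g + b)) has_sum (\<Sum>\<^sub>\<infinity>x. h x)) (UNIV \<times> ebox M)"
    using hs by (subst has_sum_reindex_bij_betw[OF bij_betw_ebox_decomp(1)[OF M]])
  then show "((\<lambda>g. \<Sum>b\<in>ebox M. h (of_int M * g + b)) has_sum (\<Sum>\<^sub>\<infinity>x. h x)) UNIV"
    by (rule has_sum_SigmaD) auto
  have "((\<lambda>z. h (case z of (g, b) \<Rightarrow> of_int M * g - b)) has_sum (\<Sum>\<^sub>\<infinity>x. h x)) (UNIV \<times> ebox M)"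
    using hs by (subst has_sum_reindex_bij_betw[OF bij_betw_ebox_decomp(2)[OF M]])
  then show "((\<lambda>g. \<Sum>b\<in>ebox M. h (of_int M * g - b)) has_sum (\<Sum>\<^sub>\<infinity>x. h x)) UNIV"
    by (rule has_sum_SigmaD) auto
qed

text \<open>Each block M g + b is averaged with M g - b, which is legitimate as f is even; and as f
  has mean 0 over a block, twice the value at M g can be subtracted for free. What remains is a
  combination of second differences, of size N(g)^(-Re s - 1), and lattice sums converge for
  exponents above 1.\<close>

lemma periodic_dirichlet_continuation:
  assumes M: "M > 0" and per: "\<And>x y. econg M x y \<Longrightarrow> f x = f y" and even: "\<And>x. f (- x) = f x"
    and mean: "sum f (ebox M) = 0"
  shows "\<exists>F. F holomorphic_on {s. Re s > 0} \<and> (\<forall>s. Re s > 1 \<longrightarrow> F s = (\<Sum>\<^sub>\<infinity>x. f x * epow s x))"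
proof -
  define D where "D g s b = epow s (of_int M * g + b) + epow s (of_int M * g - b) - 2 * epow s (of_int M * g)" for g s b
  define T where "T g s = (\<Sum>b\<in>ebox M. f b * D g s b) / 2" for g s
  define T' where "T' g s = deriv (T g) s" for g s
  have dT: "(T g has_field_derivative T' g s) (at s)" for g s
  proof -
    have "\<exists>d. (T g has_field_derivative d) (at s)" unfolding T_def D_def
      by (rule exI) (auto intro!: derivative_eq_intros epow_has_field_derivative)
    then show ?thesis unfolding T'_def using DERIV_imp_deriv by metis
  qed
  define F where "F s = (\<Sum>\<^sub>\<infinity>g. T g s)" for s
  have "F field_differentiable at z" if z: "Re z > 0" for z
  proof -
    \<comment> \<open>The closed disc of radius r around z stays in the region of real part at least
      r > 0.\<close>
    define r where "r = Re z / 2"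
    define R where "R = norm z + r"
    have r: "r > 0" using z by (simp add: r_def)
    have sb: "norm s \<le> R" "Re s \<ge> r" if "s \<in> cball z r" for s
    proof -
      have "norm (s - z) \<le> r" using that by (simp add: dist_norm norm_minus_commute)
      moreover have "\<bar>Re (s - z)\<bar> \<le> norm (s - z)" by (rule abs_Re_le_cmod)
      ultimately show "norm s \<le> R" "Re s \<ge> r"
        using norm_triangle_ineq[of z "s - z"] by (auto simp: R_def r_def)
    qed
    have R: "R \<ge> 0" using r by (simp add: R_def)
    define nb where "nb = (\<Sum>b\<in>ebox M. eN b)"
    have nb: "nb \<ge> 0" by (simp add: nb_def sum_nonneg)
    have nbb: "eN b \<le> nb" if "b \<in> ebox M" for b
      unfolding nb_def by (rule member_le_sum) (use that in auto)
    define C where "C = (18 * (4 * R\<^sup>2 * exp R + 2 * R) + 2 * R) * nb"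
    have C: "C \<ge> 0" using R nb by (simp add: C_def)
    define C0 where "C0 = (36 * nb + 1) powr (r + 1)"
    define K where "K = C + 4 * C0"
    define P where "P = (\<Sum>b\<in>ebox M. norm (f b))"
    have P: "P \<ge> 0" by (simp add: P_def sum_nonneg)
    define B where "B g = P * (K * eN g powr (- (r + 1)) + (if g \<in> {0} then 4 else 0))" for g
    have D: "norm (D g s b) \<le> K * eN g powr (- (r + 1)) + (if g = 0 then 4 else 0)"
      if s: "s \<in> cball z r" and b: "b \<in> ebox M" for g s b
    proof -
      have D4: "norm (D g s b) \<le> 4"
      proof -
        have e1: "norm (epow s x) \<le> 1" for x using norm_epow_le_1 sb[OF s] r by auto
        then show ?thesis unfolding D_def
          using e1[of "of_int M * g + b"] e1[of "of_int M * g - b"] e1[of "of_int M * g"]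
            norm_triangle_ineq4[of "epow s (of_int M * g + b) + epow s (of_int M * g - b)" "2 * epow s (of_int M * g)"]
            norm_triangle_ineq[of "epow s (of_int M * g + b)" "epow s (of_int M * g - b)"]
          unfolding norm_mult norm_numeral by linarith
      qed
      show ?thesis
      proof (cases "g = 0")
        case False
        define z' where "z' = of_int M * g"
        have gz: "eN z' \<ge> eN g"
        proof -
          have "1 * eN g \<le> (real_of_int M)\<^sup>2 * eN g" using M by (intro mult_right_mono) auto
          moreover have "eN z' = (real_of_int M)\<^sup>2 * eN g" by (simp add: z'_def eN_mult) (simp add: eN_def)
          ultimately show ?thesis by simp
        qed
        have g1: "eN g \<ge> 1" using eN_ge_1[OF False] .
        show ?thesis
        proof (cases "eN z' \<ge> 36 * eN b")
          case True
          have z'0: "z' \<noteq> 0" using gz g1 by auto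
          have "norm (D g s b) \<le> (18 * (4 * R\<^sup>2 * exp R + 2 * R) + 2 * R) * eN b * eN z' powr (- Re s - 1)"
            unfolding D_def z'_def[symmetric] by (rule epow_second_difference[OF sb(1)[OF s] z'0 True])
          also have "\<dots> \<le> C * eN g powr (- (r + 1))" unfolding C_def
          proof (intro mult_mono mult_nonneg_nonneg)
            have "eN z' powr (- Re s - 1) \<le> eN z' powr (- (r + 1))"
              using sb(2)[OF s] gz g1 by (intro powr_mono) auto
            also have "\<dots> \<le> eN g powr (- (r + 1))" using gz g1 r by (intro powr_mono2') auto
            finally show "eN z' powr (- Re s - 1) \<le> eN g powr (- (r + 1))" .
          qed (use R nb nbb[OF b] in auto)
          also have "\<dots> \<le> K * eN g powr (- (r + 1))" by (intro mult_right_mono) (auto simp: K_def C0_def)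
          finally show ?thesis using False by simp
        next
          case nge: False
          have "eN g \<le> 36 * nb + 1" using nge gz nbb[OF b] by linarith
          then have "(36 * nb + 1) powr (- (r + 1)) \<le> eN g powr (- (r + 1))"
            using g1 r by (intro powr_mono2') auto
          then have "C0 * (36 * nb + 1) powr (- (r + 1)) \<le> C0 * eN g powr (- (r + 1))"
            by (intro mult_left_mono) (auto simp: C0_def)
          moreover have "C0 * (36 * nb + 1) powr (- (r + 1)) = 1"
            unfolding C0_def using nb by (simp flip: powr_add)
          ultimately have "4 \<le> 4 * C0 * eN g powr (- (r + 1))" by simp
          also have "\<dots> \<le> K * eN g powr (- (r + 1))" using C by (intro mult_right_mono) (auto simp: K_def)
          finally show ?thesis using D4 False by simp
        qed
      qed (use D4 in simp)
    qed
    have TB: "norm (T g s) \<le> B g" if s: "s \<in> cball z r" for g s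
    proof -
      define E where "E = K * eN g powr (- (r + 1)) + (if g = 0 then 4 else 0)"
      have "norm (\<Sum>b\<in>ebox M. f b * D g s b) \<le> (\<Sum>b\<in>ebox M. norm (f b) * E)"
        unfolding E_def by (intro sum_norm_le, unfold norm_mult, intro mult_left_mono D[OF s]) auto
      also have "\<dots> = B g" by (simp add: B_def P_def E_def sum_distrib_right)
      finally show ?thesis using norm_ge_zero[of "\<Sum>b\<in>ebox M. f b * D g s b"]
        unfolding T_def norm_divide norm_numeral by linarith
    qed
    have Bs: "B summable_on UNIV" unfolding B_def
    proof (intro summable_on_cmult_right summable_on_add)
      show "(\<lambda>x. eN x powr - (r + 1)) summable_on UNIV" using r by (intro summable_on_eN_powr) auto
      show "(\<lambda>x::eis. if x \<in> {0} then 4 else (0::real)) summable_on UNIV"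
        by (rule finite_nonzero_values_imp_summable_on) auto
    qed
    have "(F has_field_derivative (\<Sum>\<^sub>\<infinity>g. T' g z)) (at z)"
      unfolding F_def using has_field_derivative_infsum(2)[OF r dT TB Bs] r by auto
    then show ?thesis by (auto simp: field_differentiable_def)
  qed
  then have "F holomorphic_on {s. Re s > 0}"
    by (auto simp: holomorphic_on_def intro: field_differentiable_at_within)
  moreover have "F s = (\<Sum>\<^sub>\<infinity>x. f x * epow s x)" if s: "Re s > 1" for s
  proof -
    define h where "h x = f x * epow s x" for x
    define B where "B = (\<Sum>b\<in>ebox M. norm (f b))"
    have fb: "norm (f x) \<le> B" for x
    proof -
      have "f x = f (ered M x)" using per econg_ered by metis
      then show ?thesis unfolding B_def using member_le_sum[of "ered M x" "ebox M" "\<lambda>b. norm (f b)"] ered_in_ebox[OF M] by auto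
    qed
    have hs: "(\<lambda>x. norm (h x)) summable_on UNIV" unfolding h_def by (rule abs_summable_mult_epow[OF s fb])
    have fp: "f (of_int M * g + b) = f b" "f (of_int M * g - b) = f b" for g b
    proof -
      show "f (of_int M * g + b) = f b" by (rule per) (simp add: econg_def)
      have "f (of_int M * g - b) = f (- b)" by (rule per) (simp add: econg_def)
      then show "f (of_int M * g - b) = f b" by (simp add: even)
    qed
    have "((\<lambda>g. ((\<Sum>b\<in>ebox M. h (of_int M * g + b)) + (\<Sum>b\<in>ebox M. h (of_int M * g - b))) / 2) has_sum
       ((\<Sum>\<^sub>\<infinity>x. h x) + (\<Sum>\<^sub>\<infinity>x. h x)) / 2) UNIV"
      by (intro has_sum_divide_const has_sum_add infsum_by_ebox[OF M hs])
    moreover have "((\<Sum>b\<in>ebox M. h (of_int M * g + b)) + (\<Sum>b\<in>ebox M. h (of_int M * g - b))) / 2 = T g s" for g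
    proof -
      \<comment> \<open>The unshifted terms in \<open>D\<close> collect into the sum of f over the
        box times a common factor, which is 0.\<close>
      have "(\<Sum>b\<in>ebox M. h (of_int M * g + b)) + (\<Sum>b\<in>ebox M. h (of_int M * g - b))
         = (\<Sum>b\<in>ebox M. f b * D g s b) + (\<Sum>b\<in>ebox M. f b) * (2 * epow s (of_int M * g))"
        unfolding h_def fp D_def by (simp add: algebra_simps sum.distrib sum_subtractf sum_distrib_left sum_distrib_right)
      then show ?thesis by (simp add: mean T_def)
    qed
    ultimately show ?thesis unfolding F_def h_def[symmetric] by (simp add: infsumI)
  qed
  ultimately show ?thesis by blast
qed

section \<open>Prime powers and the logarithmic derivative\<close>

definition prime_powers :: "(eis \<times> nat) set" where
  "prime_powers = {(p, k). prime p \<and> k \<ge> 1}"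

definition pk :: "eis \<times> nat \<Rightarrow> eis" where "pk q = fst q ^ snd q"

text \<open>\<open>eP\<close> is the logarithm of \<open>eL\<close> up to a constant, and \<open>ePsi\<close> is minus its derivative. All sums run over elements
  rather than ideals, so \<open>eL\<close> is six times the usual \<open>L\<close>-function; \<open>prime\<close> picks one generator of each
  prime ideal.\<close>

definition eL :: "(eis \<Rightarrow> complex) \<Rightarrow> complex \<Rightarrow> complex" where
  "eL \<eta> s = (\<Sum>\<^sub>\<infinity>x. \<eta> x * epow s x)"

definition ePsi :: "(eis \<Rightarrow> complex) \<Rightarrow> complex \<Rightarrow> complex" where
  "ePsi \<eta> s = (\<Sum>\<^sub>\<infinity>q\<in>prime_powers. of_real (ln (eN (fst q))) * \<eta> (pk q) * epow s (pk q))"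

definition eP :: "(eis \<Rightarrow> complex) \<Rightarrow> complex \<Rightarrow> complex" where
  "eP \<eta> s = (\<Sum>\<^sub>\<infinity>q\<in>prime_powers. \<eta> (pk q) * epow s (pk q) / of_nat (snd q))"

lemma eN_unit: "x dvd 1 \<Longrightarrow> eN x = 1" using eis_unit_imp_enorm by (simp add: eN_def)

lemma eN_prime_ge_2: assumes "prime p" shows "eN p \<ge> 2"
proof -
  have "p \<noteq> 0" "\<not> p dvd 1" using assms by (auto simp: prime_def prime_elem_def)
  then have "enorm p > 0" "enorm p \<noteq> 1" using enorm_eq_1_imp_unit by auto
  then show ?thesis unfolding eN_def by linarith
qed

lemma pk_nonzero: "q \<in> prime_powers \<Longrightarrow> pk q \<noteq> 0"
  by (auto simp: prime_powers_def pk_def)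

lemma ln_eN_prime_ge: "q \<in> prime_powers \<Longrightarrow> ln (eN (fst q)) \<ge> ln 2"
  using eN_prime_ge_2 by (auto simp: prime_powers_def)

lemma ln_eN_prime_nonneg: "q \<in> prime_powers \<Longrightarrow> ln (eN (fst q)) \<ge> 0"
  using ln_eN_prime_ge[of q] ln_gt_zero[of "2::real"] by linarith

lemma eN_prod_mset: "eN (prod_mset A) = (\<Prod>p\<in>#A. eN p)"
  by (induction A) (auto simp: eN_mult)

text \<open>By unique factorization the prime powers dividing x are the p^k with k up to the
  multiplicity of p. The sum is the von Mangoldt identity: summing \<Lambda> over the divisors of x
  gives log N(x).\<close>

lemma prime_powers_dividing:
  assumes "x \<noteq> 0"
  shows "finite {q\<in>prime_powers. pk q dvd x}"
    "(\<Sum>q\<in>{q\<in>prime_powers. pk q dvd x}. ln (eN (fst q))) = ln (eN x)"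
proof -
  have eq: "{q\<in>prime_powers. pk q dvd x} = (SIGMA p:prime_factors x. {1..multiplicity p x})"
    (is "?A = ?B")
  proof (intro subset_antisym subsetI)
    fix q assume "q \<in> ?A"
    then obtain p k where q: "q = (p, k)" "prime p" "k \<ge> 1" "p ^ k dvd x" by (auto simp: prime_powers_def pk_def)
    have "p dvd x" using q by (metis dvd_power dvd_trans not_one_le_zero neq0_conv)
    moreover have "k \<le> multiplicity p x" using q assms by (intro multiplicity_geI) auto
    ultimately show "q \<in> ?B" using q assms by (auto simp: in_prime_factors_iff)
  next
    fix q assume "q \<in> ?B"
    then show "q \<in> ?A" by (auto simp: prime_powers_def pk_def in_prime_factors_iff multiplicity_dvd')
  qed
  show "finite ?A" unfolding eq by auto
  have "(\<Sum>q\<in>?A. ln (eN (fst q))) = (\<Sum>p\<in>prime_factors x. \<Sum>k\<in>{1..multiplicity p x}. ln (eN p))"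
    unfolding eq by (subst sum.Sigma) (auto simp: case_prod_unfold)
  also have "\<dots> = (\<Sum>p\<in>prime_factors x. ln (eN p ^ multiplicity p x))"
    by (intro sum.cong refl) (auto simp: ln_realpow in_prime_factors_iff)
  also have "\<dots> = ln (\<Prod>p\<in>prime_factors x. eN p ^ multiplicity p x)"
    by (rule ln_prod[symmetric]) (auto simp: in_prime_factors_iff)
  also have "(\<Prod>p\<in>prime_factors x. eN p ^ multiplicity p x) = eN (prod_mset (prime_factorization x))"
    unfolding eN_prod_mset image_prod_mset_multiplicity
    by (intro prod.cong refl) (auto simp: count_prime_factorization in_prime_factors_iff)
  also have "\<dots> = eN x"
  proof -
    \<comment> \<open>The factorization returns x only up to a unit, which the norm does not
      see.\<close>
    have "normalize (prod_mset (prime_factorization x)) = normalize x"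
      using assms by (rule prod_mset_prime_factorization_weak)
    then obtain u where "u dvd 1" "prod_mset (prime_factorization x) = u * x"
      using associatedE1 by blast
    then show ?thesis by (simp add: eN_mult eN_unit)
  qed
  finally show "(\<Sum>q\<in>?A. ln (eN (fst q))) = ln (eN x)" .
qed

lemma summable_on_ln_eN_powr:
  assumes "\<sigma> > 1" shows "(\<lambda>x. ln (eN x) * eN x powr (-\<sigma>)) summable_on A"
proof -
  define a where "a = (\<sigma> - 1) / 2"
  have a: "a > 0" using assms by (simp add: a_def)
  have "(\<lambda>x. (1 / a) * eN x powr (- (1 + a))) summable_on A"
    using a by (intro summable_on_cmult_right summable_on_eN_powr) auto
  then show ?thesis
  proof (rule summable_on_comparison_test)
    fix x
    show "ln (eN x) * eN x powr (-\<sigma>) \<le> (1 / a) * eN x powr (- (1 + a))"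
    proof (cases "x = 0")
      case False
      have "ln (eN x) * eN x powr (-\<sigma>) \<le> (eN x powr a / a) * eN x powr (-\<sigma>)"
        using ln_powr_bound[OF eN_ge_1[OF False] a] by (intro mult_right_mono) auto
      also have "\<dots> = (1 / a) * eN x powr (- (1 + a))"
      proof -
        have e: "a + - \<sigma> = - (1 + a)" by (simp add: a_def field_simps)
        have "eN x powr a * eN x powr (-\<sigma>) = eN x powr (- (1 + a))" by (simp only: e flip: powr_add)
        then show ?thesis by (metis mult.assoc mult.commute times_divide_eq_left mult_1)
      qed
      finally show ?thesis .
    qed simp
    show "0 \<le> ln (eN x) * eN x powr (-\<sigma>)"
      by (cases "x = 0") (auto intro!: mult_nonneg_nonneg dest: eN_ge_1)
  qed
qed

text \<open>Index set of the double sum behind -L' = \<Psi> L: sorted by x it gives the logarithm of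
  N(x), and via x = p^k y it becomes a product set.\<close>

definition dvd_pairs :: "(eis \<times> (eis \<times> nat)) set" where
  "dvd_pairs = (SIGMA x:-{0}. {q\<in>prime_powers. pk q dvd x})"

lemma bij_betw_dvd_pairs: "bij_betw (\<lambda>(q, y). (pk q * y, q)) (prime_powers \<times> -{0}) dvd_pairs"
  by (rule bij_betwI[where g = "\<lambda>(x, q). (q, x div pk q)"])
     (auto simp: dvd_pairs_def pk_nonzero)

lemma summable_on_dvd_pairs:
  assumes "\<sigma> > 1"
  shows "(\<lambda>(x, q). ln (eN (fst q)) * eN x powr (-\<sigma>)) summable_on dvd_pairs"
  unfolding dvd_pairs_def
proof (rule summable_on_SigmaI)
  fix x :: eis assume "x \<in> - {0}"
  then show "((\<lambda>q. case (x, q) of (x, q) \<Rightarrow> ln (eN (fst q)) * eN x powr (-\<sigma>)) has_sum (ln (eN x) * eN x powr (-\<sigma>))) {q\<in>prime_powers. pk q dvd x}"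
    using prime_powers_dividing[of x] by (intro has_sum_finiteI) (auto simp flip: sum_distrib_right)
qed (use summable_on_ln_eN_powr[OF assms] ln_eN_prime_nonneg in auto)

text \<open>The slice y = 1 of the double sum over p^k and y is exactly this series, so it inherits
  convergence.\<close>

lemma summable_on_prime_powers:
  assumes "\<sigma> > 1"
  shows "(\<lambda>q. ln (eN (fst q)) * eN (pk q) powr (-\<sigma>)) summable_on prime_powers"
proof -
  have "(\<lambda>z. (case (case z of (q, y) \<Rightarrow> (pk q * y, q)) of (x, q) \<Rightarrow> ln (eN (fst q)) * eN x powr (-\<sigma>))) summable_on prime_powers \<times> -{0}"
    using summable_on_dvd_pairs[OF assms] by (subst summable_on_reindex_bij_betw[OF bij_betw_dvd_pairs])
  then have "(\<lambda>z. (case (case z of (q, y) \<Rightarrow> (pk q * y, q)) of (x, q) \<Rightarrow> ln (eN (fst q)) * eN x powr (-\<sigma>))) summable_on (\<lambda>q. (q, 1)) ` prime_powers"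
    by (rule summable_on_subset_banach) auto
  then show ?thesis by (subst (asm) summable_on_reindex) (auto simp: o_def inj_on_def)
qed

lemma summable_ePsi_terms:
  assumes "Re s > 1" "\<And>x. norm (\<eta> x) \<le> 1"
  shows "(\<lambda>q. norm (of_real (ln (eN (fst q))) * \<eta> (pk q) * epow s (pk q))) summable_on prime_powers"
proof (rule summable_on_comparison_test[OF summable_on_prime_powers[OF assms(1)]])
  fix q assume q: "q \<in> prime_powers"
  show "norm (of_real (ln (eN (fst q))) * \<eta> (pk q) * epow s (pk q)) \<le> ln (eN (fst q)) * eN (pk q) powr (- Re s)"
    using ln_eN_prime_nonneg[OF q] assms(2)[of "pk q"]
    by (auto simp: norm_mult norm_epow mult.assoc intro!: mult_left_mono mult_left_le_one_le)
qed auto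

text \<open>One absolutely convergent double sum evaluated in both orders: fixing x gives log N(x),
  fixing p^k lets multiplicativity split off \<open>eL\<close>. It takes the place of
  differentiating an Euler product.\<close>

lemma sum_ln_eN_eq_ePsi_eL:
  assumes s: "Re s > 1" and b: "\<And>x. norm (\<eta> x) \<le> 1" and m: "\<And>x y. \<eta> (x * y) = \<eta> x * \<eta> y"
  shows "(\<Sum>\<^sub>\<infinity>x. of_real (ln (eN x)) * (\<eta> x * epow s x)) = ePsi \<eta> s * eL \<eta> s"
proof -
  define F where "F = (\<lambda>(x, q :: eis \<times> nat). of_real (ln (eN (fst q))) * (\<eta> x * epow s x) :: complex)"
  have Fs: "F summable_on dvd_pairs"
  proof (rule abs_summable_summable, rule summable_on_comparison_test[OF summable_on_dvd_pairs[OF s]])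
    fix z assume "z \<in> dvd_pairs"
    then obtain x q where z: "z = (x, q)" "q \<in> prime_powers" by (auto simp: dvd_pairs_def)
    show "norm (F z) \<le> (case z of (x, q) \<Rightarrow> ln (eN (fst q)) * eN x powr (- Re s))"
      using ln_eN_prime_nonneg[OF z(2)] b[of x]
      by (auto simp: F_def z norm_mult norm_epow intro!: mult_left_mono mult_left_le_one_le)
  qed auto
  have "infsum F dvd_pairs = (\<Sum>\<^sub>\<infinity>x\<in>-{0}. \<Sum>\<^sub>\<infinity>q\<in>{q\<in>prime_powers. pk q dvd x}. F (x, q))"
    using Fs unfolding dvd_pairs_def by (subst infsum_Sigma_banach) auto
  also have "\<dots> = (\<Sum>\<^sub>\<infinity>x\<in>-{0}. of_real (ln (eN x)) * (\<eta> x * epow s x))"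
  proof (rule infsum_cong)
    fix x :: eis assume "x \<in> -{0}"
    then have x: "x \<noteq> 0" by simp
    show "(\<Sum>\<^sub>\<infinity>q\<in>{q\<in>prime_powers. pk q dvd x}. F (x, q)) = of_real (ln (eN x)) * (\<eta> x * epow s x)"
      using prime_powers_dividing(1)[OF x]
      by (simp add: F_def prime_powers_dividing(2)[OF x, symmetric] flip: sum_distrib_right)
  qed
  also have "\<dots> = (\<Sum>\<^sub>\<infinity>x. of_real (ln (eN x)) * (\<eta> x * epow s x))"
    by (rule infsum_cong_neutral) auto
  finally have 1: "infsum F dvd_pairs = \<dots>" .
  have "infsum F dvd_pairs = (\<Sum>\<^sub>\<infinity>z\<in>prime_powers \<times> -{0}. F (case z of (q, y) \<Rightarrow> (pk q * y, q)))"
    by (rule infsum_reindex_bij_betw[OF bij_betw_dvd_pairs, symmetric])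
  also have "\<dots> = (\<Sum>\<^sub>\<infinity>q\<in>prime_powers. \<Sum>\<^sub>\<infinity>y\<in>-{0}. F (pk q * y, q))"
  proof -
    have "(\<lambda>z. F (case z of (q, y) \<Rightarrow> (pk q * y, q))) summable_on prime_powers \<times> -{0}"
      using Fs by (subst summable_on_reindex_bij_betw[OF bij_betw_dvd_pairs])
    from infsum_Sigma_banach[OF this] show ?thesis by simp
  qed
  also have "\<dots> = (\<Sum>\<^sub>\<infinity>q\<in>prime_powers. (of_real (ln (eN (fst q))) * \<eta> (pk q) * epow s (pk q)) * eL \<eta> s)"
  proof (rule infsum_cong)
    fix q assume "q \<in> prime_powers"
    have "(\<Sum>\<^sub>\<infinity>y\<in>-{0}. F (pk q * y, q)) = (\<Sum>\<^sub>\<infinity>y\<in>-{0}. (of_real (ln (eN (fst q))) * \<eta> (pk q) * epow s (pk q)) * (\<eta> y * epow s y))"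
      by (intro infsum_cong) (simp add: F_def m epow_mult mult_ac)
    also have "\<dots> = (of_real (ln (eN (fst q))) * \<eta> (pk q) * epow s (pk q)) * (\<Sum>\<^sub>\<infinity>y\<in>-{0}. \<eta> y * epow s y)"
      by (rule infsum_cmult_right')
    also have "(\<Sum>\<^sub>\<infinity>y\<in>-{0}. \<eta> y * epow s y) = eL \<eta> s"
      unfolding eL_def by (rule infsum_cong_neutral) auto
    finally show "(\<Sum>\<^sub>\<infinity>y\<in>-{0}. F (pk q * y, q)) = (of_real (ln (eN (fst q))) * \<eta> (pk q) * epow s (pk q)) * eL \<eta> s" .
  qed
  also have "\<dots> = ePsi \<eta> s * eL \<eta> s" unfolding ePsi_def by (rule infsum_cmult_left')
  finally show ?thesis using 1 by simp
qed

lemma Re_ge_in_cball: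
  fixes s w :: complex assumes "w \<in> cball s r" shows "Re w \<ge> Re s - r"
proof -
  have "norm (w - s) \<le> r" using assms by (simp add: dist_norm norm_minus_commute)
  then show ?thesis using abs_Re_le_cmod[of "w - s"] by simp
qed

lemma norm_epow_mono: "\<sigma> \<le> Re s \<Longrightarrow> norm (epow s x) \<le> eN x powr (- \<sigma>)"
  unfolding norm_epow by (cases "x = 0") (auto intro!: powr_mono dest: eN_ge_1)

lemma eL_has_field_derivative:
  assumes s: "Re s > 1" and b: "\<And>x. norm (\<eta> x) \<le> 1" and m: "\<And>x y. \<eta> (x * y) = \<eta> x * \<eta> y"
  shows "(eL \<eta> has_field_derivative (- ePsi \<eta> s * eL \<eta> s)) (at s)"
proof -
  define r where "r = (Re s - 1) / 2"
  have r: "r > 0" "Re s - r > 1" using s by (auto simp: r_def field_simps)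
  have "(eL \<eta> has_field_derivative (\<Sum>\<^sub>\<infinity>x. \<eta> x * (- of_real (ln (eN x)) * epow s x))) (at s)"
    unfolding eL_def
  proof (rule has_field_derivative_infsum(2)[OF r(1)])
    show "norm (\<eta> x * epow w x) \<le> eN x powr (- (Re s - r))" if "w \<in> cball s r" for x w
      using mult_mono[OF b[of x] norm_epow_mono[OF Re_ge_in_cball[OF that], of x]] by (simp add: norm_mult)
    show "(\<lambda>x. eN x powr - (Re s - r)) summable_on UNIV" by (rule summable_on_eN_powr[OF r(2)])
    show "((\<lambda>s. \<eta> x * epow s x) has_field_derivative \<eta> x * (- of_real (ln (eN x)) * epow w x)) (at w)" for x w
      by (intro DERIV_cmult epow_has_field_derivative)
  qed (use r in auto)
  also have "(\<Sum>\<^sub>\<infinity>x. \<eta> x * (- of_real (ln (eN x)) * epow s x)) = - (\<Sum>\<^sub>\<infinity>x. of_real (ln (eN x)) * (\<eta> x * epow s x))"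
    by (subst infsum_uminus[symmetric]) (simp add: mult_ac)
  finally show ?thesis unfolding sum_ln_eN_eq_ePsi_eL[OF assms] by simp
qed

lemma eP_has_field_derivative:
  assumes s: "Re s > 1" and b: "\<And>x. norm (\<eta> x) \<le> 1"
  shows "(eP \<eta> has_field_derivative (- ePsi \<eta> s)) (at s)"
proof -
  define r where "r = (Re s - 1) / 2"
  have r: "r > 0" "Re s - r > 1" using s by (auto simp: r_def field_simps)
  have "(eP \<eta> has_field_derivative (\<Sum>\<^sub>\<infinity>q\<in>prime_powers. \<eta> (pk q) / of_nat (snd q) * (- of_real (ln (eN (pk q))) * epow s (pk q)))) (at s)"
    unfolding eP_def
  proof (rule has_field_derivative_infsum(2)[OF r(1)])
    fix q w assume q: "q \<in> prime_powers" and w: "w \<in> cball s r"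
    have k: "snd q \<ge> 1" using q by (auto simp: prime_powers_def)
    have "norm (\<eta> (pk q) * epow w (pk q) / of_nat (snd q)) \<le> norm (\<eta> (pk q) * epow w (pk q))"
      using k by (simp add: norm_divide divide_simps mult_le_cancel_left1)
    also have "\<dots> \<le> 1 * eN (pk q) powr (- (Re s - r))"
      unfolding norm_mult by (intro mult_mono b norm_epow_mono[OF Re_ge_in_cball[OF w]]) auto
    also have "\<dots> \<le> (ln (eN (fst q)) / ln 2) * eN (pk q) powr (- (Re s - r))"
      using ln_eN_prime_ge[OF q] by (intro mult_right_mono) auto
    finally show "norm (\<eta> (pk q) * epow w (pk q) / of_nat (snd q)) \<le> (1 / ln 2) * (ln (eN (fst q)) * eN (pk q) powr (- (Re s - r)))"
      by simp
    show "((\<lambda>s. \<eta> (pk q) * epow s (pk q) / of_nat (snd q)) has_field_derivative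
       \<eta> (pk q) / of_nat (snd q) * (- of_real (ln (eN (pk q))) * epow w (pk q))) (at w)"
      using DERIV_cmult[OF epow_has_field_derivative, of "\<eta> (pk q) / of_nat (snd q)"] by simp
  next
    show "(\<lambda>q. (1 / ln 2) * (ln (eN (fst q)) * eN (pk q) powr (- (Re s - r)))) summable_on prime_powers"
      by (intro summable_on_cmult_right summable_on_prime_powers[OF r(2)])
  qed (use r in auto)
  also have "(\<Sum>\<^sub>\<infinity>q\<in>prime_powers. \<eta> (pk q) / of_nat (snd q) * (- of_real (ln (eN (pk q))) * epow s (pk q))) = - ePsi \<eta> s"
    unfolding ePsi_def infsum_uminus[symmetric]
  proof (rule infsum_cong)
    fix q assume q: "q \<in> prime_powers"
    then have "snd q \<noteq> 0" "eN (fst q) > 0" by (auto simp: prime_powers_def)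
    then show "\<eta> (pk q) / of_nat (snd q) * (- of_real (ln (eN (pk q))) * epow s (pk q))
       = - (of_real (ln (eN (fst q))) * \<eta> (pk q) * epow s (pk q))"
      by (simp add: pk_def eN_power ln_realpow)
  qed
  finally show ?thesis .
qed

text \<open>\<open>eL\<close> and the exponential of \<open>eP\<close> have the same logarithmic
  derivative - \<open>ePsi\<close>, so their quotient is constant on the half-plane. The constant is
  nonzero because for large real s the units alone survive in \<open>eL\<close>.\<close>

lemma eL_eq_exp_eP:
  assumes b: "\<And>x. norm (\<eta> x) \<le> 1" and m: "\<And>x y. \<eta> (x * y) = \<eta> x * \<eta> y" and u: "\<And>u. u dvd 1 \<Longrightarrow> \<eta> u = 1"
  shows "\<exists>c. c \<noteq> 0 \<and> (\<forall>s. Re s > 1 \<longrightarrow> eL \<eta> s = c * exp (eP \<eta> s))"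
proof -
  define H where "H = {s. Re s > 1}"
  have "convex H" unfolding H_def by (rule convex_halfspace_Re_gt)
  moreover have "((\<lambda>s. eL \<eta> s * exp (- eP \<eta> s)) has_field_derivative 0) (at s within H)" if "s \<in> H" for s
  proof -
    have s: "Re s > 1" using that by (simp add: H_def)
    show ?thesis
      by (rule derivative_eq_intros eL_has_field_derivative[OF s b m, THEN DERIV_subset]
        eP_has_field_derivative[OF s b, THEN DERIV_subset] refl subset_UNIV)+ (simp add: algebra_simps)
  qed
  ultimately obtain c where c: "\<And>s. s \<in> H \<Longrightarrow> eL \<eta> s * exp (- eP \<eta> s) = c"
    using has_field_derivative_zero_constant[of H "\<lambda>s. eL \<eta> s * exp (- eP \<eta> s)"] by blast
  have eq: "eL \<eta> s = c * exp (eP \<eta> s)" if "Re s > 1" for s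
    using c[of s] that by (auto simp: H_def exp_minus field_simps)
  moreover have "c \<noteq> 0"
  proof
    assume "c = 0"
    then have L0: "eL \<eta> s = 0" if "Re s > 1" for s using eq[OF that] by simp
    define U where "U = {x::eis. x dvd 1}"
    define C where "C = (\<Sum>\<^sub>\<infinity>x\<in>-U. eN x powr (-2))"
    have C: "C \<ge> 0" unfolding C_def by (rule infsum_nonneg) auto
    \<comment> \<open>If \<open>eL\<close> vanished at 2 + t, the units, which contribute at least
      1, would be cancelled by the nonzero nonunits, all of norm at least 2, whose share decays like
      2^(-t).\<close>
    have "1 \<le> 2 powr (- t) * C" if t: "t > 0" for t :: real
    proof -
      define s where "s = complex_of_real (2 + t)"
      have s: "Re s > 1" using t by (simp add: s_def)
      define h where "h x = \<eta> x * epow s x" for x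
      have hn: "(\<lambda>x. norm (h x)) summable_on A" for A unfolding h_def by (rule abs_summable_mult_epow[OF s b])
      have hs: "h summable_on A" for A using hn abs_summable_summable by blast
      have hU: "h x = 1" if "x \<in> U" for x using that u[of x] eN_unit[of x] by (simp add: h_def U_def epow_def)
      have "(\<Sum>\<^sub>\<infinity>x. h x) = (\<Sum>\<^sub>\<infinity>x\<in>U. h x) + (\<Sum>\<^sub>\<infinity>x\<in>-U. h x)"
        using infsum_Un_disjoint[OF hs[of U] hs[of "-U"]] by simp
      then have z: "(\<Sum>\<^sub>\<infinity>x\<in>U. h x) = - (\<Sum>\<^sub>\<infinity>x\<in>-U. h x)" using L0[OF s]
        by (simp add: eL_def h_def eq_neg_iff_add_eq_0)
      have "(\<lambda>x. norm (h x)) summable_on U" by (rule hn)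
      then have "sum (\<lambda>x. norm (h x)) {1} \<le> (\<Sum>\<^sub>\<infinity>x\<in>U. norm (h x))"
        by (rule finite_sum_le_infsum) (auto simp: U_def)
      moreover have "(\<Sum>\<^sub>\<infinity>x\<in>U. norm (h x)) = Re (\<Sum>\<^sub>\<infinity>x\<in>U. h x)"
        using hU by (subst infsum_Re[OF hs, symmetric]) (auto intro!: infsum_cong)
      ultimately have "1 \<le> Re (\<Sum>\<^sub>\<infinity>x\<in>U. h x)" using hU[of 1] by (simp add: U_def)
      also have "\<dots> \<le> norm (\<Sum>\<^sub>\<infinity>x\<in>U. h x)" by (rule complex_Re_le_cmod)
      also have "\<dots> \<le> (\<Sum>\<^sub>\<infinity>x\<in>-U. norm (h x))" unfolding z norm_minus_cancel by (rule norm_infsum_bound[OF hn])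
      also have "\<dots> \<le> (\<Sum>\<^sub>\<infinity>x\<in>-U. 2 powr (- t) * eN x powr (-2))"
      proof (rule infsum_mono[OF hn])
        show "(\<lambda>x. 2 powr (- t) * eN x powr (-2)) summable_on - U"
          by (intro summable_on_cmult_right summable_on_eN_powr) auto
        fix x assume x: "x \<in> - U"
        show "norm (h x) \<le> 2 powr (- t) * eN x powr (-2)"
        proof (cases "x = 0")
          case False
          have "enorm x > 0" "enorm x \<noteq> 1" using False x enorm_eq_1_imp_unit by (auto simp: U_def)
          then have "eN x \<ge> 2" unfolding eN_def by linarith
          have "norm (h x) \<le> 1 * eN x powr (- 2 - t)" unfolding h_def norm_mult
            by (intro mult_mono b) (auto simp: norm_epow s_def)
          also have "\<dots> = eN x powr (- t) * eN x powr (- 2)" using powr_add[of "eN x" "- 2" "- t"] by (simp add: mult.commute)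
          also have "\<dots> \<le> 2 powr (- t) * eN x powr (-2)"
            using t \<open>eN x \<ge> 2\<close> by (intro mult_right_mono powr_mono2') auto
          finally show ?thesis .
        qed (simp add: h_def)
      qed
      also have "\<dots> = 2 powr (- t) * C" unfolding C_def by (rule infsum_cmult_right')
      finally show ?thesis .
    qed
    moreover have "((\<lambda>t. 2 powr (- t) * C) \<longlongrightarrow> 0 * C) at_top"
    proof (intro tendsto_mult tendsto_const)
      show "((\<lambda>t::real. 2 powr (- t)) \<longlongrightarrow> 0) at_top" by real_asymp
    qed
    ultimately have "1 \<le> 0 * C"
      by (intro tendsto_lowerbound[of "\<lambda>t. 2 powr (- t) * C" _ at_top])
         (auto intro: eventually_mono[OF eventually_gt_at_top[of 0]])
    then show False by simp
  qed
  ultimately show ?thesis by blast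
qed

text \<open>Landau's theorem for a function \<open>W\<close> whose negative logarithmic derivative is a Dirichlet series
  with nonnegative coefficients: the Taylor coefficients of \<open>W (2 - t) / W 2\<close> are nonnegative and dominate those of
  the series.\<close>

lemma landau_ode:
  fixes c lam :: "'i \<Rightarrow> real" and W :: "complex \<Rightarrow> complex"
  assumes c: "\<And>i. i \<in> A \<Longrightarrow> c i \<ge> 0" and lam: "\<And>i. i \<in> A \<Longrightarrow> lam i \<ge> 0"
    and sm: "\<And>\<sigma>. \<sigma> > 1 \<Longrightarrow> (\<lambda>i. c i * exp (- (lam i * \<sigma>))) summable_on A"
    and W: "W holomorphic_on ball 2 2"
    and ode: "\<And>z. z \<in> ball 2 1 \<Longrightarrow>
        (W has_field_derivative (- (\<Sum>\<^sub>\<infinity>i\<in>A. of_real (c i) * exp (- (of_real (lam i) * z))) * W z)) (at z)"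
    and W2: "W 2 \<noteq> 0" and \<sigma>: "0 < \<sigma>" "\<sigma> < 2"
  shows "(\<lambda>i. c i * exp (- (lam i * \<sigma>))) summable_on A"
proof -
  \<comment> \<open>Everything is recentred at 2: with z = 2 - t the series becomes
    \<open>Phi\<close>, and \<open>b k\<close> is its k-th Taylor coefficient at t = 0.\<close>
  define d where "d i = c i * exp (- (lam i * 2))" for i
  have d: "d i \<ge> 0" if "i \<in> A" for i using c[OF that] by (simp add: d_def)
  define b where "b k = (\<Sum>\<^sub>\<infinity>i\<in>A. d i * (lam i ^ k / fact k))" for k
  have dsum: "(\<lambda>i. d i * exp (lam i * t)) summable_on A" if "t < 1" for t
    using sm[of "2 - t"] that by (simp add: d_def algebra_simps flip: exp_add)
  have exps: "((\<lambda>k. (x * t) ^ k / fact k) has_sum exp (x * t)) UNIV" if "x \<ge> 0" "t \<ge> 0" for x t :: real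
    by (rule norm_summable_imp_has_sum) (use that summable_exp_generic[of "x * t"] exp_converges[of "x * t"] in \<open>auto simp: divide_inverse mult.commute\<close>)
  \<comment> \<open>Summability of the nonnegative double family in i and k is what permits
    rearranging the series into powers of t.\<close>
  have pairs: "(\<lambda>(i, k). d i * ((lam i * t) ^ k / fact k)) summable_on A \<times> UNIV" if "0 \<le> t" "t < 1" for t
  proof (rule summable_on_SigmaI)
    show "((\<lambda>k. case (i, k) of (i, k) \<Rightarrow> d i * ((lam i * t) ^ k / fact k)) has_sum d i * exp (lam i * t)) UNIV" if "i \<in> A" for i
      using has_sum_cmult_right[OF exps[OF lam[OF that] \<open>0 \<le> t\<close>]] by simp
  qed (use dsum[OF that(2)] d lam that(1) in auto)
  have bsum: "(\<lambda>i. d i * (lam i ^ k / fact k)) summable_on A" for k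
  proof -
    have "(\<lambda>z. case z of (i, k) \<Rightarrow> d i * ((lam i * (1/2)) ^ k / fact k)) summable_on ((\<lambda>i. (i, k)) ` A)"
      by (rule summable_on_subset_banach[OF pairs[of "1/2"]]) auto
    then have "(\<lambda>i. d i * ((lam i * (1/2)) ^ k / fact k)) summable_on A"
      by (subst (asm) summable_on_reindex) (auto simp: inj_on_def o_def)
    then have "(\<lambda>i. 2 ^ k * (d i * ((lam i * (1/2)) ^ k / fact k))) summable_on A"
      by (rule summable_on_cmult_right)
    then show ?thesis by (simp add: power_divide)
  qed
  have b0: "b k \<ge> 0" for k unfolding b_def by (intro infsum_nonneg mult_nonneg_nonneg d) (auto simp: lam)
  define Phi where "Phi t = (\<Sum>\<^sub>\<infinity>i\<in>A. of_real (d i) * exp (of_real (lam i) * t))" for t :: complex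
  have Phi: "((\<lambda>k. of_real (b k) * t ^ k) has_sum Phi t) UNIV" if t: "norm t < 1" for t
  proof -
    define G where "G = (\<lambda>(i, k). complex_of_real (d i) * ((of_real (lam i) * t) ^ k / fact k))"
    have "(\<lambda>z. norm (G z)) summable_on A \<times> UNIV"
      by (rule summable_on_cong[THEN iffD1, OF _ pairs[of "norm t"]])
         (use t d lam in \<open>auto simp: G_def norm_mult norm_divide norm_power\<close>)
    then have Gs: "G summable_on A \<times> UNIV" by (rule abs_summable_summable)
    have inner: "((\<lambda>k. G (i, k)) has_sum (of_real (d i) * exp (of_real (lam i) * t))) UNIV" for i
    proof -
      have "((\<lambda>k. (of_real (lam i) * t) ^ k / fact k) has_sum exp (of_real (lam i) * t)) UNIV"
        by (rule norm_summable_imp_has_sum)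
           (use summable_norm_exp[of "of_real (lam i) * t"] exp_converges[of "of_real (lam i) * t"] in \<open>auto simp: divide_inverse mult.commute scaleR_conv_of_real\<close>)
      from has_sum_cmult_right[OF this, of "of_real (d i)"] show ?thesis by (simp add: G_def)
    qed
    have "Phi t = infsum G (A \<times> UNIV)"
      unfolding Phi_def by (subst infsum_Sigma_banach[OF Gs, symmetric]) (auto intro!: infsum_cong infsumI[OF inner, symmetric])
    moreover have GP: "(G has_sum infsum G (A \<times> UNIV)) (A \<times> UNIV)" using Gs by simp
    have "((\<lambda>(k, i). G (i, k)) has_sum infsum G (A \<times> UNIV)) (UNIV \<times> A)"
      using GP by (subst (asm) has_sum_swap) (simp add: case_prod_unfold)
    then have "((\<lambda>k. of_real (b k) * t ^ k) has_sum infsum G (A \<times> UNIV)) UNIV"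
    proof (rule has_sum_SigmaD)
      fix k :: nat
      have "((\<lambda>i. of_real (d i * (lam i ^ k / fact k))) has_sum complex_of_real (b k)) A"
        unfolding b_def by (intro has_sum_of_real has_sum_infsum bsum)
      then have "((\<lambda>i. of_real (d i * (lam i ^ k / fact k)) * t ^ k) has_sum complex_of_real (b k) * t ^ k) A"
        by (rule has_sum_cmult_left)
      then show "((\<lambda>i. case (k, i) of (k, i) \<Rightarrow> G (i, k)) has_sum complex_of_real (b k) * t ^ k) A"
        by (simp add: G_def power_mult_distrib mult.assoc)
    qed
    ultimately show ?thesis by simp
  qed
  define V where "V t = W (2 - t) / W 2" for t
  have V: "V holomorphic_on ball 0 2" unfolding V_def
  proof (intro holomorphic_intros holomorphic_on_compose_gen[OF _ W, unfolded o_def])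
    show "(\<lambda>t. 2 - t) ` ball 0 2 \<subseteq> ball (2::complex) 2" by (auto simp: dist_norm)
  qed (use W2 in auto)
  have V': "(V has_field_derivative Phi t * V t) (at t)" if t: "norm t < 1" for t
  proof -
    have z: "2 - t \<in> ball 2 1" using t by (simp add: dist_norm)
    have Pz: "(\<Sum>\<^sub>\<infinity>i\<in>A. of_real (c i) * exp (- (of_real (lam i) * (2 - t)))) = Phi t"
      unfolding Phi_def d_def
      by (intro infsum_cong) (simp add: algebra_simps flip: exp_of_real exp_add)
    have "((\<lambda>t. W (2 - t)) has_field_derivative (- Phi t * W (2 - t)) * (- 1)) (at t)"
      by (rule DERIV_chain2[where f = W and g = "\<lambda>t. 2 - t"])
         (use ode[OF z] in \<open>auto simp: Pz intro!: derivative_eq_intros\<close>)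
    then show ?thesis using W2 unfolding V_def by (auto intro!: derivative_eq_intros)
  qed
  define FV where "FV = fps_expansion V 0"
  define G where "G = Abs_fps (\<lambda>k. complex_of_real (b k))"
  have FV: "V has_fps_expansion FV" unfolding FV_def using V by (intro has_fps_expansion_fps_expansion[of "ball 0 2"]) auto
  have G: "Phi has_fps_expansion G"
    unfolding has_fps_expansion_def
  proof
    have "summable (\<lambda>n. of_real (b n) * (1/2 :: complex) ^ n)"
      using Phi[of "1/2"] by (intro summable_on_imp_summable) (auto simp: summable_on_def)
    then have "conv_radius (fps_nth G) \<ge> norm (1/2::complex)" unfolding G_def by (intro conv_radius_geI) simp
    then show "0 < fps_conv_radius G" unfolding fps_conv_radius_def
      by (rule less_le_trans[rotated]) simp
    have "\<forall>\<^sub>F z in nhds 0. z \<in> ball (0::complex) 1" by (intro eventually_nhds_in_open) auto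
    then show "\<forall>\<^sub>F z in nhds 0. eval_fps G z = Phi z"
    proof eventually_elim
      case (elim z)
      then have "(\<lambda>k. of_real (b k) * z ^ k) sums Phi z" using Phi[of z] by (intro has_sum_imp_sums) auto
      then show ?case by (simp add: eval_fps_def G_def sums_iff)
    qed
  qed
  have "(\<lambda>t. Phi t * V t) has_fps_expansion G * FV" by (intro has_fps_expansion_mult G FV)
  moreover have "\<forall>\<^sub>F t in nhds 0. deriv V t = Phi t * V t"
  proof -
    have "\<forall>\<^sub>F z in nhds 0. z \<in> ball (0::complex) 1" by (intro eventually_nhds_in_open) auto
    then show ?thesis by eventually_elim (auto intro!: DERIV_imp_deriv V')
  qed
  ultimately have "deriv V has_fps_expansion G * FV" by (subst has_fps_expansion_cong) auto
  then have eq: "fps_deriv FV = G * FV"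
    using fps_expansion_unique_complex has_fps_expansion_deriv[OF FV] by blast
  \<comment> \<open>Comparison of coefficients in V' = Phi V. The recursion has nonnegative weights
    and starts at V(0) = 1, so all coefficients of V are nonnegative.\<close>
  have rec: "of_nat (Suc n) * fps_nth FV (Suc n) = (\<Sum>j=0..n. of_real (b j) * fps_nth FV (n - j))" for n
    using arg_cong[OF eq, of "\<lambda>F. fps_nth F n"] by (simp add: fps_mult_nth G_def)
  have FV0: "fps_nth FV 0 = 1" using W2 by (simp add: FV_def fps_expansion_def V_def)
  have real: "fps_nth FV n \<in> \<real> \<and> Re (fps_nth FV n) \<ge> 0" for n
  proof (induction n rule: less_induct)
    case (less n)
    show ?case
    proof (cases n)
      case (Suc m)
      define S where "S = (\<Sum>j=0..m. of_real (b j) * fps_nth FV (m - j))"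
      have "S \<in> \<real>" "Re S \<ge> 0" unfolding S_def
        using less.IH Suc b0 by (auto intro!: sum_in_Reals Reals_mult sum_nonneg mult_nonneg_nonneg)
      moreover have "fps_nth FV n = S / of_nat (Suc m)"
        using rec[of m] Suc by (simp add: S_def field_simps del: of_nat_Suc)
      ultimately show ?thesis by (auto simp: Re_divide_of_nat simp del: of_nat_Suc)
    qed (use FV0 in simp)
  qed
  have bn: "b n \<le> norm (fps_nth (fps_deriv FV) n)" for n
  proof -
    have "fps_nth (fps_deriv FV) n = (\<Sum>j=0..n. of_real (b j) * fps_nth FV (n - j))" using rec[of n] by simp
    then have "Re (fps_nth (fps_deriv FV) n) = (\<Sum>j=0..n. b j * Re (fps_nth FV (n - j)))" by simp
    \<comment> \<open>Of the convolution only the term j = n, with factor V(0) = 1, is kept.\<close>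
    also have "\<dots> \<ge> (\<Sum>j\<in>{n}. b j * Re (fps_nth FV (n - j)))"
      using b0 real by (intro sum_mono2) auto
    finally show ?thesis using complex_Re_le_cmod[of "fps_nth (fps_deriv FV) n"] FV0 by simp
  qed
  define t where "t = 2 - \<sigma>"
  have t: "0 < t" "t < 2" using \<sigma> by (auto simp: t_def)
  \<comment> \<open>Holomorphy on the disc of radius 2 forces the power series of V, hence that of
    V' and its minorant \<open>b\<close>, to converge at t = 2 - \<sigma>, even beyond the unit disc
    where the differential equation is given.\<close>
  have "fps_conv_radius FV \<ge> 2" unfolding FV_def using V by (intro conv_radius_fps_expansion) auto
  then have cr: "fps_conv_radius (fps_deriv FV) \<ge> 2" using fps_conv_radius_deriv order_trans by blast
  have "ereal (norm (complex_of_real t)) < fps_conv_radius (fps_deriv FV)"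
    by (rule less_le_trans[OF _ cr]) (use t in simp)
  then have "summable (\<lambda>n. norm (fps_nth (fps_deriv FV) n * of_real t ^ n))" by (rule norm_summable_fps)
  then have bt: "summable (\<lambda>n. b n * t ^ n)"
    by (rule summable_comparison_test_ev[rotated])
       (use bn b0 t in \<open>auto intro!: always_eventually mult_right_mono simp: norm_mult norm_power abs_mult simp del: fps_deriv_nth\<close>)
  have "(\<lambda>i. d i * exp (lam i * t)) summable_on A"
  proof (rule nonneg_bdd_above_summable_on)
    show "bdd_above (sum (\<lambda>i. d i * exp (lam i * t)) ` {F. F \<subseteq> A \<and> finite F})"
    proof (rule bdd_aboveI2)
      fix F assume "F \<in> {F. F \<subseteq> A \<and> finite F}"
      then have F: "F \<subseteq> A" "finite F" by auto
      have "(\<lambda>k. \<Sum>i\<in>F. d i * ((lam i * t) ^ k / fact k)) sums (\<Sum>i\<in>F. d i * exp (lam i * t))"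
        using exps[OF lam, THEN has_sum_imp_sums] F t by (intro sums_sum sums_mult) auto
      moreover have "(\<Sum>i\<in>F. d i * ((lam i * t) ^ k / fact k)) \<le> b k * t ^ k" for k
      proof -
        have *: "(\<Sum>i\<in>F. d i * (lam i ^ k / fact k)) \<le> b k" unfolding b_def
          using F d lam by (intro finite_sum_le_infsum bsum) auto
        have "(\<Sum>i\<in>F. d i * ((lam i * t) ^ k / fact k)) = (\<Sum>i\<in>F. d i * (lam i ^ k / fact k)) * t ^ k"
          unfolding sum_distrib_right by (intro sum.cong refl) (simp add: power_mult_distrib)
        also have "\<dots> \<le> b k * t ^ k" using t * by (intro mult_right_mono) auto
        finally show ?thesis .
      qed
      ultimately show "(\<Sum>i\<in>F. d i * exp (lam i * t)) \<le> (\<Sum>k. b k * t ^ k)"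
        by (intro sums_le[OF _ _ summable_sums[OF bt]])
    qed
  qed (use d in auto)
  then show ?thesis by (simp add: d_def t_def algebra_simps flip: exp_add)
qed

section \<open>Primes in residue classes of the Eisenstein integers\<close>

text \<open>For k \<ge> 2 and n \<ge> 2 one has n^k \<ge> n^2 2^(k - 2), so the series is dominated
  by the product of a convergent sum with exponent 2 and a geometric series; 4 turns 2^(-k) into
  2^(2 - k).\<close>

lemma summable_on_higher_prime_powers:
  "(\<lambda>q. ln (eN (fst q)) / eN (pk q)) summable_on {q\<in>prime_powers. snd q \<ge> 2}"
proof -
  have "(\<lambda>k::nat. (1/2::real) ^ k) summable_on UNIV"
    by (intro norm_summable_imp_summable_on) auto
  then have "(\<lambda>(p, k). (ln (eN p) * eN p powr (-2)) * (1/2) ^ k) summable_on (- {0}) \<times> UNIV"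
    by (intro summable_on_prod_nonneg summable_on_ln_eN_powr)
       (auto intro!: mult_nonneg_nonneg dest: eN_ge_1)
  then have "(\<lambda>(p, k). (ln (eN p) * eN p powr (-2)) * (1/2) ^ k) summable_on {q\<in>prime_powers. snd q \<ge> 2}"
    by (rule summable_on_subset_banach) (auto simp: prime_powers_def)
  then have "(\<lambda>z. 4 * (case z of (p, k) \<Rightarrow> (ln (eN p) * eN p powr (-2)) * (1/2) ^ k)) summable_on {q\<in>prime_powers. snd q \<ge> 2}"
    by (rule summable_on_cmult_right)
  then show ?thesis
  proof (rule summable_on_comparison_test)
    fix q assume q: "q \<in> {q\<in>prime_powers. snd q \<ge> 2}"
    obtain p k where pk': "q = (p, k)" by (cases q)
    have p: "prime p" and k: "k \<ge> 2" using q by (auto simp: pk' prime_powers_def)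
    define n where "n = eN p"
    have n: "n \<ge> 2" using eN_prime_ge_2[OF p] by (simp add: n_def)
    have "n\<^sup>2 * 2 ^ (k - 2) \<le> n\<^sup>2 * n ^ (k - 2)" using n by (intro mult_left_mono power_mono) auto
    also have "\<dots> = n ^ k" using k by (metis le_add_diff_inverse power_add)
    finally have *: "n\<^sup>2 * 2 ^ (k - 2) \<le> n ^ k" .
    have "ln n / n ^ k \<le> ln n / (n\<^sup>2 * 2 ^ (k - 2))"
      using n * by (intro divide_left_mono) auto
    also have "\<dots> = 4 * ((ln n * n powr (-2)) * (1/2) ^ k)"
    proof -
      have "(2::real) ^ k = 2 ^ 2 * 2 ^ (k - 2)" using k by (metis le_add_diff_inverse power_add)
      then have "(2::real) ^ k = 4 * 2 ^ (k - 2)" by simp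
      then show ?thesis using n by (simp add: powr_minus powr_numeral divide_simps power_divide)
    qed
    finally show "ln (eN (fst q)) / eN (pk q) \<le> 4 * (case q of (p, k) \<Rightarrow> (ln (eN p) * eN p powr (-2)) * (1/2) ^ k)"
      by (simp add: pk' pk_def eN_power n_def)
    show "0 \<le> ln (eN (fst q)) / eN (pk q)" using n by (simp add: pk' n_def)
  qed
qed

text \<open>Carries a bound for s slightly above 1 over to s = 1. On finite sets the limit is
  harmless, and for nonnegative terms bounded finite sums are all that summability asks for.\<close>

lemma sum_powr_limit:
  assumes F: "finite F" "\<And>x. x \<in> F \<Longrightarrow> y x > (0::real)"
    and b: "\<And>s. 1 < s \<Longrightarrow> s < 2 \<Longrightarrow> (\<Sum>x\<in>F. a x * y x powr (- s)) \<le> K"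
  shows "(\<Sum>x\<in>F. a x / y x) \<le> (K::real)"
proof -
  have "((\<lambda>s. \<Sum>x\<in>F. a x * y x powr (- s)) \<longlongrightarrow> (\<Sum>x\<in>F. a x * y x powr (- 1))) (at_right 1)"
    using F by (intro tendsto_intros) (auto intro!: tendsto_eq_intros dest: F(2))
  moreover have "\<forall>\<^sub>F s in at_right 1. (\<Sum>x\<in>F. a x * y x powr (- s)) \<le> K"
    using b by (auto simp: eventually_at_right_field intro!: exI[of _ 2])
  ultimately have "(\<Sum>x\<in>F. a x * y x powr (- 1)) \<le> K"
    by (intro tendsto_upperbound) auto
  moreover have "(\<Sum>x\<in>F. a x * y x powr (- 1)) = (\<Sum>x\<in>F. a x / y x)"
    by (intro sum.cong refl) (simp add: powr_minus divide_inverse abs_of_pos F(2))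
  ultimately show ?thesis by simp
qed

lemma ecoprime_pk_iff:
  assumes "q \<in> prime_powers" shows "ecoprime M (pk q) \<longleftrightarrow> ecoprime M (fst q)"
proof -
  obtain k where "snd q = Suc k" using assms by (cases "snd q") (auto simp: prime_powers_def)
  then show ?thesis by (auto simp: pk_def ecoprime_mult_iff ecoprime_power)
qed

text \<open>If the sum converged, so would the one over all prime powers, hence \<open>eP\<close> of
  the principal character and with it \<open>eL\<close> would stay bounded as s decreases to 1. But
  \<open>eL\<close> dominates the sum of N(x)^(-s) over x congruent to 1, which is
  unbounded.\<close>

lemma not_summable_on_primes:
  assumes M: "M > 0"
  shows "\<not> (\<lambda>p. ln (eN p) / eN p) summable_on {p. prime p \<and> ecoprime M p}"
proof
  assume sm: "(\<lambda>p. ln (eN p) / eN p) summable_on {p. prime p \<and> ecoprime M p}"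
  define Q where "Q = {q\<in>prime_powers. ecoprime M (fst q)}"
  define Q1 where "Q1 = (\<lambda>p. (p, 1::nat)) ` {p. prime p \<and> ecoprime M p}"
  define f where "f q = ln (eN (fst q)) / eN (pk q)" for q
  have "f summable_on Q1" unfolding Q1_def
    by (subst summable_on_reindex) (use sm in \<open>auto simp: inj_on_def o_def f_def pk_def\<close>)
  moreover have "f summable_on {q\<in>prime_powers. snd q \<ge> 2}"
    unfolding f_def by (rule summable_on_higher_prime_powers)
  ultimately have "f summable_on (Q1 \<union> {q\<in>prime_powers. snd q \<ge> 2})" by (rule summable_on_union)
  then have fQ: "f summable_on Q"
  proof (rule summable_on_subset_banach)
    show "Q \<subseteq> Q1 \<union> {q\<in>prime_powers. snd q \<ge> 2}"
    proof
      fix q assume "q \<in> Q"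
      then show "q \<in> Q1 \<union> {q\<in>prime_powers. snd q \<ge> 2}"
        by (cases "snd q = 1") (auto simp: Q_def Q1_def prime_powers_def image_iff)
    qed
  qed
  \<comment> \<open>The terms of \<open>eP\<close> carry no logarithm; as N(p) \<ge> 2, inserting
    the factor log N(p) / log 2 \<ge> 1 compares them with \<open>f\<close>.\<close>
  define B where "B = infsum f Q / ln 2"
  note b0 = norm_echar_le[OF M echar0_in]
  note c0 = echarsD[OF echar0_in]
  obtain c where c: "\<And>s. Re s > 1 \<Longrightarrow> eL (echar0 M) s = c * exp (eP (echar0 M) s)"
    using eL_eq_exp_eP[of "echar0 M"] b0 c0(1,3) by metis
  have fnn: "f q \<ge> 0" if "q \<in> prime_powers" for q
    unfolding f_def using ln_eN_prime_nonneg[OF that] by simp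
  have PB: "norm (eP (echar0 M) (of_real s)) \<le> B" if s: "s > 1" for s
  proof -
    define g where "g q = echar0 M (pk q) * epow (of_real s) (pk q) / of_nat (snd q)" for q
    have gb: "norm (g q) \<le> f q / ln 2" if q: "q \<in> Q" for q
    proof -
      have qp: "q \<in> prime_powers" using q by (simp add: Q_def)
      have k: "snd q \<ge> 1" using qp by (auto simp: prime_powers_def)
      have "norm (g q) \<le> norm (echar0 M (pk q) * epow (of_real s) (pk q))"
        unfolding g_def using k by (simp add: norm_divide divide_simps mult_le_cancel_left1)
      also have "\<dots> \<le> 1 * eN (pk q) powr (- 1)"
        unfolding norm_mult by (intro mult_mono b0 norm_epow_mono) (use s in auto)
      also have "\<dots> = 1 / eN (pk q)" by (simp add: powr_minus divide_inverse)
      also have "\<dots> \<le> (ln (eN (fst q)) / ln 2) / eN (pk q)"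
        using ln_eN_prime_ge[OF qp] by (intro divide_right_mono) auto
      finally show ?thesis by (simp add: f_def mult.commute)
    qed
    have fs: "(\<lambda>q. f q / ln 2) summable_on Q" using summable_on_cmult_left[OF fQ, of "1 / ln 2"] by simp
    have gs: "(\<lambda>q. norm (g q)) summable_on Q"
      by (rule summable_on_comparison_test[OF fs]) (use gb in auto)
    have "eP (echar0 M) (of_real s) = infsum g Q"
      unfolding eP_def g_def Q_def
      by (rule infsum_cong_neutral) (auto simp: ecoprime_pk_iff c0(4))
    also have "norm \<dots> \<le> infsum (\<lambda>q. norm (g q)) Q" by (rule norm_infsum_bound[OF gs])
    also have "\<dots> \<le> infsum (\<lambda>q. f q / ln 2) Q" by (rule infsum_mono[OF gs fs gb])
    also have "\<dots> = B" unfolding B_def divide_inverse by (rule infsum_cmult_left')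
    finally show ?thesis .
  qed
  define K where "K = norm c * exp B"
  have LK: "norm (eL (echar0 M) (of_real s)) \<le> K" if s: "s > 1" for s
  proof -
    have "norm (exp (eP (echar0 M) (of_real s))) \<le> exp (norm (eP (echar0 M) (of_real s)))" by (rule norm_exp)
    also have "\<dots> \<le> exp B" using PB[OF s] by simp
    finally show ?thesis using s by (simp add: c norm_mult K_def mult_left_mono)
  qed
  have "(\<lambda>x. 1 / eN x) summable_on {x. econg M x 1} - {0}"
  proof (rule nonneg_bdd_above_summable_on)
    show "bdd_above (sum (\<lambda>x. 1 / eN x) ` {F. F \<subseteq> {x. econg M x 1} - {0} \<and> finite F})"
    proof (rule bdd_aboveI2)
      fix F assume "F \<in> {F. F \<subseteq> {x. econg M x 1} - {0} \<and> finite F}"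
      then have F: "finite F" "\<And>x. x \<in> F \<Longrightarrow> econg M x 1" "\<And>x. x \<in> F \<Longrightarrow> eN x > 0" by auto
      show "(\<Sum>x\<in>F. 1 / eN x) \<le> K"
      proof (rule sum_powr_limit)
        fix s :: real assume s: "1 < s"
        define h where "h x = echar0 M x * epow (of_real s) x" for x
        have hn: "(\<lambda>x. norm (h x)) summable_on UNIV" unfolding h_def
          by (rule abs_summable_mult_epow[OF _ b0]) (use s in simp)
        have hreal: "h x = of_real (norm (h x))" for x
          by (auto simp: h_def echar0_def epow_def norm_powr_real_powr powr_of_real[symmetric] simp flip: of_real_minus)
        have "(\<Sum>x\<in>F. 1 * eN x powr (- s)) = (\<Sum>x\<in>F. norm (h x))"
        proof (rule sum.cong)
          fix x assume "x \<in> F"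
          then have "ecoprime M x" using F(2) ecoprime_cong[of M x 1] by simp
          then show "1 * eN x powr (- s) = norm (h x)" by (simp add: h_def echar0_def norm_epow)
        qed simp
        also have "\<dots> \<le> (\<Sum>\<^sub>\<infinity>x. norm (h x))" by (rule finite_sum_le_infsum[OF hn F(1)]) auto
        also have "\<dots> = Re (\<Sum>\<^sub>\<infinity>x. h x)"
          by (subst infsum_Re[OF abs_summable_summable[OF hn], symmetric]) (metis Re_complex_of_real hreal)
        also have "\<dots> \<le> norm (eL (echar0 M) (of_real s))" unfolding eL_def h_def by (rule complex_Re_le_cmod)
        also have "\<dots> \<le> K" by (rule LK[OF s])
        finally show "(\<Sum>x\<in>F. 1 * eN x powr (- s)) \<le> K" .
      qed (use F in auto)
    qed
  qed auto
  then have "(\<lambda>x. 1 / eN x) summable_on insert 0 ({x. econg M x 1} - {0})" by (subst summable_on_insert_iff)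
  then have "(\<lambda>x. 1 / eN x) summable_on {x. econg M x 1}" by (rule summable_on_subset_banach) auto
  then show False using not_summable_on_inverse_eN[OF M] by blast
qed

section \<open>Continuation of the L-functions\<close>

lemma sum_echar_ebox:
  assumes M: "M > 0" and \<eta>: "\<eta> \<in> echars M" "\<eta> \<noteq> echar0 M"
  shows "sum \<eta> (ebox M) = 0"
proof -
  have "\<exists>x. ecoprime M x \<and> \<eta> x \<noteq> 1"
  proof (rule ccontr)
    assume "\<nexists>x. ecoprime M x \<and> \<eta> x \<noteq> 1"
    then have "\<eta> = echar0 M" using echarsD(4)[OF \<eta>(1)] by (auto simp: echar0_def fun_eq_iff)
    then show False using \<eta>(2) by simp
  qed
  then obtain x where x: "ecoprime M x" "\<eta> x \<noteq> 1" by blast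
  obtain y where y: "econg M (x * y) 1" using x(1) by (auto simp: ecoprime_def)
  have er: "ered M b = b" if "b \<in> ebox M" for b using that by (auto simp: ebox_def ered_def)
  have inv: "ered M (u * ered M (v * b)) = b" if "b \<in> ebox M" "econg M (u * v) 1" for u v b
  proof -
    have "econg M (u * ered M (v * b)) (u * (v * b))" by (intro econg_mult econg_refl econg_ered)
    moreover have "econg M (u * v * b) (1 * b)" by (intro econg_mult econg_refl that)
    ultimately have "econg M (u * ered M (v * b)) b" using econg_trans by (simp add: mult.assoc)
    then have "ered M (u * ered M (v * b)) = ered M b" by (simp add: ered_eq_iff)
    then show ?thesis using er[OF that(1)] by simp
  qed
  have yx: "econg M (y * x) 1" using y by (simp add: mult.commute)
  \<comment> \<open>Multiplication by x permutes the residues, and the sum over them picks up the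
    factor \<eta>(x), which is not 1.\<close>
  have "sum \<eta> (ebox M) = (\<Sum>b\<in>ebox M. \<eta> x * \<eta> b)"
  proof (rule sum.reindex_bij_witness[where i = "\<lambda>b. ered M (x * b)" and j = "\<lambda>b. ered M (y * b)"])
    fix b assume b: "b \<in> ebox M"
    show "ered M (x * ered M (y * b)) = b" "ered M (y * ered M (x * b)) = b" using inv b y yx by auto
    show "ered M (y * b) \<in> ebox M" "ered M (x * b) \<in> ebox M" using ered_in_ebox[OF M] by auto
    have "\<eta> x * \<eta> (ered M (y * b)) = \<eta> x * \<eta> (y * b)" using echarsD(2)[OF \<eta>(1) econg_ered] by simp
    also have "\<dots> = \<eta> (x * y) * \<eta> b" by (simp add: echarsD[OF \<eta>(1)])
    also have "\<eta> (x * y) = 1" using echarsD(2)[OF \<eta>(1) y] echarsD(5)[OF \<eta>(1)] by simp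
    finally show "\<eta> x * \<eta> (ered M (y * b)) = \<eta> b" by simp
  qed
  also have "\<dots> = \<eta> x * sum \<eta> (ebox M)" by (simp add: sum_distrib_left)
  finally have "(1 - \<eta> x) * sum \<eta> (ebox M) = 0" by (simp add: algebra_simps)
  then show ?thesis using x(2) by simp
qed

lemma echar_minus: "\<eta> \<in> echars M \<Longrightarrow> \<eta> (- x) = \<eta> x"
  using echarsD(1)[of \<eta> M "-1" x] echarsD(3)[of \<eta> M "-1"] by simp

lemma eL_continuation:
  assumes M: "M > 0" and \<eta>: "\<eta> \<in> echars M" "\<eta> \<noteq> echar0 M"
  shows "\<exists>F. F holomorphic_on {s. Re s > 0} \<and> (\<forall>s. Re s > 1 \<longrightarrow> F s = eL \<eta> s)"
  unfolding eL_def
  by (rule periodic_dirichlet_continuation[OF M])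
     (use echarsD(2)[OF \<eta>(1)] echar_minus[OF \<eta>(1)] sum_echar_ebox[OF assms] in auto)

lemma card_ebox: "M > 0 \<Longrightarrow> card (ebox M) = nat M ^ 2"
  unfolding ebox_def by (subst card_image) (auto simp: inj_on_def card_cartesian_product power2_eq_square)

text \<open>The principal character does not have mean 0, so it is split into a part that does and a
  multiple of \<open>Z\<close>, the sum of N(x)^(-s) over all x. As with the alternating zeta
  function, \<open>Z\<close> times 1 - 4^(1 - s) is a periodic series of mean 0. On the disc that
  factor vanishes only at 1, to first order, and s - 1 absorbs this zero.\<close>

lemma eL_echar0_continuation:
  assumes M: "M > 0"
  shows "\<exists>E. E holomorphic_on ball 2 2 \<and> (\<forall>s\<in>ball 2 2. Re s > 1 \<longrightarrow> E s = (s - 1) * eL (echar0 M) s)"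
proof -
  define H where "H = {s::complex. Re s > 0}"
  have H: "open H" unfolding H_def by (rule open_halfspace_Re_gt)
  have ballH: "ball 2 2 \<subseteq> H"
  proof
    fix s :: complex assume "s \<in> ball 2 2"
    then have "norm (s - 2) < 2" by (simp add: dist_norm norm_minus_commute)
    then show "s \<in> H" using abs_Re_le_cmod[of "s - 2"] by (simp add: H_def)
  qed
  define \<mu> where "\<mu> = sum (echar0 M) (ebox M) / of_nat (card (ebox M))"
  have cb: "card (ebox M) \<noteq> 0" using M by (simp add: card_ebox)
  have "\<exists>F. F holomorphic_on {s. Re s > 0} \<and> (\<forall>s. Re s > 1 \<longrightarrow> F s = (\<Sum>\<^sub>\<infinity>x. (echar0 M x - \<mu>) * epow s x))"
  proof (rule periodic_dirichlet_continuation[OF M])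
    show "(\<Sum>x\<in>ebox M. echar0 M x - \<mu>) = 0" using cb by (simp add: sum_subtractf \<mu>_def)
  qed (use echarsD(2)[OF echar0_in] echar_minus[OF echar0_in] in auto)
  then obtain F where F: "F holomorphic_on H" "\<And>s. Re s > 1 \<Longrightarrow> F s = (\<Sum>\<^sub>\<infinity>x. (echar0 M x - \<mu>) * epow s x)"
    unfolding H_def by blast
  \<comment> \<open>Multiples of 2 are one residue class in four, so the weights -3, 1, 1, 1 have
    mean 0; and N(2) = 4 turns the correction into a multiple of \<open>Z\<close>.\<close>
  define g where "g x = (if econg 2 x 0 then -3 else 1 :: complex)" for x
  have "\<exists>F. F holomorphic_on {s. Re s > 0} \<and> (\<forall>s. Re s > 1 \<longrightarrow> F s = (\<Sum>\<^sub>\<infinity>x. g x * epow s x))"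
  proof (rule periodic_dirichlet_continuation[of 2])
    show "g x = g y" if "econg 2 x y" for x y using that by (auto simp: g_def intro: econg_trans econg_sym)
    show "g (- x) = g x" for x by (simp add: g_def econg_iff cong_0_iff)
    have "ebox 2 = {Eis 0 0, Eis 0 1, Eis 1 0, Eis 1 1}"
    proof -
      have "{0..<2::int} = {0, 1}" by auto
      then show ?thesis by (auto simp: ebox_def)
    qed
    then show "sum g (ebox 2) = 0" by (simp add: g_def econg_iff cong_0_iff)
  qed simp
  then obtain G where G: "G holomorphic_on H" "\<And>s. Re s > 1 \<Longrightarrow> G s = (\<Sum>\<^sub>\<infinity>x. g x * epow s x)"
    unfolding H_def by blast
  define Z where "Z s = (\<Sum>\<^sub>\<infinity>x. epow s x)" for s
  define q where "q s = 1 - exp ((1 - s) * of_real (ln 4))" for s :: complex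
  have FZ: "eL (echar0 M) s = F s + \<mu> * Z s" if s: "Re s > 1" for s
  proof -
    have e: "(\<lambda>x. epow s x) summable_on UNIV" using epow_summable[OF s] abs_summable_summable by blast
    have e0: "(\<lambda>x. echar0 M x * epow s x) summable_on UNIV"
      by (rule abs_summable_summable, rule abs_summable_mult_epow[OF s norm_echar_le[OF M echar0_in]])
    have "F s = (\<Sum>\<^sub>\<infinity>x. echar0 M x * epow s x + (- \<mu>) * epow s x)"
      unfolding F(2)[OF s] by (simp add: algebra_simps)
    also have "\<dots> = eL (echar0 M) s + (- \<mu>) * Z s" unfolding eL_def Z_def
      by (subst infsum_add[OF e0 summable_on_cmult_right[OF e]]) (simp only: infsum_cmult_right')
    finally show ?thesis by simp
  qed
  have GZ: "G s = q s * Z s" if s: "Re s > 1" for s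
  proof -
    have e: "(\<lambda>x. epow s x) summable_on A" for A using epow_summable[OF s] abs_summable_summable by blast
    have "(2::eis) \<noteq> 0" using eis_of_int_sel(1)[of 2] by auto
    then have i2: "inj_on (\<lambda>x::eis. 2 * x) UNIV" by (auto simp: inj_on_def)
    have rng: "range (\<lambda>x::eis. 2 * x) = {x. econg 2 x 0}"
      by (auto simp: econg_def dvd_def)
    have "(\<Sum>\<^sub>\<infinity>x\<in>{x. econg 2 x 0}. epow s x) = (\<Sum>\<^sub>\<infinity>x. epow s (2 * x))"
      unfolding rng[symmetric] by (subst infsum_reindex[OF i2]) (simp add: o_def)
    also have "\<dots> = epow s 2 * Z s" unfolding epow_mult Z_def by (rule infsum_cmult_right')
    finally have 1: "(\<Sum>\<^sub>\<infinity>x\<in>{x. econg 2 x 0}. epow s x) = epow s 2 * Z s" .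
    have "G s = (\<Sum>\<^sub>\<infinity>x. epow s x + (-4) * (if x \<in> {x. econg 2 x 0} then epow s x else 0))"
      unfolding G(2)[OF s] by (rule infsum_cong) (simp add: g_def)
    also have "\<dots> = Z s + (-4) * (\<Sum>\<^sub>\<infinity>x. if x \<in> {x. econg 2 x 0} then epow s x else 0)"
    proof -
      have "(\<lambda>x. if x \<in> {x. econg 2 x 0} then epow s x else 0) summable_on UNIV"
        using e[of "{x. econg 2 x 0}"] by (rule summable_on_cong_neutral[THEN iffD1, rotated -1]) auto
      then show ?thesis unfolding Z_def infsum_cmult_right'[symmetric]
        by (intro infsum_add e summable_on_cmult_right)
    qed
    also have "(\<Sum>\<^sub>\<infinity>x. if x \<in> {x. econg 2 x 0} then epow s x else 0) = (\<Sum>\<^sub>\<infinity>x\<in>{x. econg 2 x 0}. epow s x)"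
      by (rule infsum_cong_neutral) auto
    also have "Z s + (-4) * \<dots> = (1 - 4 * epow s 2) * Z s" unfolding 1 by (simp add: algebra_simps)
    also have "4 * epow s 2 = exp ((1 - s) * of_real (ln 4))"
    proof -
      have e2: "eN 2 = 4" using enorm_of_int[of 2] by (simp add: eN_def)
      have l4: "complex_of_real (ln 4) = Ln 4" using Ln_of_real[of 4] by simp
      have "exp (complex_of_real (ln 4)) = 4" unfolding l4 by simp
      then show ?thesis by (simp add: epow_def e2 powr_def l4 exp_diff exp_minus algebra_simps field_simps)
    qed
    finally show ?thesis by (simp add: q_def)
  qed
  have qd: "(q has_field_derivative of_real (ln 4)) (at 1)"
    unfolding q_def by (auto intro!: derivative_eq_intros)
  \<comment> \<open>\<open>h\<close> is q(s) / (s - 1) with the removable singularity at 1 filled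
    in.\<close>
  define h where "h s = (if s = 1 then deriv q 1 else (q s - q 1) / (s - 1))" for s
  have "q holomorphic_on UNIV" unfolding q_def by (intro holomorphic_intros)
  then have hh: "h holomorphic_on UNIV" unfolding h_def by (rule pole_lemma_open) auto
  have q1: "q 1 = 0" by (simp add: q_def)
  have h0: "h s \<noteq> 0" if s: "s \<in> ball 2 2" for s
  proof (cases "s = 1")
    case True
    then show ?thesis using DERIV_imp_deriv[OF qd] by (simp add: h_def)
  next
    case False
    have "q s \<noteq> 0"
    proof
      assume "q s = 0"
      then have "exp ((1 - s) * of_real (ln 4)) = 1" by (simp add: q_def)
      \<comment> \<open>The zeros of \<open>q\<close> have real part 1, and Im s times ln 4 is a
        multiple of 2 \<pi>. In the disc |Im s| < 2, and the crude bounds ln 4 \<le> 3 and \<pi> > 3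
        leave only s = 1.\<close>
      then obtain n :: int where "Re ((1 - s) * of_real (ln 4)) = 0" "Im ((1 - s) * of_real (ln 4)) = of_int (2 * n) * pi"
        unfolding exp_eq_1 by auto
      then have r: "Re s = 1" and im: "- Im s * ln 4 = of_int (2 * n) * pi" by auto
      have "\<bar>Im (s - 2)\<bar> < 2" using s abs_Im_le_cmod[of "s - 2"] by (simp add: dist_norm norm_minus_commute)
      moreover have l4: "ln (4::real) \<le> 3" using ln_le_minus_one[of 4] by simp
      moreover have l40: "ln (4::real) > 0" by simp
      ultimately have "\<bar>- Im s * ln 4\<bar> < 2 * 3" unfolding abs_mult by (intro mult_less_le_imp_less) auto
      then have "\<bar>real_of_int (2 * n)\<bar> * pi < 6" unfolding im abs_mult by simp
      moreover have "\<bar>real_of_int (2 * n)\<bar> * pi \<ge> 2 * 3" if "n \<noteq> 0"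
        using that pi_gt3 by (intro mult_mono) auto
      ultimately have "n = 0" by fastforce
      then have "Im s = 0" using im l40 by simp
      then show False using r False by (simp add: complex_eq_iff)
    qed
    then show ?thesis using False by (simp add: h_def q1)
  qed
  define E where "E s = (s - 1) * F s + \<mu> * (G s / h s)" for s
  have "E holomorphic_on ball 2 2" unfolding E_def
    by (intro holomorphic_intros holomorphic_on_subset[OF F(1) ballH] holomorphic_on_subset[OF G(1) ballH]
         holomorphic_on_subset[OF hh]) (use h0 in auto)
  moreover have "E s = (s - 1) * eL (echar0 M) s" if s: "Re s > 1" "s \<in> ball 2 2" for s
  proof -
    have s1: "s \<noteq> 1" using s by auto
    have "q s = (s - 1) * h s" using s1 by (simp add: h_def q1)
    then have "G s / h s = (s - 1) * Z s" using GZ[OF s(1)] h0[OF s(2)] by simp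
    then have "E s = (s - 1) * F s + \<mu> * ((s - 1) * Z s)" by (simp only: E_def)
    then show ?thesis unfolding FZ[OF s(1)] by (simp add: algebra_simps)
  qed
  ultimately show ?thesis by blast
qed

section \<open>Nonvanishing at 1\<close>

lemma has_sum_sum_finite:
  fixes f :: "'a \<Rightarrow> 'b \<Rightarrow> complex"
  assumes "finite S" "\<And>i. i \<in> S \<Longrightarrow> (f i has_sum g i) A"
  shows "((\<lambda>x. \<Sum>i\<in>S. f i x) has_sum (\<Sum>i\<in>S. g i)) A"
  using assms by (induction S rule: finite_induct) (auto intro!: has_sum_add)

lemma echar_sum:
  assumes M: "M > 0"
  shows "(\<Sum>\<eta>\<in>echars M. \<eta> x) = (if \<exists>u. u dvd 1 \<and> econg M x u then of_nat (card (echars M)) else 0)"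
proof (cases "ecoprime M x")
  case False
  then have 1: "\<not> (\<exists>u. u dvd 1 \<and> econg M x u)" using ecoprime_cong ecoprime_unit by blast
  have "\<eta> x = 0" if "\<eta> \<in> echars M" for \<eta> using echarsD(4)[OF that] False by simp
  then show ?thesis unfolding if_not_P[OF 1] by (intro sum.neutral) blast
qed (rule echar_orthogonality[OF M])

lemma card_echars_pos: "M > 0 \<Longrightarrow> card (echars M) > 0"
  using finite_echars[of M] echar0_in[of M] by (metis card_gt_0_iff empty_iff)

text \<open>Orthogonality singles out the prime powers in the class inverse to \<open>g\<close>, up
  to units. With g = 1 it shows that the sum over all characters has nonnegative coefficients; with
  other \<open>g\<close> it isolates a residue class.\<close>

lemma sum_ePsi:
  assumes M: "M > 0" and s: "Re s > 1"
  shows "(\<Sum>\<eta>\<in>echars M. \<eta> g * ePsi \<eta> s) = of_nat (card (echars M)) *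
    (\<Sum>\<^sub>\<infinity>q\<in>{q\<in>prime_powers. \<exists>u. u dvd 1 \<and> econg M (g * pk q) u}. of_real (ln (eN (fst q))) * epow s (pk q))"
proof -
  define t where "t q = of_real (ln (eN (fst q))) * epow s (pk q)" for q
  define A where "A = {q\<in>prime_powers. \<exists>u. u dvd 1 \<and> econg M (g * pk q) u}"
  have "((\<lambda>q. \<eta> g * (of_real (ln (eN (fst q))) * \<eta> (pk q) * epow s (pk q))) has_sum \<eta> g * ePsi \<eta> s) prime_powers"
    if "\<eta> \<in> echars M" for \<eta>
    unfolding ePsi_def using summable_ePsi_terms[OF s norm_echar_le[OF M that]]
    by (intro has_sum_cmult_right has_sum_infsum) (rule abs_summable_summable)
  then have "((\<lambda>q. \<Sum>\<eta>\<in>echars M. \<eta> g * (of_real (ln (eN (fst q))) * \<eta> (pk q) * epow s (pk q))) has_sum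
      (\<Sum>\<eta>\<in>echars M. \<eta> g * ePsi \<eta> s)) prime_powers"
    by (intro has_sum_sum_finite finite_echars[OF M])
  also have "(\<lambda>q. \<Sum>\<eta>\<in>echars M. \<eta> g * (of_real (ln (eN (fst q))) * \<eta> (pk q) * epow s (pk q))) =
      (\<lambda>q. (\<Sum>\<eta>\<in>echars M. \<eta> (g * pk q)) * t q)"
    unfolding sum_distrib_right by (intro ext sum.cong refl) (simp add: t_def echarsD(1))
  finally have "(\<Sum>\<eta>\<in>echars M. \<eta> g * ePsi \<eta> s) = (\<Sum>\<^sub>\<infinity>q\<in>prime_powers. (\<Sum>\<eta>\<in>echars M. \<eta> (g * pk q)) * t q)"
    by (simp add: infsumI)
  also have "\<dots> = (\<Sum>\<^sub>\<infinity>q\<in>A. of_nat (card (echars M)) * t q)"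
    unfolding echar_sum[OF M] by (rule infsum_cong_neutral) (auto simp: A_def)
  also have "\<dots> = of_nat (card (echars M)) * (\<Sum>\<^sub>\<infinity>q\<in>A. t q)" by (rule infsum_cmult_right')
  finally show ?thesis by (simp add: A_def t_def)
qed

lemma prod_has_field_derivative_log:
  fixes f :: "'a \<Rightarrow> complex \<Rightarrow> complex"
  assumes "finite S" "\<And>i. i \<in> S \<Longrightarrow> (f i has_field_derivative (- p i * f i z)) (at z)"
  shows "((\<lambda>z. \<Prod>i\<in>S. f i z) has_field_derivative (- (\<Sum>i\<in>S. p i) * (\<Prod>i\<in>S. f i z))) (at z)"
  using assms
proof (induction S rule: finite_induct)
  case (insert i S)
  then have "((\<lambda>z. f i z * (\<Prod>i\<in>S. f i z)) has_field_derivative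
      (- p i * f i z) * (\<Prod>i\<in>S. f i z) + (- (\<Sum>i\<in>S. p i) * (\<Prod>i\<in>S. f i z)) * f i z) (at z)"
    by (intro DERIV_mult) auto
  then show ?case using insert.hyps by (simp add: algebra_simps)
qed simp

lemma ball_2_1_Re: "z \<in> ball 2 1 \<Longrightarrow> Re z > 1"
proof -
  assume "z \<in> ball 2 1"
  then have "norm (z - 2) < 1" by (simp add: dist_norm norm_minus_commute)
  then show ?thesis using abs_Re_le_cmod[of "z - 2"] by simp
qed

lemma ball_2_2_Re: "z \<in> ball 2 2 \<Longrightarrow> Re z > 0"
proof -
  assume "z \<in> ball 2 2"
  then have "norm (z - 2) < 2" by (simp add: dist_norm norm_minus_commute)
  then show ?thesis using abs_Re_le_cmod[of "z - 2"] by simp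
qed

lemma eL_nonzero:
  assumes "M > 0" "\<eta> \<in> echars M" "Re s > 1" shows "eL \<eta> s \<noteq> 0"
proof -
  obtain c where "c \<noteq> 0" "\<forall>s. Re s > 1 \<longrightarrow> eL \<eta> s = c * exp (eP \<eta> s)"
    using eL_eq_exp_eP[of \<eta>] norm_echar_le[OF assms(1,2)] echarsD(1,3)[OF assms(2)] by blast
  then show ?thesis using assms(3) by simp
qed

text \<open>A zero of \<open>F1\<close> at 1 can be divided out, giving \<open>K\<close>, and makes
  up for the factor s - 1 contained in \<open>E\<close>. So \<open>W\<close> continues the product
  of all L-functions holomorphically to the disc, and Landau's argument makes the series of its
  logarithmic derivative converge at every exponent between 0 and 2, which is too much.\<close>

lemma nonvanishing_at_1:
  assumes M: "M > 0" and \<eta>1: "\<eta>1 \<in> echars M" "\<eta>1 \<noteq> echar0 M"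
    and F1: "F1 holomorphic_on {s. Re s > 0}" "\<And>s. Re s > 1 \<Longrightarrow> F1 s = eL \<eta>1 s"
  shows "F1 1 \<noteq> 0"
proof
  assume F0: "F1 1 = 0"
  define H where "H = {s::complex. Re s > 0}"
  have H: "open H" unfolding H_def by (rule open_halfspace_Re_gt)
  have ballH: "ball 2 2 \<subseteq> H" using ball_2_2_Re by (auto simp: H_def)
  define K where "K s = (if s = 1 then deriv F1 1 else (F1 s - F1 1) / (s - 1))" for s
  have K: "K holomorphic_on H" unfolding K_def using F1(1) H by (intro pole_lemma_open) (auto simp: H_def)
  have KF: "K s * (s - 1) = F1 s" if "s \<noteq> 1" for s using that F0 by (simp add: K_def)
  obtain E where E: "E holomorphic_on ball 2 2" "\<And>s. s \<in> ball 2 2 \<Longrightarrow> Re s > 1 \<Longrightarrow> E s = (s - 1) * eL (echar0 M) s"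
    using eL_echar0_continuation[OF M] by blast
  define X where "X = echars M"
  define Y where "Y = X - {echar0 M, \<eta>1}"
  have finX: "finite X" using finite_echars[OF M] by (simp add: X_def)
  have "\<forall>\<eta>\<in>Y. \<exists>F. F holomorphic_on H \<and> (\<forall>s. Re s > 1 \<longrightarrow> F s = eL \<eta> s)"
    using eL_continuation[OF M] by (auto simp: Y_def X_def H_def)
  then obtain F where F: "\<And>\<eta>. \<eta> \<in> Y \<Longrightarrow> F \<eta> holomorphic_on H" "\<And>\<eta> s. \<eta> \<in> Y \<Longrightarrow> Re s > 1 \<Longrightarrow> F \<eta> s = eL \<eta> s"
    by metis
  define W where "W s = E s * K s * (\<Prod>\<eta>\<in>Y. F \<eta> s)" for s
  have Wh: "W holomorphic_on ball 2 2" unfolding W_def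
    by (intro holomorphic_intros E(1) holomorphic_on_subset[OF K ballH] holomorphic_on_subset[OF F(1) ballH])
  have WX: "W s = (\<Prod>\<eta>\<in>X. eL \<eta> s)" if s: "s \<in> ball 2 1" for s
  proof -
    have s1: "Re s > 1" using ball_2_1_Re[OF s] .
    have s2: "s \<in> ball 2 2" using s by auto
    have Xi: "X = insert (echar0 M) (insert \<eta>1 Y)" using \<eta>1 by (auto simp: X_def Y_def)
    have Yi: "finite Y" "\<eta>1 \<notin> Y" "echar0 M \<notin> insert \<eta>1 Y" using finX \<eta>1 by (auto simp: Y_def)
    have "(\<Prod>\<eta>\<in>X. eL \<eta> s) = eL (echar0 M) s * (eL \<eta>1 s * (\<Prod>\<eta>\<in>Y. eL \<eta> s))"
      unfolding Xi using Yi by simp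
    also have "(\<Prod>\<eta>\<in>Y. eL \<eta> s) = (\<Prod>\<eta>\<in>Y. F \<eta> s)" using F(2)[OF _ s1] by simp
    also have "eL \<eta>1 s = K s * (s - 1)"
    proof -
      have "s \<noteq> 1" using s1 by auto
      then show ?thesis using KF[of s] F1(2)[OF s1] by simp
    qed
    finally show ?thesis unfolding W_def E(2)[OF s2 s1] by simp
  qed
  define A where "A = {q\<in>prime_powers. \<exists>u. u dvd 1 \<and> econg M (pk q) u}"
  define c where "c q = real (card X) * ln (eN (fst q))" for q :: "eis \<times> nat"
  define lam where "lam q = ln (eN (pk q))" for q
  have AP: "q \<in> prime_powers" if "q \<in> A" for q using that by (simp add: A_def)
  have pkN: "eN (pk q) > 0" if "q \<in> prime_powers" for q using pk_nonzero[OF that] by simp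
  have epr: "exp (- (lam q * \<sigma>)) = eN (pk q) powr (- \<sigma>)" if "q \<in> A" for q \<sigma>
    using pk_nonzero[OF AP[OF that]] by (simp add: lam_def powr_def mult.commute)
  have epc: "exp (- (of_real (lam q) * z)) = epow z (pk q)" if "q \<in> A" for q z
    using pk_nonzero[OF AP[OF that]] by (simp add: lam_def epow_def powr_def mult.commute Ln_of_real)
  have conv: "(\<lambda>q. c q * exp (- (lam q * \<sigma>))) summable_on A" if \<sigma>: "0 < \<sigma>" "\<sigma> < 2" for \<sigma>
  proof (rule landau_ode[where W = W])
    show "c q \<ge> 0" if "q \<in> A" for q using ln_eN_prime_nonneg[OF AP[OF that]] by (simp add: c_def)
    show "lam q \<ge> 0" if "q \<in> A" for q using eN_ge_1[OF pk_nonzero[OF AP[OF that]]] by (simp add: lam_def)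
    show "(\<lambda>q. c q * exp (- (lam q * \<sigma>))) summable_on A" if "\<sigma> > 1" for \<sigma>
    proof -
      have "(\<lambda>q. real (card X) * (ln (eN (fst q)) * eN (pk q) powr (- \<sigma>))) summable_on A"
        by (intro summable_on_cmult_right summable_on_subset_banach[OF summable_on_prime_powers[OF that]]) (use AP in auto)
      then show ?thesis by (rule summable_on_cong[THEN iffD1, rotated]) (simp add: c_def epr)
    qed
    show "(W has_field_derivative (- (\<Sum>\<^sub>\<infinity>q\<in>A. of_real (c q) * exp (- (of_real (lam q) * z))) * W z)) (at z)"
      if z: "z \<in> ball 2 1" for z
    proof -
      have z1: "Re z > 1" using ball_2_1_Re[OF z] .
      have "((\<lambda>z. \<Prod>\<eta>\<in>X. eL \<eta> z) has_field_derivative (- (\<Sum>\<eta>\<in>X. ePsi \<eta> z) * (\<Prod>\<eta>\<in>X. eL \<eta> z))) (at z)"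
        by (intro prod_has_field_derivative_log finX eL_has_field_derivative[OF z1])
           (auto simp: X_def norm_echar_le[OF M] echarsD(1))
      moreover have "(\<Sum>\<eta>\<in>X. ePsi \<eta> z) = (\<Sum>\<^sub>\<infinity>q\<in>A. of_real (c q) * exp (- (of_real (lam q) * z)))"
      proof -
        have "(\<Sum>\<eta>\<in>X. ePsi \<eta> z) = (\<Sum>\<eta>\<in>X. \<eta> 1 * ePsi \<eta> z)"
          by (intro sum.cong refl) (simp add: X_def echarsD(5))
        also have "\<dots> = (\<Sum>\<^sub>\<infinity>q\<in>A. of_nat (card X) * (of_real (ln (eN (fst q))) * epow z (pk q)))"
          using sum_ePsi[OF M z1, of 1] by (simp add: X_def A_def infsum_cmult_right')
        also have "\<dots> = (\<Sum>\<^sub>\<infinity>q\<in>A. of_real (c q) * exp (- (of_real (lam q) * z)))"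
          by (rule infsum_cong) (simp add: epc c_def)
        finally show ?thesis .
      qed
      ultimately have "((\<lambda>z. \<Prod>\<eta>\<in>X. eL \<eta> z) has_field_derivative (- (\<Sum>\<^sub>\<infinity>q\<in>A. of_real (c q) * exp (- (of_real (lam q) * z))) * W z)) (at z)"
        using WX[OF z] by simp
      then show ?thesis
        by (rule has_field_derivative_transform_within_open[where S = "ball 2 1"]) (use z WX in auto)
    qed
    show "W 2 \<noteq> 0" using eL_nonzero[OF M] finX by (simp add: WX X_def)
  qed (use Wh \<sigma> in auto)
  \<comment> \<open>The h-th powers of coprime primes are all congruent to 1, so at exponent 1/h the
    terms belonging to p^h are multiples of log N(p) / N(p): the divergent sum over all primes
    coprime to \<open>M\<close>.\<close>
  obtain h where h: "h > 0" "\<And>x. ecoprime M x \<Longrightarrow> econg M (x ^ h) 1" using ecoprime_exponent[OF M] by auto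
  have "(\<lambda>q. c q * exp (- (lam q * (1 / real h)))) summable_on A" using h(1) by (intro conv) (auto simp: field_simps)
  then have "(\<lambda>q. c q * exp (- (lam q * (1 / real h)))) summable_on (\<lambda>p. (p, h)) ` {p. prime p \<and> ecoprime M p}"
  proof (rule summable_on_subset_banach)
    show "(\<lambda>p. (p, h)) ` {p. prime p \<and> ecoprime M p} \<subseteq> A"
      using h by (auto simp: A_def prime_powers_def pk_def intro!: exI[of _ 1])
  qed
  then have "(\<lambda>p. c (p, h) * exp (- (lam (p, h) * (1 / real h)))) summable_on {p. prime p \<and> ecoprime M p}"
    by (subst (asm) summable_on_reindex) (auto simp: inj_on_def o_def)
  then have "(\<lambda>p. (1 / real (card X)) * (c (p, h) * exp (- (lam (p, h) * (1 / real h))))) summable_on {p. prime p \<and> ecoprime M p}"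
    by (rule summable_on_cmult_right)
  then have "(\<lambda>p. ln (eN p) / eN p) summable_on {p. prime p \<and> ecoprime M p}"
  proof (rule summable_on_cong[THEN iffD1, rotated])
    fix p assume p: "p \<in> {p. prime p \<and> ecoprime M p}"
    have pN: "eN p > 0" using p by auto
    have "lam (p, h) * (1 / real h) = ln (eN p)" using h(1) pN by (simp add: lam_def pk_def eN_power ln_realpow)
    then show "(1 / real (card X)) * (c (p, h) * exp (- (lam (p, h) * (1 / real h)))) = ln (eN p) / eN p"
      using card_echars_pos[OF M] pN by (simp add: c_def X_def exp_minus divide_inverse)
  qed
  then show False using not_summable_on_primes[OF M] by blast
qed

section \<open>Primes of degree one in residue classes\<close>

lemma summable_on_inert_primes:
  "(\<lambda>p. ln (eN p) / eN p) summable_on {p. prime p \<and> \<not> prime (enorm p)}"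
proof -
  define I where "I = {p::eis. prime p \<and> \<not> prime (enorm p)}"
  \<comment> \<open>A prime divides its norm and hence some rational prime l; its norm is then l or
    l^2. In the second case it is an associate of l, so these primes are indexed injectively by
    integers and contribute 2 log l / l^2 each.\<close>
  have ex: "\<exists>n::nat. n > 0 \<and> eN p = real n ^ 2 \<and> p = normalize (of_nat n)" if p: "p \<in> I" for p
  proof -
    have of_nat_mset: "of_nat (prod_mset A) = prod_mset (image_mset (of_nat :: nat \<Rightarrow> eis) A)" for A
      by (induction A) auto
    have pp: "prime p" and np: "\<not> prime (enorm p)" using p by (auto simp: I_def)
    have n2: "eN p \<ge> 2" using eN_prime_ge_2[OF pp] .
    then have e2: "enorm p \<ge> 2" by (simp add: eN_def)
    have "p dvd of_int (enorm p)" using mult_eis_cnj[of p] by (metis dvd_triv_left)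
    also have "of_int (enorm p) = (of_nat (nat (enorm p)) :: eis)" using e2 by simp
    also have "nat (enorm p) = prod_mset (prime_factorization (nat (enorm p)))"
      using e2 by (subst prod_mset_prime_factorization_nat) auto
    finally have "p dvd prod_mset (image_mset of_nat (prime_factorization (nat (enorm p))))"
      by (simp add: of_nat_mset)
    then obtain l :: nat where l: "l \<in># prime_factorization (nat (enorm p))" "p dvd of_nat l"
      using pp by (auto simp: prime_dvd_prod_mset_iff)
    have lp: "prime l" using l(1) by auto
    obtain y where y: "of_nat l = p * y" using l(2) by auto
    have "int l ^ 2 = enorm (of_nat l)" using enorm_of_int[of "int l"] by (simp only: of_int_of_nat_eq)
    also have "\<dots> = enorm p * enorm y" using y by (simp add: enorm_mult)
    finally have ly: "enorm p * enorm y = int l ^ 2" by simp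
    then have "enorm p dvd int l ^ 2" by (metis dvd_triv_left)
    then obtain i where i: "i \<le> 2" "enorm p = int l ^ i"
      using divides_primepow[of "int l" "enorm p" 2] lp e2 by auto
    have "i \<noteq> 0" using i(2) e2 by (cases i) auto
    moreover have "i \<noteq> 1" using i np lp by auto
    ultimately have i2: "i = 2" using i(1) by simp
    then have "enorm y = 1" using ly i lp by (auto simp: prime_gt_0_nat)
    then have "y dvd 1" by (rule enorm_eq_1_imp_unit)
    then have "normalize (of_nat l :: eis) = normalize p" unfolding y
      by (metis associatedI dvd_mult_unit_iff dvd_refl dvd_triv_left mult_unit_dvd_iff)
    also have "\<dots> = p" using pp by (simp add: normalize_prime)
    finally have "p = normalize (of_nat l)" by simp
    moreover have "eN p = real l ^ 2" using i i2 by (simp add: eN_def)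
    ultimately show ?thesis using lp prime_gt_0_nat by auto
  qed
  then obtain f :: "eis \<Rightarrow> nat" where f: "\<And>p. p \<in> I \<Longrightarrow> f p > 0 \<and> eN p = real (f p) ^ 2 \<and> p = normalize (of_nat (f p))"
    by metis
  have inj: "inj_on f I" using f by (metis inj_onI)
  define t where "t n = 2 * ln (real n) / real n ^ 2" for n
  have "summable t"
  proof (rule summable_comparison_test_ev)
    show "summable (\<lambda>n. 4 * real n powr (- (3/2)))"
      by (intro summable_mult) (simp add: summable_real_powr_iff)
    have "norm (t n) \<le> 4 * real n powr (- (3/2))" if n: "n \<ge> 1" for n
    proof -
      have "ln (real n) \<le> real n powr (1/2) / (1/2)" using n by (intro ln_powr_bound) auto
      then have "t n \<le> 2 * (real n powr (1/2) / (1/2)) / real n ^ 2" unfolding t_def by (intro divide_right_mono) auto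
      also have "\<dots> = 4 * (real n powr (1/2) / real n powr 2)" using n by simp
      also have "real n powr (1/2) / real n powr 2 = real n powr (- (3/2))"
        using powr_diff[of "real n" "1/2" 2] by simp
      finally show ?thesis using n by (simp add: t_def)
    qed
    then show "\<forall>\<^sub>F n in sequentially. norm (t n) \<le> 4 * real n powr (- (3/2))"
      by (intro eventually_mono[OF eventually_ge_at_top[of 1]]) auto
  qed
  moreover have "t n \<ge> 0" for n by (cases "n = 0") (auto simp: t_def)
  ultimately have "t summable_on UNIV" by (intro summable_nonneg_imp_summable_on) auto
  then have "t summable_on f ` I" by (rule summable_on_subset_banach) auto
  then have "(\<lambda>p. t (f p)) summable_on I" using inj by (simp add: summable_on_reindex o_def)
  then have "(\<lambda>p. ln (eN p) / eN p) summable_on I"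
    by (rule summable_on_cong[THEN iffD1, rotated]) (use f in \<open>auto simp: t_def ln_realpow\<close>)
  then show ?thesis by (simp add: I_def)
qed

text \<open>Inert primes and higher powers contribute convergent sums, so if the class of
  \<open>g\<close> held no element of prime norm, the combination of the \<open>ePsi\<close>
  weighted by an inverse of \<open>g\<close> would stay bounded near 1. The nonprincipal terms are
  bounded because their L-functions do not vanish at 1; the principal one would be bounded too,
  against the divergence over primes.\<close>

theorem dirichlet_eisenstein:
  assumes M: "M > 0" and g: "ecoprime M g"
  shows "\<exists>r. econg M r g \<and> prime (enorm r)"
proof (rule ccontr)
  assume none: "\<nexists>r. econg M r g \<and> prime (enorm r)"
  obtain g' where g': "econg M (g * g') 1" using g by (auto simp: ecoprime_def)
  define X where "X = echars M"
  have finX: "finite X" using finite_echars[OF M] by (simp add: X_def)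
  define A where "A = {q\<in>prime_powers. \<exists>u. u dvd 1 \<and> econg M (g' * pk q) u}"
  define f where "f q = ln (eN (fst q)) / eN (pk q)" for q
  have fnn: "f q \<ge> 0" if "q \<in> prime_powers" for q
    unfolding f_def using ln_eN_prime_nonneg[OF that] by simp
  \<comment> \<open>Orthogonality sees classes up to units only; multiplying the generator by a unit
    v moves it into the class of \<open>g\<close> itself and keeps its norm.\<close>
  have A1: "\<not> prime (enorm (fst q))" if q: "q \<in> A" "snd q = 1" for q
  proof
    assume pr: "prime (enorm (fst q))"
    have pq: "pk q = fst q" using q by (simp add: pk_def)
    obtain u where u: "u dvd 1" "econg M (g' * fst q) u" using q by (auto simp: A_def pq)
    obtain v where v: "1 = u * v" using u(1) by (auto elim: dvdE)
    have "econg M (g * g' * (fst q * v)) (1 * (fst q * v))" by (intro econg_mult g' econg_refl)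
    then have 1: "econg M (fst q * v) (g * g' * (fst q * v))" by (simp add: econg_sym)
    have "econg M ((g * v) * (g' * fst q)) ((g * v) * u)" by (intro econg_mult u econg_refl)
    then have 2: "econg M (g * g' * (fst q * v)) g" using v by (simp add: mult_ac)
    have "enorm v = 1" using eis_unit_imp_enorm v by (metis dvd_triv_right)
    then have "prime (enorm (fst q * v))" using pr by (simp add: enorm_mult)
    then show False using none econg_trans[OF 1 2] by blast
  qed
  have fA: "f summable_on A"
  proof (rule summable_on_subset_banach)
    have "f summable_on (\<lambda>p. (p, 1)) ` {p. prime p \<and> \<not> prime (enorm p)}"
      by (subst summable_on_reindex) (use summable_on_inert_primes in \<open>auto simp: inj_on_def o_def f_def pk_def\<close>)
    moreover have "f summable_on {q\<in>prime_powers. snd q \<ge> 2}"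
      unfolding f_def by (rule summable_on_higher_prime_powers)
    ultimately show "f summable_on ((\<lambda>p. (p, 1)) ` {p. prime p \<and> \<not> prime (enorm p)} \<union> {q\<in>prime_powers. snd q \<ge> 2})"
      by (rule summable_on_union)
    show "A \<subseteq> (\<lambda>p. (p, 1)) ` {p. prime p \<and> \<not> prime (enorm p)} \<union> {q\<in>prime_powers. snd q \<ge> 2}"
    proof
      fix q assume q: "q \<in> A"
      show "q \<in> (\<lambda>p. (p, 1)) ` {p. prime p \<and> \<not> prime (enorm p)} \<union> {q\<in>prime_powers. snd q \<ge> 2}"
        using A1[OF q] q by (cases "snd q = 1") (auto simp: A_def prime_powers_def image_iff)
    qed
  qed
  define BA where "BA = real (card X) * infsum f A"
  have bA: "norm (\<Sum>\<eta>\<in>X. \<eta> g' * ePsi \<eta> (of_real s)) \<le> BA" if s: "s > 1" for s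
  proof -
    define t where "t q = of_real (ln (eN (fst q))) * epow (of_real s) (pk q)" for q
    have tf: "norm (t q) \<le> f q" if "q \<in> A" for q
    proof -
      have qp: "q \<in> prime_powers" using that by (simp add: A_def)
      have "norm (t q) \<le> ln (eN (fst q)) * eN (pk q) powr (- 1)"
        unfolding t_def norm_mult using ln_eN_prime_nonneg[OF qp] s by (intro mult_mono norm_epow_mono) auto
      then show ?thesis by (simp add: f_def powr_minus divide_inverse)
    qed
    have ts: "(\<lambda>q. norm (t q)) summable_on A" by (rule summable_on_comparison_test[OF fA tf]) auto
    have "norm (infsum t A) \<le> infsum (\<lambda>q. norm (t q)) A" by (rule norm_infsum_bound[OF ts])
    also have "\<dots> \<le> infsum f A" by (rule infsum_mono[OF ts fA tf])
    finally have "norm (of_nat (card X) * infsum t A) \<le> BA"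
      unfolding BA_def norm_mult by (simp add: mult_left_mono)
    moreover have "(\<Sum>\<eta>\<in>X. \<eta> g' * ePsi \<eta> (of_real s)) = of_nat (card X) * infsum t A"
      unfolding X_def A_def t_def by (rule sum_ePsi[OF M]) (use s in simp)
    ultimately show ?thesis by simp
  qed
  have "\<exists>B. \<forall>s. 1 < s \<longrightarrow> s < 2 \<longrightarrow> norm (ePsi \<eta> (of_real s)) \<le> B" if \<eta>: "\<eta> \<in> X - {echar0 M}" for \<eta>
  proof -
    have \<eta>': "\<eta> \<in> echars M" "\<eta> \<noteq> echar0 M" using \<eta> by (auto simp: X_def)
    obtain F where F: "F holomorphic_on {s. Re s > 0}" "\<And>s. Re s > 1 \<Longrightarrow> F s = eL \<eta> s"
      using eL_continuation[OF M \<eta>'] by blast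
    have oH: "open {s. Re s > 0}" by (rule open_halfspace_Re_gt)
    \<comment> \<open>Including the endpoint 1 makes the segment compact, so F' / F is bounded on
      it; above 1 this quotient is - \<open>ePsi\<close>.\<close>
    have nz: "F (of_real s) \<noteq> 0" if "s \<in> {1..2}" for s
      using nonvanishing_at_1[OF M \<eta>' F] eL_nonzero[OF M \<eta>'(1), of "of_real s"] F(2)[of "of_real s"] that
      by (cases "s = 1") auto
    have sub: "complex_of_real ` {1..2} \<subseteq> {s. Re s > 0}" by auto
    have r: "continuous_on {1..2} complex_of_real" by (intro continuous_intros)
    have "continuous_on {s. Re s > 0} (deriv F)"
      by (rule holomorphic_on_imp_continuous_on[OF holomorphic_deriv[OF F(1) oH]])
    then have 1: "continuous_on {1..2} (\<lambda>s. deriv F (complex_of_real s))" by (rule continuous_on_compose2[OF _ r sub])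
    have "continuous_on {s. Re s > 0} F" by (rule holomorphic_on_imp_continuous_on[OF F(1)])
    then have 2: "continuous_on {1..2} (\<lambda>s. F (complex_of_real s))" by (rule continuous_on_compose2[OF _ r sub])
    have "continuous_on {1..2} (\<lambda>s. deriv F (complex_of_real s) / F (complex_of_real s))"
      by (rule continuous_on_divide[OF 1 2]) (use nz in blast)
    then have "bounded ((\<lambda>s. deriv F (complex_of_real s) / F (complex_of_real s)) ` {1..2})"
      by (intro compact_imp_bounded compact_continuous_image) auto
    then obtain B where B: "\<And>s. s \<in> {1..2} \<Longrightarrow> norm (deriv F (complex_of_real s) / F (complex_of_real s)) \<le> B"
      unfolding bounded_iff by blast
    have "norm (ePsi \<eta> (of_real s)) \<le> B" if s: "1 < s" "s < 2" for s
    proof -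
      define z where "z = complex_of_real s"
      have z: "Re z > 1" using s by (simp add: z_def)
      have "(eL \<eta> has_field_derivative (- ePsi \<eta> z * eL \<eta> z)) (at z)"
        by (rule eL_has_field_derivative[OF z norm_echar_le[OF M \<eta>'(1)] echarsD(1)[OF \<eta>'(1)]])
      then have "(F has_field_derivative (- ePsi \<eta> z * eL \<eta> z)) (at z)"
        by (rule has_field_derivative_transform_within_open[where S = "{s. Re s > 1}"])
           (use z F(2) in \<open>auto simp: open_halfspace_Re_gt\<close>)
      then have "deriv F z = - ePsi \<eta> z * F z" unfolding F(2)[OF z] by (rule DERIV_imp_deriv)
      then have "ePsi \<eta> z = - (deriv F z / F z)" using nz[of s] s by (simp add: z_def)
      then show ?thesis using B[of s] s by (simp add: z_def)
    qed
    then show ?thesis by blast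
  qed
  then obtain B where B: "\<And>\<eta> s. \<eta> \<in> X - {echar0 M} \<Longrightarrow> 1 < s \<Longrightarrow> s < 2 \<Longrightarrow> norm (ePsi \<eta> (of_real s)) \<le> B \<eta>"
    by metis
  define K where "K = BA + (\<Sum>\<eta>\<in>X - {echar0 M}. B \<eta>)"
  have g'c: "ecoprime M g'" using g' by (auto simp: ecoprime_def mult.commute)
  have K: "norm (ePsi (echar0 M) (of_real s)) \<le> K" if s: "1 < s" "s < 2" for s
  proof -
    have "(\<Sum>\<eta>\<in>X. \<eta> g' * ePsi \<eta> (of_real s)) = echar0 M g' * ePsi (echar0 M) (of_real s) + (\<Sum>\<eta>\<in>X - {echar0 M}. \<eta> g' * ePsi \<eta> (of_real s))"
      using finX by (intro sum.remove) (auto simp: X_def)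
    then have "ePsi (echar0 M) (of_real s) = (\<Sum>\<eta>\<in>X. \<eta> g' * ePsi \<eta> (of_real s)) - (\<Sum>\<eta>\<in>X - {echar0 M}. \<eta> g' * ePsi \<eta> (of_real s))"
      using g'c by (simp add: echar0_def)
    moreover have "norm (\<Sum>\<eta>\<in>X - {echar0 M}. \<eta> g' * ePsi \<eta> (of_real s)) \<le> (\<Sum>\<eta>\<in>X - {echar0 M}. B \<eta>)"
    proof (rule sum_norm_le)
      fix \<eta> assume \<eta>: "\<eta> \<in> X - {echar0 M}"
      have "norm (\<eta> g') \<le> 1" using norm_echar_le[OF M] \<eta> by (auto simp: X_def)
      then show "norm (\<eta> g' * ePsi \<eta> (of_real s)) \<le> B \<eta>"
        using mult_mono[OF _ B[OF \<eta> s], of "norm (\<eta> g')" 1] by (simp add: norm_mult)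
    qed
    ultimately show ?thesis using bA[OF s(1)]
        norm_triangle_ineq4[of "\<Sum>\<eta>\<in>X. \<eta> g' * ePsi \<eta> (of_real s)" "\<Sum>\<eta>\<in>X - {echar0 M}. \<eta> g' * ePsi \<eta> (of_real s)"]
      unfolding K_def by simp
  qed
  have "(\<lambda>p. ln (eN p) / eN p) summable_on {p. prime p \<and> ecoprime M p}"
  proof (rule nonneg_bdd_above_summable_on)
    show "0 \<le> ln (eN p) / eN p" if "p \<in> {p. prime p \<and> ecoprime M p}" for p
      using eN_prime_ge_2[of p] that by auto
    show "bdd_above (sum (\<lambda>p. ln (eN p) / eN p) ` {F. F \<subseteq> {p. prime p \<and> ecoprime M p} \<and> finite F})"
    proof (rule bdd_aboveI2)
      fix F assume "F \<in> {F. F \<subseteq> {p. prime p \<and> ecoprime M p} \<and> finite F}"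
      then have F: "finite F" "\<And>p. p \<in> F \<Longrightarrow> prime p" "\<And>p. p \<in> F \<Longrightarrow> ecoprime M p" by auto
      show "(\<Sum>p\<in>F. ln (eN p) / eN p) \<le> K"
      proof (rule sum_powr_limit[OF F(1)])
        show "eN p > 0" if "p \<in> F" for p using F(2)[OF that] by auto
        fix s :: real assume s: "1 < s" "s < 2"
        define h where "h q = of_real (ln (eN (fst q))) * echar0 M (pk q) * epow (of_real s) (pk q)" for q
        have hn: "(\<lambda>q. norm (h q)) summable_on prime_powers" unfolding h_def
          by (rule summable_ePsi_terms[OF _ norm_echar_le[OF M echar0_in]]) (use s in simp)
        have hreal: "h q = of_real (norm (h q))" if "q \<in> prime_powers" for q
          using ln_eN_prime_nonneg[OF that]
          by (auto simp: h_def echar0_def epow_def norm_mult norm_powr_real_powr powr_of_real[symmetric] simp flip: of_real_minus)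
        have "(\<Sum>p\<in>F. ln (eN p) * eN p powr (- s)) = (\<Sum>p\<in>F. norm (h (p, 1)))"
        proof (rule sum.cong)
          fix p assume p: "p \<in> F"
          have "ln (eN p) \<ge> 0" using eN_prime_ge_2[OF F(2)[OF p]] by simp
          then show "ln (eN p) * eN p powr (- s) = norm (h (p, 1))"
            using F(3)[OF p] by (simp add: h_def pk_def echar0_def norm_mult norm_epow)
        qed simp
        also have "\<dots> = (\<Sum>q\<in>(\<lambda>p. (p, 1)) ` F. norm (h q))" by (subst sum.reindex) (auto simp: inj_on_def)
        also have "\<dots> \<le> (\<Sum>\<^sub>\<infinity>q\<in>prime_powers. norm (h q))"
          by (rule finite_sum_le_infsum[OF hn]) (use F in \<open>auto simp: prime_powers_def\<close>)
        also have "\<dots> = (\<Sum>\<^sub>\<infinity>q\<in>prime_powers. Re (h q))" by (rule infsum_cong) (metis Re_complex_of_real hreal)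
        also have "\<dots> = Re (ePsi (echar0 M) (of_real s))"
          unfolding ePsi_def h_def[symmetric] by (rule infsum_Re[OF abs_summable_summable[OF hn]])
        also have "\<dots> \<le> K" using K[OF s] complex_Re_le_cmod order_trans by blast
        finally show "(\<Sum>p\<in>F. ln (eN p) * eN p powr (- s)) \<le> K" .
      qed
    qed
  qed
  then show False using not_summable_on_primes[OF M] by blast
qed

section \<open>The quadratic character of a square root of minus three\<close>

lemma Legendre_values: "Legendre a p \<in> {-1, 0, 1}" by (simp add: Legendre_def)

lemma Legendre_eq_of_cong:
  assumes "p > 2" "[Legendre a p = x] (mod p)" "x \<in> {-1, 0, 1}"
  shows "Legendre a p = x"
proof -
  have "p dvd Legendre a p - x" using assms(2) by (simp add: cong_iff_dvd_diff)
  moreover have "\<bar>Legendre a p - x\<bar> < p" using Legendre_values[of a p] assms(1,3) by auto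
  ultimately show ?thesis using dvd_imp_le_int[of "Legendre a p - x" p] by force
qed

text \<open>A locale, because the same rules are wanted at p and, through reciprocity, at the primes
  dividing c or d in p = c^2 + 3 d^2.\<close>

locale odd_prime =
  fixes p :: nat
  assumes prime_p: "prime p" and p_gt_2: "p > 2"
begin

abbreviation lg :: "int \<Rightarrow> int" where "lg a \<equiv> Legendre a (int p)"

lemma lg_eqI: "[lg a = x] (mod int p) \<Longrightarrow> x \<in> {-1, 0, 1} \<Longrightarrow> lg a = x"
  using Legendre_eq_of_cong p_gt_2 by simp

lemma lg_euler: "[lg a = a ^ ((p - 1) div 2)] (mod int p)"
  using euler_criterion[OF prime_p p_gt_2] .

lemma lg_mult: "lg (a * b) = lg a * lg b"
proof (rule lg_eqI)
  have "[lg (a * b) = a ^ ((p - 1) div 2) * b ^ ((p - 1) div 2)] (mod int p)"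
    using lg_euler[of "a * b"] by (simp add: power_mult_distrib)
  moreover have "[lg a * lg b = a ^ ((p - 1) div 2) * b ^ ((p - 1) div 2)] (mod int p)"
    by (intro cong_mult lg_euler)
  ultimately show "[lg (a * b) = lg a * lg b] (mod int p)" using cong_sym cong_trans by blast
  show "lg a * lg b \<in> {- 1, 0, 1}" using Legendre_values[of a p] Legendre_values[of b p] by auto
qed

lemma lg_cong: assumes "[a = b] (mod int p)" shows "lg a = lg b"
proof (rule lg_eqI)
  have "[lg a = a ^ ((p - 1) div 2)] (mod int p)" by (rule lg_euler)
  also have "[a ^ ((p - 1) div 2) = b ^ ((p - 1) div 2)] (mod int p)" using assms by (rule cong_pow)
  also have "[b ^ ((p - 1) div 2) = lg b] (mod int p)" by (rule cong_sym[OF lg_euler])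
  finally show "[lg a = lg b] (mod int p)" .
qed (rule Legendre_values)

lemma lg_eq_0_iff: "lg a = 0 \<longleftrightarrow> int p dvd a"
  by (auto simp: Legendre_def cong_0_iff)

lemma lg_square: "\<not> int p dvd a \<Longrightarrow> lg (a\<^sup>2) = 1"
  using Legendre_values[of a p] lg_eq_0_iff[of a] by (auto simp: power2_eq_square lg_mult)

lemma lg_1 [simp]: "lg 1 = 1"
  using lg_square[of 1] p_gt_2 by (simp add: zdvd1_eq)

lemma lg_sq_self: "\<not> int p dvd a \<Longrightarrow> lg a * lg a = 1"
  using lg_square[of a] by (simp add: power2_eq_square lg_mult)

lemma lg_multiplicative_eq:
  fixes e :: "nat \<Rightarrow> int"
  assumes e: "\<And>a b. e (a * b) = e a * e b" "e 1 = 1"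
  shows "n > 0 \<Longrightarrow> (\<And>q. prime q \<Longrightarrow> q dvd n \<Longrightarrow> lg (int q) = e q) \<Longrightarrow> lg (int n) = e n"
proof (induction n rule: prime_divisors_induct)
  case (factor q n)
  then have "lg (int n) = e n" "lg (int q) = e q" by auto
  then show ?case by (simp add: lg_mult e)
qed (use e in auto)

end

text \<open>The primitive quadratic character modulo 12, attached to the field of \<surd>3. It is
  even, so the sign of c will not matter.\<close>

definition char12 :: "nat \<Rightarrow> int" where
  "char12 n = (if n mod 12 \<in> {1, 11} then 1 else if n mod 12 \<in> {5, 7} then -1 else 0)"

lemma char12_mult: "char12 (a * b) = char12 a * char12 b"
proof -
  define R where "R = {0, 1, 2, 3, 4, 5, 6, 7, 8, 9, 10, 11 :: nat}"
  have "\<forall>x\<in>R. \<forall>y\<in>R. char12 (x * y) = char12 x * char12 y"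
    by (simp add: char12_def R_def)
  moreover have "x mod 12 \<in> R" for x unfolding R_def by (simp, presburger)
  ultimately have "char12 ((a mod 12) * (b mod 12)) = char12 (a mod 12) * char12 (b mod 12)" by blast
  moreover have "char12 (x mod 12) = char12 x" for x by (simp add: char12_def)
  moreover have "char12 ((a mod 12) * (b mod 12)) = char12 (a * b)" by (simp add: char12_def mod_mult_eq)
  ultimately show ?thesis by simp
qed

lemma Legendre_mod_3:
  assumes "\<not> 3 dvd (q::int)" shows "Legendre q 3 = (if [q = 1] (mod 3) then 1 else -1)"
proof -
  interpret odd_prime 3 by unfold_locales auto
  have q: "[q = 1] (mod 3) \<or> [q = -1] (mod 3)" using assms by (simp add: cong_def) presburger
  have "lg (-1) = -1"
    by (rule lg_eqI) (use lg_euler[of "-1"] in auto)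
  then show ?thesis using q lg_1 lg_cong[of q 1] lg_cong[of q "-1"] by (auto simp: cong_def)
qed

lemma Legendre_3:
  assumes q: "prime q" "q > 3" shows "Legendre 3 (int q) = char12 q"
proof -
  have "\<not> 3 dvd q" using q primes_dvd_imp_eq[of 3 q] by auto
  then have n3: "q mod 3 = 1 \<or> q mod 3 = 2" by presburger
  have "odd q" using q prime_odd_nat by auto
  then have n2: "q mod 4 = 1 \<or> q mod 4 = 3" by presburger
  have "Legendre (int q) (int 3) * Legendre (int 3) (int q) = (-1) ^ ((q - 1) div 2 * ((3 - 1) div 2))"
    using q by (intro Quadratic_Reciprocity) auto
  moreover have "Legendre (int q) (int 3) = (if q mod 3 = 1 then 1 else -1)"
  proof -
    have "\<not> 3 dvd int q" using \<open>\<not> 3 dvd q\<close> int_dvd_int_iff[of 3 q] by simp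
    moreover have "[int q = 1] (mod 3) \<longleftrightarrow> q mod 3 = 1"
      using cong_int_iff[of q 1 3] by (simp add: cong_def)
    ultimately show ?thesis using Legendre_mod_3[of "int q"] by simp
  qed
  moreover have "even ((q - 1) div 2) \<longleftrightarrow> q mod 4 = 1" using n2 \<open>odd q\<close> by presburger
  ultimately have "Legendre 3 (int q) = (if q mod 3 = 1 then 1 else -1) * (if q mod 4 = 1 then 1 else -1)"
    by (auto simp: minus_one_power_iff split: if_splits)
  moreover define r where "r = q mod 12"
  have r34: "q mod 3 = r mod 3" "q mod 4 = r mod 4" by (simp_all add: r_def mod_mod_cancel)
  moreover have "r \<in> {1, 5, 7, 11}" using n2 n3 unfolding r_def by (simp, presburger)
  ultimately show ?thesis unfolding char12_def r_def[symmetric] by auto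
qed

section \<open>Quadratic characters attached to p = c^2 + 3 d^2\<close>

context odd_prime begin

lemma lg_odd_prime:
  assumes p4: "p mod 4 = 1" and q: "prime q" "q > 2" "q \<noteq> p"
  shows "lg (int q) = Legendre (int p) (int q)"
proof -
  have "even ((p - 1) div 2)" using p4 by presburger
  then have 1: "Legendre (int p) (int q) * lg (int q) = 1"
    using Quadratic_Reciprocity[OF prime_p p_gt_2 q(1,2)] q(3) by (simp add: minus_one_power_iff)
  show ?thesis using 1 Legendre_values[of "int p" "int q"] by auto
qed

lemma lg_minus_1: "p mod 4 = 1 \<Longrightarrow> lg (-1) = 1"
proof (rule lg_eqI)
  assume "p mod 4 = 1"
  then have "even ((p - 1) div 2)" by presburger
  then show "[lg (-1) = 1] (mod int p)" using lg_euler[of "-1"] by (simp add: minus_one_power_iff)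
qed simp

lemma ex_sqrt_minus_1: assumes "p mod 4 = 1" shows "\<exists>i. [i\<^sup>2 = -1] (mod int p)"
  using lg_minus_1[OF assms] by (auto simp: Legendre_def QuadRes_def split: if_splits)

lemma lg_2_eq_lg_i:
  assumes i: "[i\<^sup>2 = -1] (mod int p)" shows "lg 2 = lg i"
proof -
  have p2: "\<not> int p dvd 2" using p_gt_2 zdvd_imp_le by force
  have pi: "\<not> int p dvd i"
  proof
    assume "int p dvd i"
    then have "int p dvd i\<^sup>2" by (simp add: power2_eq_square)
    then have "int p dvd -1" using i cong_dvd_iff by blast
    then show False using p_gt_2 by simp
  qed
  have c: "[(1 + i)\<^sup>2 = 2 * i] (mod int p)"
  proof -
    have "(1 + i)\<^sup>2 - 2 * i = i\<^sup>2 - (-1)" by (simp add: power2_eq_square algebra_simps)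
    then show ?thesis using i by (simp add: cong_iff_dvd_diff)
  qed
  have "\<not> int p dvd (1 + i)"
  proof
    assume "int p dvd (1 + i)"
    then have "int p dvd (1 + i)\<^sup>2" by (simp add: power2_eq_square)
    then have "int p dvd 2 * i" using c cong_dvd_iff by blast
    then show False using p2 pi prime_p by (simp add: prime_dvd_mult_iff)
  qed
  then have "lg ((1 + i)\<^sup>2) = 1" by (rule lg_square)
  then have "lg 2 * lg i = 1" using lg_cong[OF c] by (simp add: lg_mult)
  then show ?thesis using Legendre_values[of 2 p] Legendre_values[of i p] by auto
qed

text \<open>With p = 4 k + 1, Euler's criterion gives a square root i of -1 the symbol (-1)^k, and 2
  i = (1 + i)^2 carries this over to 2.\<close>

lemma lg_2: assumes p4: "p mod 4 = 1" shows "lg 2 = (if p mod 8 = 1 then 1 else -1)"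
proof -
  obtain i where i: "[i\<^sup>2 = -1] (mod int p)" using ex_sqrt_minus_1[OF p4] by auto
  define k where "k = p div 4"
  have k: "(p - 1) div 2 = 2 * k" using p4 unfolding k_def by presburger
  have "[lg i = (i\<^sup>2) ^ k] (mod int p)" using lg_euler[of i] unfolding k by (simp add: power_mult)
  also have "[(i\<^sup>2) ^ k = (-1) ^ k] (mod int p)" using i by (rule cong_pow)
  finally have "lg i = (-1) ^ k" by (rule lg_eqI) (auto simp: minus_one_power_iff)
  moreover have "even k \<longleftrightarrow> p mod 8 = 1" using p4 unfolding k_def by presburger
  ultimately show ?thesis using lg_2_eq_lg_i[OF i] by (simp add: minus_one_power_iff)
qed

lemma lg_abs: assumes p4: "p mod 4 = 1" shows "lg \<bar>a\<bar> = lg a"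
  using lg_mult[of "-1" a] lg_minus_1[OF p4] by (simp add: abs_if)

text \<open>Modulo \<open>p\<close> the quotient \<open>c/d\<close> is a square root of \<open>-3\<close>, so \<open>lg c * lg d\<close> is its quadratic character.\<close>

lemma lg_norm_form:
  assumes p12: "p mod 12 = 1" and cd: "int p = c\<^sup>2 + 3 * d\<^sup>2"
  shows "lg c = char12 (nat \<bar>c\<bar>)" "even d" "4 dvd d \<Longrightarrow> lg d = 1" "\<not> 4 dvd d \<Longrightarrow> lg d = -1"
proof -
  have p4: "p mod 4 = 1" using p12 by presburger
  have cop: "coprime c d"
  proof (rule coprimeI)
    fix k assume k: "k dvd c" "k dvd d"
    then have "k\<^sup>2 dvd c\<^sup>2" "k\<^sup>2 dvd 3 * d\<^sup>2" by auto
    then have "k\<^sup>2 dvd int p" unfolding cd by (rule dvd_add)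
    then obtain j where j: "int p = k * (k * j)" by (metis dvdE mult.assoc power2_eq_square)
    have "irreducible (int p)" using prime_p by (simp add: prime_elem_imp_irreducible)
    then have "k dvd 1 \<or> k * j dvd 1" using irreducibleD[OF _ j] by blast
    then show "k dvd 1" using dvd_mult_left by blast
  qed
  have d0: "d \<noteq> 0"
  proof
    assume "d = 0"
    then have "int p = c * c" using cd by (simp add: power2_eq_square)
    moreover have "c dvd 1" using cop \<open>d = 0\<close> by simp
    ultimately show False using p_gt_2 by (auto simp: zdvd1_eq abs_if split: if_splits)
  qed
  have oc: "odd c" and ed: "even d"
  proof -
    have "c mod 4 \<in> {0,1,2,3}" "d mod 4 \<in> {0,1,2,3}" by auto
    moreover have "(c\<^sup>2 + 3 * d\<^sup>2) mod 4 = ((c mod 4)\<^sup>2 + 3 * (d mod 4)\<^sup>2) mod 4"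
      unfolding cong_def[symmetric]
      by (intro cong_add cong_mult cong_pow cong_refl) (auto simp: cong_def)
    moreover have "(c\<^sup>2 + 3 * d\<^sup>2) mod 4 = 1" using p4 unfolding cd[symmetric] by presburger
    ultimately have "c mod 4 \<in> {1,3}" "d mod 4 \<in> {0,2}" by auto
    then show "odd c" "even d" by (auto; presburger)+
  qed
  have c3: "\<not> 3 dvd c"
  proof
    assume "3 dvd c"
    then have "3 dvd int p" unfolding cd by (simp add: power2_eq_square)
    then show False using p12 by presburger
  qed
  show "even d" by (rule ed)
  have c0: "c \<noteq> 0" using oc by auto
  \<comment> \<open>For a prime q dividing c, p is congruent to 3 d^2 modulo q; reciprocity, with p
    = 1 modulo 4, turns the symbol of q modulo p into that of 3 modulo q.\<close>
  have "lg (int (nat \<bar>c\<bar>)) = char12 (nat \<bar>c\<bar>)"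
  proof (rule lg_multiplicative_eq)
    fix q assume q: "prime q" "q dvd nat \<bar>c\<bar>"
    have qc: "int q dvd c" using q(2) by (simp add: int_dvd_int_iff[symmetric] del: int_dvd_int_iff)
    have q3: "q > 3"
    proof -
      have "q \<noteq> 2" "q \<noteq> 3" using qc oc c3 by auto
      then show ?thesis using prime_ge_2_nat[OF q(1)] by linarith
    qed
    interpret Q: odd_prime q using q(1) q3 by unfold_locales auto
    have qd: "\<not> int q dvd d"
    proof
      assume "int q dvd d"
      then have "int q dvd 1" using cop qc by (metis coprime_common_divisor)
      then show False using q3 by simp
    qed
    have "q \<noteq> p"
    proof
      assume "q = p"
      then have "int q dvd 3 * d\<^sup>2" using cd qc by (metis dvd_add_right_iff dvd_refl power2_eq_square dvd_mult)
      then have "int q dvd 3 \<or> int q dvd d" using q(1) by (simp add: prime_dvd_mult_iff prime_dvd_power_iff)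
      then show False using qd q3 zdvd_imp_le[of "int q" 3] by auto
    qed
    then have "lg (int q) = Legendre (int p) (int q)" using lg_odd_prime[OF p4 q(1)] q3 by simp
    also have "\<dots> = Legendre (3 * d\<^sup>2) (int q)"
      by (rule Q.lg_cong) (use qc cd in \<open>auto simp: cong_iff_dvd_diff power2_eq_square\<close>)
    also have "\<dots> = Legendre 3 (int q)" using Q.lg_square[OF qd] by (simp add: Q.lg_mult)
    also have "\<dots> = char12 q" by (rule Legendre_3[OF q(1) q3])
    finally show "lg (int q) = char12 q" .
  qed (use c0 in \<open>auto simp: char12_mult\<close>, simp add: char12_def)
  then show "lg c = char12 (nat \<bar>c\<bar>)" using lg_abs[OF p4, of c] by simp
  \<comment> \<open>For an odd prime q dividing d, p is congruent to c^2 modulo q, so q is a square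
    modulo p; only the prime 2 can contribute a sign to d.\<close>
  have qodd: "lg (int q) = 1" if q: "prime q" "q > 2" "int q dvd d" for q
  proof -
    interpret Q: odd_prime q using q by unfold_locales auto
    have qc: "\<not> int q dvd c"
    proof
      assume "int q dvd c"
      then have "int q dvd 1" using cop q(3) by (metis coprime_common_divisor)
      then show False using q by simp
    qed
    have "q \<noteq> p"
    proof
      assume "q = p"
      then have "int q dvd c\<^sup>2" using cd q(3) by (metis dvd_add_left_iff dvd_refl power2_eq_square dvd_mult)
      then show False using qc q(1) by (simp add: prime_dvd_power_iff)
    qed
    then have "lg (int q) = Legendre (int p) (int q)" using lg_odd_prime[OF p4 q(1,2)] by simp
    also have "\<dots> = Legendre (c\<^sup>2) (int q)"
      by (rule Q.lg_cong) (use q cd in \<open>auto simp: cong_iff_dvd_diff power2_eq_square\<close>)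
    also have "\<dots> = 1" by (rule Q.lg_square[OF qc])
    finally show ?thesis .
  qed
  \<comment> \<open>Odd squares are 1 modulo 8, so p is 1 or 5 modulo 8 according to whether 4
    divides d. In the first case 2 is a square modulo p; in the second it is not, and it divides d
    exactly once.\<close>
  have c8: "c\<^sup>2 mod 8 = 1"
  proof -
    have "c mod 8 \<in> {1,3,5,7}" using oc by (auto; presburger)
    moreover have "c\<^sup>2 mod 8 = ((c mod 8)\<^sup>2) mod 8" by (simp add: power_mod)
    ultimately show ?thesis by auto
  qed
  show "lg d = 1" if d4: "4 dvd d"
  proof -
    obtain e where e: "d = 4 * e" using d4 by auto
    have "int p = c\<^sup>2 + 8 * (6 * e\<^sup>2)" unfolding cd e by (simp add: power2_eq_square)
    then have "int p mod 8 = 1" using c8 by (metis mod_mult_self2)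
    then have "p mod 8 = 1" by presburger
    then have l2: "lg 2 = 1" using lg_2[OF p4] by simp
    have "lg (int (nat \<bar>d\<bar>)) = 1"
    proof (rule lg_multiplicative_eq[where e = "\<lambda>_. 1"])
      fix q assume q: "prime q" "q dvd nat \<bar>d\<bar>"
      have qc: "int q dvd d" using q(2) by (simp add: int_dvd_int_iff[symmetric] del: int_dvd_int_iff)
      show "lg (int q) = 1" using qodd[OF q(1) _ qc] l2 prime_ge_2_nat[OF q(1)] by (cases "q = 2") auto
    qed (use d0 in auto)
    then show ?thesis using lg_abs[OF p4, of d] by simp
  qed
  show "lg d = -1" if d4: "\<not> 4 dvd d"
  proof -
    obtain e where e: "d = 2 * e" using ed by auto
    have oe: "odd e" using d4 e by auto
    have e0: "e \<noteq> 0" using oe by auto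
    obtain f where f: "e = 2 * f + 1" using oe by (auto elim: oddE)
    have "int p = (c\<^sup>2 + 4) + 8 * (6 * f\<^sup>2 + 6 * f + 1)" unfolding cd e f by (simp add: power2_eq_square algebra_simps)
    then have "int p mod 8 = 5" using c8 by presburger
    then have "p mod 8 \<noteq> 1" by presburger
    then have l2: "lg 2 = -1" using lg_2[OF p4] by simp
    have "lg (int (nat \<bar>e\<bar>)) = 1"
    proof (rule lg_multiplicative_eq[where e = "\<lambda>_. 1"])
      fix q assume q: "prime q" "q dvd nat \<bar>e\<bar>"
      have qe: "int q dvd e" using q(2) by (simp add: int_dvd_int_iff[symmetric] del: int_dvd_int_iff)
      have "q \<noteq> 2" using qe oe by auto
      then show "lg (int q) = 1" using qodd[OF q(1)] qe e prime_ge_2_nat[OF q(1)] by auto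
    qed (use e0 in auto)
    then have "lg e = 1" using lg_abs[OF p4, of e] by simp
    then show ?thesis using l2 by (simp add: e lg_mult)
  qed
qed

text \<open>Modulo p a root x makes s = x^2 + 3 a square root of 12, and s (s - 2)^2 = (4 x)^2 makes
  s itself a square. As i s d is 2 c or -2 c for i^2 = -1, and 2 has the same symbol as i, the
  symbols of c and d would agree.\<close>

lemma no_root_mod:
  assumes p12: "p mod 12 = 1" and cd: "int p = c\<^sup>2 + 3 * d\<^sup>2" and neg: "lg c * lg d = -1"
  shows "\<not> [x ^ 4 + 6 * x ^ 2 - 3 = 0] (mod int p)"
proof
  assume x: "[x ^ 4 + 6 * x ^ 2 - 3 = 0] (mod int p)"
  have p4: "p mod 4 = 1" using p12 by presburger
  obtain i where i: "[i\<^sup>2 = -1] (mod int p)" using ex_sqrt_minus_1[OF p4] by auto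
  have pp: "prime (int p)" using prime_p by simp
  have p13: "p \<ge> 13" using p12 p_gt_2 by presburger
  have small: "\<not> int p dvd k" if "k \<noteq> 0" "\<bar>k\<bar> < 13" for k
    using dvd_imp_le_int[of k "int p"] that p13 by force
  define s where "s = x\<^sup>2 + 3"
  have x': "int p dvd x ^ 4 + 6 * x ^ 2 - 3" using x by (simp add: cong_0_iff)
  have s2: "int p dvd s\<^sup>2 - 12"
  proof -
    have "s\<^sup>2 - 12 = x ^ 4 + 6 * x ^ 2 - 3" by (simp add: s_def power2_eq_square power4_eq_xxxx algebra_simps)
    then show ?thesis using x' by simp
  qed
  have px: "\<not> int p dvd x"
  proof
    assume "int p dvd x"
    then have "int p dvd x ^ 4 + 6 * x ^ 2" by (intro dvd_add dvd_mult) (auto simp: dvd_power_same intro: dvd_trans[OF _ dvd_power])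
    then have "int p dvd 3" using x' by (metis dvd_diff_commute diff_add_cancel dvd_diff cancel_ab_semigroup_add_class.add_diff_cancel_left' diff_diff_eq2)
    then show False using small[of 3] by simp
  qed
  have ps: "\<not> int p dvd s - 2"
  proof
    assume "int p dvd s - 2"
    then have "int p dvd (s - 2) * (s + 2)" by simp
    then have "int p dvd (s\<^sup>2 - 12) - (s - 2) * (s + 2)" using s2 by (rule dvd_diff[rotated])
    also have "(s\<^sup>2 - 12) - (s - 2) * (s + 2) = -8" by (simp add: power2_eq_square algebra_simps)
    finally show False using small[of "-8"] by simp
  qed
  have e16: "[s * (s - 2)\<^sup>2 = (4 * x)\<^sup>2] (mod int p)"
  proof -
    have "s * (s - 2)\<^sup>2 - (4 * x)\<^sup>2 = (s\<^sup>2 - 12) * (s - 4)"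
      by (simp add: s_def power2_eq_square algebra_simps)
    then show ?thesis using s2 by (simp add: cong_iff_dvd_diff)
  qed
  have "\<not> int p dvd 4 * x" using px small[of 4] pp by (simp add: prime_dvd_mult_iff)
  then have "lg ((4 * x)\<^sup>2) = 1" by (rule lg_square)
  then have ls: "lg s = 1" using lg_cong[OF e16] lg_square[OF ps] by (simp add: lg_mult)
  have "int p dvd (i * s * d)\<^sup>2 - (2 * c)\<^sup>2"
  proof -
    have "(i * s * d)\<^sup>2 - (2 * c)\<^sup>2 = (i\<^sup>2 - (-1)) * (s\<^sup>2 * d\<^sup>2) - (s\<^sup>2 - 12) * d\<^sup>2 - 4 * (c\<^sup>2 + 3 * d\<^sup>2)"
      by (simp add: power2_eq_square algebra_simps)
    moreover have "int p dvd i\<^sup>2 - (-1)" using i by (simp add: cong_iff_dvd_diff)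
    moreover have "int p dvd c\<^sup>2 + 3 * d\<^sup>2" using cd by simp
    ultimately show ?thesis using s2 by (metis dvd_diff dvd_mult dvd_mult2)
  qed
  also have "(i * s * d)\<^sup>2 - (2 * c)\<^sup>2 = (i * s * d - 2 * c) * (i * s * d + 2 * c)"
    by (simp add: power2_eq_square algebra_simps)
  finally have "int p dvd i * s * d - 2 * c \<or> int p dvd i * s * d + 2 * c" using pp by (simp add: prime_dvd_mult_iff)
  then have "[i * s * d = 2 * c] (mod int p) \<or> [i * s * d = (-1) * (2 * c)] (mod int p)"
    by (auto simp: cong_iff_dvd_diff)
  then have "lg (i * s * d) = lg (2 * c)"
    using lg_cong lg_mult[of "-1" "2 * c"] lg_minus_1[OF p4] by fastforce
  then have "lg i * lg d = lg i * lg c" using ls lg_2_eq_lg_i[OF i] by (simp add: lg_mult)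
  moreover have "lg i \<noteq> 0" using lg_2_eq_lg_i[OF i] lg_2[OF p4] by (auto split: if_splits)
  ultimately have "lg d = lg c" by simp
  then have "lg c * lg c = -1" using neg by simp
  moreover have "lg c * lg c \<ge> 0" by simp
  ultimately show False by linarith
qed

end

lemma V_eq_0I:
  assumes "\<And>x. \<not> [x ^ 4 + 6 * x ^ 2 - 3 = 0] (mod int p)" shows "V p = 0"
  unfolding V_def using assms by simp

section \<open>Primes with and without solutions\<close>

text \<open>Pigeonhole: the squares and the numbers c - 3 b^2 each take (q + 1) / 2 values modulo q,
  together one more than there are residues.\<close>

lemma ex_norm_form_mod_prime:
  fixes c :: int assumes q: "prime q" "q > 3"
  shows "\<exists>a b. [a\<^sup>2 + 3 * b\<^sup>2 = c] (mod int q)"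
proof -
  define h where "h = (int q - 1) div 2"
  have oq: "odd (int q)" using q prime_odd_nat[of q] by auto
  then have h: "int q = 2 * h + 1" unfolding h_def by presburger
  have h0: "h \<ge> 0" using h q by linarith
  have pq: "prime (int q)" using q by simp
  have q3: "\<not> int q dvd 3" using q zdvd_imp_le[of "int q" 3] by auto
  have sq: "a = b" if ab: "a \<in> {0..h}" "b \<in> {0..h}" "int q dvd a\<^sup>2 - b\<^sup>2" for a b
  proof -
    have "a\<^sup>2 - b\<^sup>2 = (a - b) * (a + b)" by (simp add: power2_eq_square algebra_simps)
    then have "int q dvd a - b \<or> int q dvd a + b" using ab(3) pq by (simp add: prime_dvd_mult_iff)
    then show ?thesis
    proof
      assume "int q dvd a - b"
      then show ?thesis using ab h dvd_imp_le_int[of "a - b" "int q"] by force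
    next
      assume "int q dvd a + b"
      then have "a + b = 0" using ab h zdvd_not_zless[of "a + b" "int q"] by force
      then show ?thesis using ab by simp
    qed
  qed
  define A where "A = (\<lambda>a. a\<^sup>2 mod int q) ` {0..h}"
  define B where "B = (\<lambda>b. (c - 3 * b\<^sup>2) mod int q) ` {0..h}"
  have cA: "card A = nat (h + 1)" unfolding A_def
    by (subst card_image) (auto simp: inj_on_def mod_eq_dvd_iff intro: sq)
  have cB: "card B = nat (h + 1)" unfolding B_def
  proof (subst card_image)
    show "inj_on (\<lambda>b. (c - 3 * b\<^sup>2) mod int q) {0..h}"
    proof (rule inj_onI)
      fix a b assume ab: "a \<in> {0..h}" "b \<in> {0..h}" "(c - 3 * a\<^sup>2) mod int q = (c - 3 * b\<^sup>2) mod int q"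
      then have "int q dvd 3 * (b\<^sup>2 - a\<^sup>2)" by (simp add: mod_eq_dvd_iff algebra_simps)
      then have "int q dvd b\<^sup>2 - a\<^sup>2" using q3 prime_dvd_multD[OF pq] by blast
      then show "a = b" using sq[of b a] ab by simp
    qed
  qed simp
  have "A \<union> B \<subseteq> {0..<int q}" using q by (auto simp: A_def B_def)
  then have "card (A \<union> B) \<le> q" using card_mono[of "{0..<int q}" "A \<union> B"] by simp
  moreover have "card A + card B = q + 1" unfolding cA cB using h h0 by linarith
  moreover have "card A + card B = card (A \<union> B) + card (A \<inter> B)"
    by (rule card_Un_Int) (auto simp: A_def B_def)
  ultimately have "card (A \<inter> B) > 0" by linarith
  then have "A \<inter> B \<noteq> {}" by (metis card.empty less_irrefl)
  then obtain a b where "a\<^sup>2 mod int q = (c - 3 * b\<^sup>2) mod int q" by (auto simp: A_def B_def)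
  then have "[a\<^sup>2 + 3 * b\<^sup>2 = c] (mod int q)" by (simp add: cong_iff_dvd_diff mod_eq_dvd_iff algebra_simps)
  then show ?thesis by blast
qed

lemma solve_linear_mod_prime:
  fixes a k q :: int assumes "prime q" "\<not> q dvd a" shows "\<exists>t. q dvd k + a * t"
proof -
  have "coprime a q" using assms prime_imp_coprime coprime_commute by blast
  then obtain b where "[a * b = 1] (mod q)" using cong_solve_coprime_int by blast
  then have "q dvd a * b - 1" by (simp add: cong_iff_dvd_diff)
  then have "q dvd - k * (a * b - 1)" by (rule dvd_mult)
  also have "- k * (a * b - 1) = k + a * (- k * b)" by (simp add: algebra_simps)
  finally show ?thesis by blast
qed

text \<open>A solution is built up one prime of n at a time, always keeping x and y modulo 12, since
  these residues will decide the quadratic characters. A prime already in the modulus is handled by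
  Hensel lifting, a new one by the Chinese remainder theorem. The factor 24 lets the lift at 2 shift
  x by half the modulus and still keep it modulo 12.\<close>

lemma ex_norm_form_mod:
  fixes c x0 y0 :: int
  assumes c: "coprime c 24" and x0: "odd x0" "\<not> 3 dvd x0" and base: "[x0\<^sup>2 + 3 * y0\<^sup>2 = c] (mod 24)"
  shows "n > 0 \<Longrightarrow> coprime c (int n) \<Longrightarrow>
    \<exists>x y. [x = x0] (mod 12) \<and> [y = y0] (mod 12) \<and> [x\<^sup>2 + 3 * y\<^sup>2 = c] (mod 24 * int n)"
proof (induction n rule: prime_divisors_induct)
  case (factor q n)
  have n0: "n > 0" and cn: "coprime c (int n)" and cq: "coprime c (int q)" and q: "prime q"
    using factor by auto
  obtain x y where xy: "[x = x0] (mod 12)" "[y = y0] (mod 12)" "[x\<^sup>2 + 3 * y\<^sup>2 = c] (mod 24 * int n)"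
    using factor.IH n0 cn by blast
  define m where "m = 24 * int n"
  obtain k where k: "x\<^sup>2 + 3 * y\<^sup>2 = c + m * k"
    using xy(3) unfolding m_def[symmetric] by (metis cong_iff_lin add.commute cong_sym_eq)
  have pq: "prime (int q)" using q by simp
  have ox: "odd x" and x3: "\<not> 3 dvd x"
  proof -
    have "[x = x0] (mod 2)" "[x = x0] (mod 3)" using xy(1) by (auto intro: cong_dvd_modulus)
    then show "odd x" "\<not> 3 dvd x" using x0 cong_dvd_iff by blast+
  qed
  have m12: "12 dvd m" by (simp add: m_def)
  have goalI: "\<exists>x y. [x = x0] (mod 12) \<and> [y = y0] (mod 12) \<and> [x\<^sup>2 + 3 * y\<^sup>2 = c] (mod 24 * int (q * n))"
    if "[x' = x] (mod 12)" "[y' = y] (mod 12)" "m * int q dvd x'\<^sup>2 + 3 * y'\<^sup>2 - c" for x' y'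
  proof (intro exI conjI)
    show "[x' = x0] (mod 12)" "[y' = y0] (mod 12)" using that xy cong_trans by blast+
    show "[x'\<^sup>2 + 3 * y'\<^sup>2 = c] (mod 24 * int (q * n))" using that(3) by (simp add: cong_iff_dvd_diff m_def mult_ac)
  qed
  show ?case
  proof (cases "int q dvd m")
    case True
    show ?thesis
    proof (cases "q = 2")
      case True
      \<comment> \<open>A step by a multiple of m is useless at 2, as the derivative 2 x is even. A
        step by k m / 2 changes the value by m k x modulo 2 m, and x is odd.\<close>
      define x' where "x' = x + k * (12 * int n)"
      have "x'\<^sup>2 + 3 * y\<^sup>2 - c = m * (k * (1 + x) + 2 * (3 * int n * k\<^sup>2))"
        using k by (simp add: x'_def m_def power2_eq_square algebra_simps)
      moreover have "2 dvd k * (1 + x) + 2 * (3 * int n * k\<^sup>2)" using ox by simp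
      ultimately show ?thesis using True by (intro goalI[of x' y]) (auto simp: x'_def cong_iff_dvd_diff)
    next
      case False
      have q2: "\<not> int q dvd 2" using False q primes_dvd_imp_eq[of "int q" 2] by auto
      have qm: "m * int q dvd m * m" using True by (intro mult_dvd_mono) auto
      show ?thesis
      proof (cases "int q dvd x")
        case False
        then have "\<not> int q dvd 2 * x" using q2 pq by (simp add: prime_dvd_mult_iff)
        then obtain t where t: "int q dvd k + 2 * x * t" using solve_linear_mod_prime[OF pq] by blast
        have "(x + t * m)\<^sup>2 + 3 * y\<^sup>2 - c = m * (k + 2 * x * t) + t\<^sup>2 * (m * m)"
          using k by (simp add: power2_eq_square algebra_simps)
        moreover have "m * int q dvd m * (k + 2 * x * t)" using t by (intro mult_dvd_mono) auto
        ultimately show ?thesis using m12 qm by (intro goalI[of "x + t * m" y]) (auto simp: cong_iff_dvd_diff)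
      next
        \<comment> \<open>When q divides x the lift moves y instead; q cannot divide 6 y as well,
          for then it would divide c.\<close>
        case qx: True
        have "\<not> int q dvd 6 * y"
        proof
          assume "int q dvd 6 * y"
          then have "int q dvd 2 * (3 * y)" by simp
          then have "int q dvd 3 * y" using q2 pq by (metis prime_dvd_mult_iff)
          then have "int q dvd x * x + 3 * y * y - m * k" using qx True by (intro dvd_diff dvd_add) auto
          also have "x * x + 3 * y * y - m * k = c" using k by (simp add: power2_eq_square algebra_simps)
          finally have "int q dvd 1" using cq by (meson coprime_common_divisor dvd_refl)
          then show False using q by auto
        qed
        then obtain t where t: "int q dvd k + 6 * y * t" using solve_linear_mod_prime[OF pq] by blast
        have "x\<^sup>2 + 3 * (y + t * m)\<^sup>2 - c = m * (k + 6 * y * t) + 3 * t\<^sup>2 * (m * m)"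
          using k by (simp add: power2_eq_square algebra_simps)
        moreover have "m * int q dvd m * (k + 6 * y * t)" using t by (intro mult_dvd_mono) auto
        ultimately show ?thesis using m12 qm by (intro goalI[of x "y + t * m"]) (auto simp: cong_iff_dvd_diff)
      qed
    qed
  next
    case False
    then have cop: "coprime m (int q)" using pq prime_imp_coprime coprime_commute by blast
    have "q > 3"
    proof -
      have "q \<noteq> 2" "q \<noteq> 3" using False by (auto simp: m_def)
      then show ?thesis using prime_ge_2_nat[OF q] by linarith
    qed
    then obtain a b where ab: "[a\<^sup>2 + 3 * b\<^sup>2 = c] (mod int q)" using ex_norm_form_mod_prime[OF q] by blast
    obtain x' where x': "[x' = x] (mod m)" "[x' = a] (mod int q)" using binary_chinese_remainder_int[OF cop] by blast
    obtain y' where y': "[y' = y] (mod m)" "[y' = b] (mod int q)" using binary_chinese_remainder_int[OF cop] by blast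
    have "[x'\<^sup>2 + 3 * y'\<^sup>2 = x\<^sup>2 + 3 * y\<^sup>2] (mod m)" by (intro cong_add cong_mult cong_pow x' y' cong_refl)
    then have 1: "[x'\<^sup>2 + 3 * y'\<^sup>2 = c] (mod m)" using xy(3) cong_trans unfolding m_def by blast
    have "[x'\<^sup>2 + 3 * y'\<^sup>2 = a\<^sup>2 + 3 * b\<^sup>2] (mod int q)" by (intro cong_add cong_mult cong_pow x' y' cong_refl)
    then have 2: "[x'\<^sup>2 + 3 * y'\<^sup>2 = c] (mod int q)" using ab cong_trans by blast
    have "m * int q dvd x'\<^sup>2 + 3 * y'\<^sup>2 - c"
      using 1 2 cop by (intro divides_mult) (auto simp: cong_iff_dvd_diff)
    moreover have "[x' = x] (mod 12)" "[y' = y] (mod 12)" using x'(1) y'(1) m12 cong_dvd_modulus by blast+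
    ultimately show ?thesis by (intro goalI)
  qed
next
  case (unit n)
  then have "n = 1" by simp
  then show ?case using base by (intro exI[of _ x0] exI[of _ y0]) simp
qed simp

text \<open>The class of p does not fix c1 modulo 12 in p = c1^2 + 3 d^2. This residue is prescribed
  so that the symbols of c1 and d modulo p differ, and an Eisenstein integer of prime norm in the
  corresponding class supplies p.\<close>

lemma ex_prime_V_eq_0:
  fixes c :: int
  assumes m: "m > 0" "12 dvd m" and c: "[c = 1] (mod 12)" "coprime c (int m)"
  shows "\<exists>p :: nat. prime p \<and> [int p = c] (mod int m) \<and> V p = 0"
proof -
  obtain n where n: "m = 12 * n" using m(2) by auto
  have n0: "n > 0" using m(1) n by auto
  have c12: "c mod 12 = 1" using c(1) by (simp add: cong_def)
  have c24: "c mod 24 = 1 \<or> c mod 24 = 13" using c12 by presburger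
  have cop24: "coprime c 24"
  proof -
    have "coprime c 12" using c(2) n by simp
    then have "coprime c 2" "coprime c 12" by (auto intro: coprime_imp_coprime dvd_trans)
    then have "coprime c (2 * 12)" by (simp only: coprime_mult_right_iff)
    then show ?thesis by simp
  qed
  \<comment> \<open>Modulo 24, 5^2 + 3 * 0^2 = 1 and 1^2 + 3 * 2^2 = 13. In the first case the
    symbol of c1 is -1 and that of d is 1, because 4 divides d; in the second they are 1 and
    -1.\<close>
  define x0 y0 :: int where "x0 = (if c mod 24 = 1 then 5 else 1)" and "y0 = (if c mod 24 = 1 then 0 else 2)"
  have x0: "odd x0" "\<not> 3 dvd x0" by (auto simp: x0_def)
  have base: "[x0\<^sup>2 + 3 * y0\<^sup>2 = c] (mod 24)" using c24 by (auto simp: x0_def y0_def cong_def)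
  have cn: "coprime c (int n)" using c(2) n by simp
  obtain x y where xy: "[x = x0] (mod 12)" "[y = y0] (mod 12)" "[x\<^sup>2 + 3 * y\<^sup>2 = c] (mod 24 * int n)"
    using ex_norm_form_mod[OF cop24 x0 base n0 cn] by blast
  \<comment> \<open>Twice m: the coordinate at \<omega> will be 2 d, and d must stay determined
    modulo 12.\<close>
  define M where "M = 24 * int n"
  have M: "M > 0" using n0 by (simp add: M_def)
  \<comment> \<open>This is x + y \<surd>-3, as \<surd>-3 = 1 + 2 \<omega>.\<close>
  define g where "g = Eis (x + y) (2 * y)"
  have eng: "enorm g = x\<^sup>2 + 3 * y\<^sup>2" by (simp add: g_def enorm_def power2_eq_square algebra_simps)
  have "ecoprime M g"
  proof -
    have "coprime c M" unfolding M_def using cop24 cn by (simp only: coprime_mult_right_iff)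
    then obtain d where d: "[c * d = 1] (mod M)" using cong_solve_coprime_int by blast
    have "[(x\<^sup>2 + 3 * y\<^sup>2) * d = c * d] (mod M)" by (intro cong_mult cong_refl) (use xy(3) in \<open>simp add: M_def\<close>)
    then have "[enorm g * d = 1] (mod M)" using d cong_trans unfolding eng by blast
    moreover have "g * (eis_cnj g * of_int d) = of_int (enorm g * d)" using mult_eis_cnj[of g] by (simp add: mult.assoc[symmetric])
    ultimately have "econg M (g * (eis_cnj g * of_int d)) 1" by (simp only: econg_iff eis_of_int_sel eis_sel) simp
    then show ?thesis by (auto simp: ecoprime_def)
  qed
  then obtain r where r: "econg M r g" "prime (enorm r)" using dirichlet_eisenstein[OF M] by blast
  define p where "p = nat (enorm r)"
  have ip: "int p = enorm r" by (simp add: p_def)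
  have pp: "prime p" using r(2) unfolding ip[symmetric] by simp
  have r1: "[eis_re r = x + y] (mod M)" "[eis_om r = 2 * y] (mod M)" using r(1) by (auto simp: econg_iff g_def)
  have M24: "24 dvd M" by (simp add: M_def)
  have "[eis_om r = 2 * y] (mod 24)" using r1(2) M24 cong_dvd_modulus by blast
  then have ev: "24 dvd eis_om r - 2 * y" by (simp add: cong_iff_dvd_diff)
  then have "even (eis_om r)" by presburger
  then obtain d where d: "eis_om r = 2 * d" by (auto elim: evenE)
  define c1 where "c1 = eis_re r - d"
  have pcd: "int p = c1\<^sup>2 + 3 * d\<^sup>2" unfolding ip enorm_def d c1_def by (simp add: power2_eq_square algebra_simps)
  have d12: "12 dvd d - y" using ev unfolding d by presburger
  have "[eis_re r = x + y] (mod 24)" using r1(1) M24 cong_dvd_modulus by blast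
  then have "24 dvd eis_re r - (x + y)" by (simp add: cong_iff_dvd_diff)
  then have "12 dvd eis_re r - (x + y)" by (rule dvd_trans[rotated]) simp
  then have "12 dvd (eis_re r - (x + y)) - (d - y)" using d12 by (rule dvd_diff)
  then have c12': "[c1 = x] (mod 12)" by (simp add: cong_iff_dvd_diff c1_def algebra_simps)
  have "[enorm r = enorm g] (mod M)"
    unfolding enorm_def by (intro cong_add cong_diff cong_mult cong_pow) (use r1 in \<open>auto simp: g_def\<close>)
  then have pc: "[int p = c] (mod M)" unfolding ip eng using xy(3) cong_trans unfolding M_def by blast
  then have pcm: "[int p = c] (mod int m)" by (rule cong_dvd_modulus) (simp add: M_def n)
  then have "[int p = c] (mod 12)" by (rule cong_dvd_modulus) (simp add: n)
  then have "int p mod 12 = 1" using c12 by (simp add: cong_def)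
  then have p12: "p mod 12 = 1" by presburger
  then have "p \<noteq> 2" by auto
  then have "p > 2" using prime_ge_2_nat[OF pp] by linarith
  then interpret odd_prime p using pp by unfold_locales
  note L = lg_norm_form[OF p12 pcd]
  have cx: "c1 mod 12 = x0 mod 12" using cong_trans[OF c12' xy(1)] by (simp add: cong_def)
  have "[d = y] (mod 12)" using d12 by (simp add: cong_iff_dvd_diff)
  then have dy: "12 dvd d - y0" using cong_trans xy(2) by (simp add: cong_iff_dvd_diff[symmetric]) blast
  \<comment> \<open>Passing to the absolute value may negate c1 modulo 12, which is harmless: 5 and
    7, like 1 and 11, share a value of \<open>char12\<close>.\<close>
  have abs12: "nat \<bar>c1\<bar> mod 12 = nat (\<bar>c1\<bar> mod 12)" by (simp add: nat_mod_distrib)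
  have "lg c1 * lg d = -1"
  proof (cases "c mod 24 = 1")
    case True
    then have c5: "c1 mod 12 = 5" and "12 dvd d" using cx dy by (auto simp: x0_def y0_def)
    then have d4: "4 dvd d" by (auto intro: dvd_trans[of 4 12])
    have "nat \<bar>c1\<bar> mod 12 \<in> {5, 7}" unfolding abs12 using c5 by (auto simp: abs_if zmod_zminus1_eq_if)
    then have "lg c1 = -1" using L(1) by (auto simp: char12_def)
    then show ?thesis using L(3)[OF d4] by simp
  next
    case False
    then have c5: "c1 mod 12 = 1" and d4: "12 dvd d - 2" using cx dy by (auto simp: x0_def y0_def)
    have "nat \<bar>c1\<bar> mod 12 \<in> {1, 11}" unfolding abs12 using c5 by (auto simp: abs_if zmod_zminus1_eq_if)
    then have "lg c1 = 1" using L(1) by (auto simp: char12_def)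
    moreover have "\<not> 4 dvd d" using d4 by presburger
    ultimately show ?thesis using L(4) by simp
  qed
  then have "V p = 0" using no_root_mod[OF p12 pcd] by (intro V_eq_0I)
  then show ?thesis using pp pcm by blast
qed

section \<open>Infinitely many primes with solutions\<close>

lemma V_pos_of_root:
  assumes p: "prime p" "p > 2" and i: "[i\<^sup>2 = -1] (mod int p)" and z: "[z ^ 8 + 6 * z ^ 4 - 3 = 0] (mod int p)"
  shows "V p > 0"
proof -
  \<comment> \<open>The inverse of 2 modulo p, so that \<open>r\<close> is half of
    \<open>s\<close>.\<close>
  define h where "h = (int p + 1) div 2"
  have "odd (int p)" using p prime_odd_nat[of p] by auto
  then have h: "2 * h = int p + 1" unfolding h_def by presburger
  define x where "x = z\<^sup>2"
  define s where "s = x\<^sup>2 + 3"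
  define r where "r = s * h"
  \<comment> \<open>\<open>i\<close> supplies the square root of the sign in x^3 - x = -x (r - 1)^2,
    and z that of x.\<close>
  define y where "y = i * z * (r - 1)"
  have P1: "int p dvd i\<^sup>2 + 1" using i by (simp add: cong_iff_dvd_diff)
  have x4: "x ^ 4 + 6 * x\<^sup>2 - 3 = z ^ 8 + 6 * z ^ 4 - 3" by (simp add: x_def flip: power_mult)
  have P2: "int p dvd x ^ 4 + 6 * x\<^sup>2 - 3" unfolding x4 using z by (simp add: cong_0_iff)
  have s12: "s\<^sup>2 - 12 = x ^ 4 + 6 * x\<^sup>2 - 3" by (simp add: s_def power2_eq_square power4_eq_xxxx algebra_simps)
  have P3: "int p dvd 2 * r - s"
  proof -
    have "2 * r - s = s * (2 * h - 1)" by (simp add: r_def algebra_simps)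
    then show ?thesis by (simp add: h)
  qed
  have "int p dvd 4 * (y\<^sup>2 - (x ^ 3 - x))"
  proof -
    \<comment> \<open>The factor 4 clears the halves; what is left vanishes modulo p because of the
      equations for i, for r and for x.\<close>
    have "4 * (y\<^sup>2 - (x ^ 3 - x)) = (i\<^sup>2 + 1) * (x * (2 * r - 2)\<^sup>2) - x * ((2 * r - s) * (2 * r + s - 4) + (x ^ 4 + 6 * x\<^sup>2 - 3))"
      by (simp add: y_def s_def x_def power2_eq_square power3_eq_cube power4_eq_xxxx algebra_simps)
    then show ?thesis using P1 P2 P3 by simp
  qed
  moreover have "\<not> int p dvd 4"
  proof
    assume "int p dvd 4"
    then have "int p dvd 2 ^ 2" by simp
    then have "int p dvd 2" using p(1) by (metis prime_dvd_power prime_nat_int_transfer)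
    then show False using p(2) zdvd_imp_le by force
  qed
  moreover have "prime (int p)" using p(1) by simp
  ultimately have P4: "int p dvd y\<^sup>2 - (x ^ 3 - x)" using prime_dvd_multD by blast
  define S where "S = {(x::int, y::int). x \<in> {0..<int p} \<and> y \<in> {0..<int p} \<and>
      [x^4 + 6*x^2 - 3 = 0] (mod int p) \<and> [y^2 = x^3 - x] (mod int p)}"
  define x1 y1 where "x1 = x mod int p" and "y1 = y mod int p"
  have cx: "[x1 = x] (mod int p)" "[y1 = y] (mod int p)" by (simp_all add: x1_def y1_def cong_def)
  have "[x1 ^ 4 + 6 * x1\<^sup>2 - 3 = x ^ 4 + 6 * x\<^sup>2 - 3] (mod int p)"
    by (intro cong_add cong_diff cong_mult cong_pow cx cong_refl)
  then have 1: "[x1 ^ 4 + 6 * x1\<^sup>2 - 3 = 0] (mod int p)" using P2 by (metis cong_0_iff cong_dvd_iff)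
  have "[y1\<^sup>2 = y\<^sup>2] (mod int p)" "[x1 ^ 3 - x1 = x ^ 3 - x] (mod int p)"
    by (intro cong_diff cong_pow cx)+
  then have 2: "[y1\<^sup>2 = x1 ^ 3 - x1] (mod int p)" using P4 by (metis cong_iff_dvd_diff cong_sym cong_trans)
  have "(x1, y1) \<in> S" unfolding S_def using 1 2 p by (simp add: x1_def y1_def)
  moreover have "finite S" by (rule finite_subset[of _ "{0..<int p} \<times> {0..<int p}"]) (auto simp: S_def)
  ultimately have "card S > 0" using card_gt_0_iff by blast
  then show ?thesis by (simp add: V_def S_def)
qed

text \<open>Writing \<open>(n + \<i>)\<^sup>8 + 6(n + \<i>)\<^sup>4 - 3 = A + B\<i>\<close>, the primes that can divide both \<open>A\<close> and \<open>B\<close>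
  divide \<open>2 \<cdot> 11 \<cdot> 1201 \<cdot> n\<close>; any other prime dividing \<open>A\<^sup>2 + B\<^sup>2\<close> is a prime of degree one of the Gaussian
  integers at which the polynomial has a root.\<close>

lemma ex_large_prime_V_pos:
  "\<exists>p :: nat. prime p \<and> p > N \<and> [p = 1] (mod 12) \<and> V p > 0"
proof -
  \<comment> \<open>The factorial forces p > N, the factors 3, 11 and 1201 exclude primes that would
    spoil the argument below, and 4 allows the constant term 4 of A, as a polynomial in n, to be
    divided out.\<close>
  define n :: int where "n = 4 * 3 * 11 * 1201 * fact N"
  have n1: "n \<ge> 4" unfolding n_def using fact_ge_1[of N, where 'a = int] by linarith
  define w where "w = n\<^sup>2"
  \<comment> \<open>u + v i is (n + i)^4, and A + B i is the value of the octic at n + i.\<close>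
  define u where "u = w\<^sup>2 - 6 * w + 1"
  define v where "v = 4 * n * (w - 1)"
  define A where "A = u\<^sup>2 - v\<^sup>2 + 6 * u - 3"
  define B where "B = 2 * v * (u + 3)"
  define n' where "n' = 3 * 11 * 1201 * (fact N :: int)"
  have n4: "n = 4 * n'" by (simp add: n_def n'_def)
  have "\<exists>a. A = 4 * (1 + n * a)"
  proof -
    have u1: "u = 1 + w * (w - 6)" by (simp add: u_def power2_eq_square algebra_simps)
    have "A = 4 + w * ((w - 6) * (u + 1) - 16 * (w - 1)\<^sup>2 + 6 * (w - 6))"
      unfolding A_def v_def using w_def
      by (simp add: u1 power2_eq_square algebra_simps)
    also have "w = 4 * (n * n')" by (simp add: w_def n4 power2_eq_square)
    finally show ?thesis by (metis (no_types, opaque_lifting) distrib_left mult.assoc mult.right_neutral)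
  qed
  then obtain a where a: "A = 4 * (1 + n * a)" by blast
  have "\<exists>b. B = 4 * (n * b)"
    by (rule exI[of _ "2 * (w - 1) * (u + 3)"]) (simp add: B_def v_def)
  then obtain b where b: "B = 4 * (n * b)" by blast
  have B0: "B \<noteq> 0"
  proof -
    have w16: "w \<ge> 16" unfolding w_def using power_mono[OF n1, of 2] by simp
    then have "w * (w - 6) \<ge> 0" by simp
    then have "u + 3 > 0" by (simp add: u_def power2_eq_square algebra_simps)
    moreover have "v > 0" unfolding v_def using n1 w16 by simp
    ultimately show ?thesis unfolding B_def by simp
  qed
  \<comment> \<open>A^2 + B^2 = 16 T with T = 1 modulo n, so the prime factors of T avoid every
    factor of n.\<close>
  define T where "T = (1 + n * a)\<^sup>2 + (n * b)\<^sup>2"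
  have "n * b \<noteq> 0" using B0 b by simp
  moreover have "1 + n * a \<noteq> 0"
  proof
    assume "1 + n * a = 0"
    then have "n dvd 1" by (metis dvd_add_right_iff dvd_triv_left dvd_0_right add.commute dvd_add_left_iff)
    then show False using n1 by simp
  qed
  ultimately have T1: "T > 1"
  proof -
    assume "n * b \<noteq> 0" "1 + n * a \<noteq> 0"
    then have "(n * b)\<^sup>2 > 0" "(1 + n * a)\<^sup>2 > 0" by (simp_all only: zero_less_power2 not_False_eq_True)
    then show ?thesis unfolding T_def by linarith
  qed
  then have "nat T \<noteq> 1" by linarith
  then obtain p where p: "prime p" "p dvd nat T" using prime_factor_nat[of "nat T"] by blast
  have pp: "prime (int p)" using p by simp
  have pT: "int p dvd T" using p(2) T1 by (simp add: int_dvd_int_iff[symmetric] del: int_dvd_int_iff)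
  have pn: "\<not> int p dvd n"
  proof
    assume pn: "int p dvd n"
    have "T = 1 + n * (2 * a + n * a\<^sup>2 + n * b\<^sup>2)" by (simp add: T_def power2_eq_square algebra_simps)
    then have "int p dvd 1" using pT pn by (metis dvd_add_left_iff dvd_mult2)
    then show False using p(1) by auto
  qed
  have notp: "\<not> int p dvd k" if "k dvd n" for k using pn that dvd_trans by blast
  have p2: "\<not> int p dvd 2" by (rule notp) (simp add: n_def)
  have p3: "\<not> int p dvd 3" by (rule notp) (simp add: n_def)
  have p11: "\<not> int p dvd 11" by (rule notp) (simp add: n_def)
  have p1201: "\<not> int p dvd 1201" by (rule notp) (simp add: n_def)
  have pN: "p > N"
  proof (rule ccontr)
    assume "\<not> p > N"
    then have "p dvd fact N" using prime_ge_1_nat[OF p(1)] by (intro dvd_fact) auto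
    then have "int p dvd int (fact N)" by (simp only: int_dvd_int_iff)
    then have "int p dvd fact N" by simp
    then show False using notp[of "fact N"] by (simp add: n_def)
  qed
  have pAB: "int p dvd A\<^sup>2 + B\<^sup>2"
  proof -
    have "A\<^sup>2 + B\<^sup>2 = 16 * T" by (simp add: a b T_def power2_eq_square algebra_simps)
    then show ?thesis using pT by simp
  qed
  have pB: "\<not> int p dvd B"
  proof
    assume pB: "int p dvd B"
    then have "int p dvd B\<^sup>2" by (simp add: power2_eq_square)
    then have "int p dvd A\<^sup>2" using pAB by (simp add: dvd_add_left_iff)
    then have pA: "int p dvd A" using pp prime_dvd_power by blast
    have "B = 2 * (2 * (2 * (n * ((w - 1) * (u + 3)))))" by (simp add: B_def v_def algebra_simps)
    then have "int p dvd 2 * (2 * (2 * (n * ((w - 1) * (u + 3)))))" using pB by (simp only:)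
    then have "int p dvd w - 1 \<or> int p dvd u + 3" using p2 pn pp by (simp only: prime_dvd_mult_iff) blast
    then show False
    proof
      assume w1: "int p dvd w - 1"
      \<comment> \<open>At w = 1 the real part A takes the value -11.\<close>
      have "A + 11 = (w - 1) * ((w - 5) * (u + 2) - 16 * w * (w - 1))"
      proof -
        have e: "u + 4 = (w - 1) * (w - 5)" by (simp add: u_def power2_eq_square algebra_simps)
        have "A + 11 = (u + 4) * (u + 2) - 16 * w * (w - 1)\<^sup>2"
          unfolding A_def v_def w_def by (simp add: power2_eq_square algebra_simps)
        then have "A + 11 = ((w - 1) * (w - 5)) * (u + 2) - 16 * w * (w - 1)\<^sup>2" unfolding e .
        then show ?thesis by (simp add: power2_eq_square algebra_simps)
      qed
      then have "int p dvd A + 11" using w1 by simp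
      then have "int p dvd 11" using pA by (simp add: dvd_add_right_iff)
      then show False using p11 by simp
    next
      assume u3: "int p dvd u + 3"
      have A': "A = (u + 3) * (u + 3) - (16 * w * (w - 1)\<^sup>2 + 12)"
        unfolding A_def v_def w_def by (simp add: power2_eq_square algebra_simps)
      then have "int p dvd (u + 3) * (u + 3) - A" using u3 pA by (intro dvd_diff) auto
      then have D: "int p dvd 16 * w * (w - 1)\<^sup>2 + 12" using A' by simp
      have U: "u + 3 = w\<^sup>2 - 6 * w + 4" by (simp add: u_def)
      have "16 * w * (w - 1)\<^sup>2 + 12 = (u + 3) * (16 * w + 64) + 4 * (84 * w - 61)"
        unfolding U by (simp add: power2_eq_square algebra_simps)
      then have "int p dvd 4 * (84 * w - 61)" using D u3 by (metis dvd_add_right_iff dvd_mult2)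
      then have "int p dvd 2 * (2 * (84 * w - 61))" by simp
      then have E: "int p dvd 84 * w - 61" using p2 pp by (simp only: prime_dvd_mult_iff) blast
      \<comment> \<open>A resultant: 84^2 (w^2 - 6 w + 4) takes the value 1201 at w = 61/84.\<close>
      have "1201 = 7056 * (u + 3) - (84 * w - 443) * (84 * w - 61)"
        unfolding U by (simp add: power2_eq_square algebra_simps)
      then have "int p dvd 1201" using u3 E by (metis dvd_diff dvd_mult)
      then show False using p1201 by simp
    qed
  qed
  \<comment> \<open>t is - A / B modulo p, hence a square root of -1; reducing i to t sends n + i to
    a root z of the octic.\<close>
  obtain t where t: "int p dvd A + B * t" using solve_linear_mod_prime[OF pp pB] by blast
  have "int p dvd B\<^sup>2 * (t\<^sup>2 + 1)"
  proof -
    have "B\<^sup>2 * (t\<^sup>2 + 1) = (A + B * t) * (B * t - A) + (A\<^sup>2 + B\<^sup>2)" by (simp add: power2_eq_square algebra_simps)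
    then show ?thesis using t pAB by simp
  qed
  then have t2: "int p dvd t\<^sup>2 + 1" using pB pp by (simp add: prime_dvd_mult_iff prime_dvd_power_iff)
  then have i: "[t\<^sup>2 = -1] (mod int p)" by (simp add: cong_iff_dvd_diff)
  have pg2: "p > 2" using p2 prime_ge_2_nat[OF p(1)] by (cases "p = 2") auto
  define z where "z = n + t"
  have z4: "[z ^ 4 = u + v * t] (mod int p)"
  proof -
    have "z ^ 4 - (u + v * t) = (t\<^sup>2 + 1) * (t\<^sup>2 + 4 * n * t + 6 * w - 1)"
      by (simp add: z_def u_def v_def w_def power2_eq_square power4_eq_xxxx algebra_simps)
    then show ?thesis using t2 by (simp add: cong_iff_dvd_diff)
  qed
  have z8: "[z ^ 8 + 6 * z ^ 4 - 3 = A + B * t] (mod int p)"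
  proof -
    have e: "z ^ 8 = (z ^ 4)\<^sup>2" by (simp flip: power_mult)
    have "[z ^ 8 + 6 * z ^ 4 - 3 = (u + v * t)\<^sup>2 + 6 * (u + v * t) - 3] (mod int p)"
      unfolding e by (intro cong_add cong_diff cong_mult cong_pow z4 cong_refl)
    moreover have "(u + v * t)\<^sup>2 + 6 * (u + v * t) - 3 - (A + B * t) = (t\<^sup>2 + 1) * v\<^sup>2"
      by (simp add: A_def B_def power2_eq_square algebra_simps)
    then have "[(u + v * t)\<^sup>2 + 6 * (u + v * t) - 3 = A + B * t] (mod int p)"
      using t2 by (simp add: cong_iff_dvd_diff)
    ultimately show ?thesis using cong_trans by blast
  qed
  then have z: "[z ^ 8 + 6 * z ^ 4 - 3 = 0] (mod int p)" using t by (metis cong_0_iff cong_dvd_iff)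
  have V: "V p > 0" by (rule V_pos_of_root[OF p(1) pg2 i z])
  interpret odd_prime p using p(1) pg2 by unfold_locales
  have pt: "\<not> int p dvd t"
  proof
    assume "int p dvd t"
    then have "int p dvd 1" using t2 by (metis dvd_add_right_iff dvd_mult power2_eq_square)
    then show False using p(1) by auto
  qed
  have "lg (-1) = 1" using lg_cong[OF i] lg_square[OF pt] by simp
  have p4: "p mod 4 = 1"
  proof (rule ccontr)
    assume "p mod 4 \<noteq> 1"
    moreover have "odd p" using p(1) pg2 prime_odd_nat by auto
    ultimately have "odd ((p - 1) div 2)" by presburger
    then have "lg (-1) = -1" using lg_euler[of "-1"] by (intro lg_eqI) (auto simp: minus_one_power_iff)
    then show False using \<open>lg (-1) = 1\<close> by simp
  qed
  \<comment> \<open>z^4 + 3 is a square root of 12: it is the s = x^2 + 3 of the quartic at x =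
    z^2.\<close>
  have "lg 12 = 1"
  proof -
    have "z ^ 8 = z ^ 4 * z ^ 4" by (simp flip: power_add)
    then have e: "(z ^ 4 + 3)\<^sup>2 - 12 = z ^ 8 + 6 * z ^ 4 - 3" by (simp add: power2_eq_square algebra_simps)
    then have c: "[(z ^ 4 + 3)\<^sup>2 = 12] (mod int p)" using z by (simp add: cong_iff_dvd_diff cong_0_iff)
    have "\<not> int p dvd z ^ 4 + 3"
    proof
      assume "int p dvd z ^ 4 + 3"
      then have "int p dvd (z ^ 4 + 3)\<^sup>2" by (simp add: power2_eq_square)
      then have "int p dvd 2 * (2 * 3)" using c cong_dvd_iff by fastforce
      then show False using p2 p3 pp by (simp only: prime_dvd_mult_iff) blast
    qed
    then show ?thesis using lg_cong[OF c] lg_square by metis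
  qed
  moreover have "lg 12 = lg 2 * lg 2 * lg 3" by (simp flip: lg_mult)
  ultimately have l3: "lg 3 = 1" using lg_sq_self[OF p2] by simp
  have pg3: "p > 3" using pg2 p3 by (cases "p = 3") auto
  have "char12 p = 1" using Legendre_3[OF p(1) pg3] l3 by simp
  then have "p mod 12 \<in> {1, 11}" by (auto simp: char12_def split: if_splits)
  then have "p mod 12 = 1" using p4 by (auto; presburger)
  then have "[p = 1] (mod 12)" by (simp add: cong_def)
  then show ?thesis using p(1) pN V by blast
qed

theorem theorem2:
  shows "infinite {p :: nat. prime p \<and> [p = 1] (mod 12) \<and> V p > 0}
    \<and> (\<forall>(m::nat) (c::int). m > 0 \<longrightarrow> 12 dvd m \<longrightarrow> [c = 1] (mod 12) \<longrightarrow> coprime c (int m) \<longrightarrow>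
         (\<exists>p :: nat. prime p \<and> [int p = c] (mod int m) \<and> V p = 0))"
proof
  show "infinite {p :: nat. prime p \<and> [p = 1] (mod 12) \<and> V p > 0}"
    unfolding infinite_nat_iff_unbounded using ex_large_prime_V_pos by blast
qed (use ex_prime_V_eq_0 in blast)

end
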